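(* For every non-trivial height 1 condition $\Sigma$ there exists a relational structure $\mathbb{B}$ such that: (i) $\mathbb{B}$ is a first-order reduct of a finitely bounded homogeneous structure; (ii) $\mathrm{Pol}(\mathbb{B})$ does not satisfy $\Sigma$; (iii) $\mathrm{Pol}(\mathbb{B})$ satisfies some other non-trivial height 1 condition (consequently there is no minion homomorphism from $\mathrm{Pol}(\mathbb{B})$ to $\mathcal{P}$); (iv) $\mathrm{CSP}(\mathbb{B})$ is solvable in polynomial time.
   Context: A clone on a set $A$ is a set of finitary operations on $A$ that contains all projections and is closed under composition. $\mathcal{P}$ denotes the clone on $\{0,1\}$ consisting of all projections. For a relational structure $\mathbb{A}$, a polymorphism is a homomorphism from the power $\mathbb{A}^n$ (domain $A^n$, relations defined componentwise) to $\mathbb{A}$ for some $n\ge 1$; $\mathrm{Pol}(\mathbb{A})$ is the clone of all polymorphisms. A height 1 identity is an expression $f(x_{\pi(1)},\dots,x_{\pi(n)})\approx g(x_{\rho(1)},\dots,x_{\rho(m)})$ where $f,g$ are function symbols of arities $n,m$ and $\pi:\{1,\dots,n\}\to\{1,\dots,r\}$, $\rho:\{1,\dots,m\}\to\{1,\dots,r\}$ are arbitrary maps; it is understood as universally quantified over $x_1,\dots,x_r$. A height 1 condition is a finite set $\Sigma$ of height 1 identities (several may share symbols). A set $\mathcal{A}$ of functions on $A$ satisfies $\Sigma$ if each symbol of $\Sigma$ can be assigned a function in $\mathcal{A}$ of the corresponding arity so that every identity of $\Sigma$ holds for all values of the variables in $A$. $\Sigma$ is trivial if it is satisfied in every clone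 (equivalently, in $\mathcal{P}$). A minion homomorphism between clones $\mathcal{A}\to\mathcal{B}$ is an arity-preserving map $\xi$ such that for all $n$-ary $f\in\mathcal{A}$ and all $\pi:\{1,\dots,n\}\to\{1,\dots,k\}$, $\xi$ maps the $k$-ary function $(x_1,\dots,x_k)\mapsto f(x_{\pi(1)},\dots,x_{\pi(n)})$ to $(x_1,\dots,x_k)\mapsto \xi(f)(x_{\pi(1)},\dots,x_{\pi(n)})$. A structure $\mathbb{A}$ is homogeneous if every isomorphism between finite substructures extends to an automorphism of $\mathbb{A}$; it is finitely bounded if its signature is finite and there is a finite set $\mathcal{F}$ of finite structures such that a finite structure in the signature embeds into $\mathbb{A}$ iff no member of $\mathcal{F}$ embeds into it. $\mathbb{B}$ is a first-order reduct of $\mathbb{A}$ if they have the same domain and every relation of $\mathbb{B}$ is first-order definable in $\mathbb{A}$. For a structure $\mathbb{B}$ with a finite relational signature, $\mathrm{CSP}(\mathbb{B})$ is the problem of deciding whether a given finite conjunction of atomic formulas over the signature of $\mathbb{B}$ is satisfiable in $\mathbb{B}$. *)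

theory Defs
  imports Main
begin

record ('a, 'r) rstruct =
  sdom :: "'a set"
  ssig :: "'r set"
  sar  :: "'r \<Rightarrow> nat"
  srel :: "'r \<Rightarrow> 'a list set"

definition wf_struct :: "('a, 'r) rstruct \<Rightarrow> bool" where
  "wf_struct S \<longleftrightarrow> (\<forall>r\<in>ssig S. \<forall>xs\<in>srel S r. length xs = sar S r \<and> set xs \<subseteq> sdom S)"

text \<open>An n-ary operation on A is represented canonically by a function on lists which
  is undefined outside A^n.\<close>
definition ext_op :: "'a set \<Rightarrow> nat \<Rightarrow> ('a list \<Rightarrow> 'a) \<Rightarrow> bool" where
  "ext_op A n f \<longleftrightarrow> (\<forall>xs. \<not> (length xs = n \<and> set xs \<subseteq> A) \<longrightarrow> f xs = undefined)"

definition Pol :: "('a, 'r) rstruct \<Rightarrow> nat \<Rightarrow> ('a list \<Rightarrow> 'a) set" where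
  "Pol B n = {f. n \<ge> 1 \<and> ext_op (sdom B) n f
     \<and> (\<forall>xs. length xs = n \<and> set xs \<subseteq> sdom B \<longrightarrow> f xs \<in> sdom B)
     \<and> (\<forall>r\<in>ssig B. \<forall>ts. length ts = n \<and> set ts \<subseteq> srel B r \<longrightarrow>
          map (\<lambda>j. f (map (\<lambda>t. t ! j) ts)) [0..<sar B r] \<in> srel B r)}"

definition proj_ops :: "nat \<Rightarrow> (bool list \<Rightarrow> bool) set" where
  "proj_ops n = {(\<lambda>xs. if length xs = n then xs ! i else undefined) | i. i < n}"

definition minor :: "'a set \<Rightarrow> nat \<Rightarrow> nat list \<Rightarrow> ('a list \<Rightarrow> 'a) \<Rightarrow> ('a list \<Rightarrow> 'a)" where
  "minor A k \<pi> f = (\<lambda>ys. if length ys = k \<and> set ys \<subseteq> A then f (map (\<lambda>i. ys ! i) \<pi>) else undefined)"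

definition minion_hom_to_P :: "('a, 'r) rstruct \<Rightarrow> (nat \<Rightarrow> ('a list \<Rightarrow> 'a) \<Rightarrow> (bool list \<Rightarrow> bool)) \<Rightarrow> bool" where
  "minion_hom_to_P B \<xi> \<longleftrightarrow>
     (\<forall>n f. f \<in> Pol B n \<longrightarrow> \<xi> n f \<in> proj_ops n) \<and>
     (\<forall>n k f \<pi>. f \<in> Pol B n \<and> k \<ge> 1 \<and> length \<pi> = n \<and> set \<pi> \<subseteq> {..<k} \<longrightarrow>
        \<xi> k (minor (sdom B) k \<pi> f) = minor UNIV k \<pi> (\<xi> n f))"

text \<open>A height 1 condition: an arity for each function symbol, and a finite list of identities
  (f, \<pi>, g, \<rho>) meaning f(x_\<pi>(1),...,x_\<pi>(n)) = g(x_\<rho>(1),...,x_\<rho>(m)); variables are natural numbers.\<close>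
type_synonym 'f h1cond = "('f \<Rightarrow> nat) \<times> ('f \<times> nat list \<times> 'f \<times> nat list) list"

definition h1_wf :: "'f h1cond \<Rightarrow> bool" where
  "h1_wf \<Sigma> \<longleftrightarrow> (\<forall>(f, \<pi>, g, \<rho>) \<in> set (snd \<Sigma>).
      length \<pi> = fst \<Sigma> f \<and> length \<rho> = fst \<Sigma> g \<and> fst \<Sigma> f \<ge> 1 \<and> fst \<Sigma> g \<ge> 1)"

definition satisfies :: "'a set \<Rightarrow> (nat \<Rightarrow> ('a list \<Rightarrow> 'a) set) \<Rightarrow> 'f h1cond \<Rightarrow> bool" where
  "satisfies A ops \<Sigma> \<longleftrightarrow> (\<exists>I. (\<forall>(f, \<pi>, g, \<rho>) \<in> set (snd \<Sigma>). I f \<in> ops (fst \<Sigma> f) \<and> I g \<in> ops (fst \<Sigma> g)) \<and>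
      (\<forall>(f, \<pi>, g, \<rho>) \<in> set (snd \<Sigma>). \<forall>x. (\<forall>i. x i \<in> A) \<longrightarrow> I f (map x \<pi>) = I g (map x \<rho>)))"

definition h1_trivial :: "'f h1cond \<Rightarrow> bool" where
  "h1_trivial \<Sigma> \<longleftrightarrow> satisfies (UNIV :: bool set) proj_ops \<Sigma>"

datatype 'r fo = FEq nat nat | FRel 'r "nat list" | FNeg "'r fo" | FConj "'r fo" "'r fo" | FEx nat "'r fo"

fun holds :: "('a, 'r) rstruct \<Rightarrow> 'r fo \<Rightarrow> (nat \<Rightarrow> 'a) \<Rightarrow> bool" where
  "holds S (FEq i j) x = (x i = x j)"
| "holds S (FRel r vs) x = (map x vs \<in> srel S r)"
| "holds S (FNeg \<phi>) x = (\<not> holds S \<phi> x)"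
| "holds S (FConj \<phi> \<psi>) x = (holds S \<phi> x \<and> holds S \<psi> x)"
| "holds S (FEx v \<phi>) x = (\<exists>a\<in>sdom S. holds S \<phi> (x(v := a)))"

fun fv :: "'r fo \<Rightarrow> nat set" where
  "fv (FEq i j) = {i, j}"
| "fv (FRel r vs) = set vs"
| "fv (FNeg \<phi>) = fv \<phi>"
| "fv (FConj \<phi> \<psi>) = fv \<phi> \<union> fv \<psi>"
| "fv (FEx v \<phi>) = fv \<phi> - {v}"

fun syms :: "'r fo \<Rightarrow> 'r set" where
  "syms (FEq i j) = {}"
| "syms (FRel r vs) = {r}"
| "syms (FNeg \<phi>) = syms \<phi>"
| "syms (FConj \<phi> \<psi>) = syms \<phi> \<union> syms \<psi>"
| "syms (FEx v \<phi>) = syms \<phi>"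

definition fo_reduct :: "('a, 'r) rstruct \<Rightarrow> ('a, 's) rstruct \<Rightarrow> bool" where
  "fo_reduct B C \<longleftrightarrow> sdom B = sdom C \<and>
     (\<forall>r\<in>ssig B. \<exists>\<phi>. fv \<phi> \<subseteq> {..<sar B r} \<and> syms \<phi> \<subseteq> ssig C \<and>
        srel B r = {xs. length xs = sar B r \<and> set xs \<subseteq> sdom C \<and> holds C \<phi> (\<lambda>i. xs ! i)})"

definition partial_iso :: "('a, 'r) rstruct \<Rightarrow> 'a set \<Rightarrow> ('a \<Rightarrow> 'a) \<Rightarrow> bool" where
  "partial_iso C X h \<longleftrightarrow> X \<subseteq> sdom C \<and> inj_on h X \<and> h ` X \<subseteq> sdom C \<and>
     (\<forall>r\<in>ssig C. \<forall>xs. length xs = sar C r \<and> set xs \<subseteq> X \<longrightarrow> (xs \<in> srel C r \<longleftrightarrow> map h xs \<in> srel C r))"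

definition automorphism :: "('a, 'r) rstruct \<Rightarrow> ('a \<Rightarrow> 'a) \<Rightarrow> bool" where
  "automorphism C g \<longleftrightarrow> bij_betw g (sdom C) (sdom C) \<and>
     (\<forall>r\<in>ssig C. \<forall>xs. length xs = sar C r \<and> set xs \<subseteq> sdom C \<longrightarrow> (xs \<in> srel C r \<longleftrightarrow> map g xs \<in> srel C r))"

definition homogeneous :: "('a, 'r) rstruct \<Rightarrow> bool" where
  "homogeneous C \<longleftrightarrow> (\<forall>X h. finite X \<and> partial_iso C X h \<longrightarrow>
      (\<exists>g. automorphism C g \<and> (\<forall>x\<in>X. g x = h x)))"

definition embeds :: "('b, 'r) rstruct \<Rightarrow> ('a, 'r) rstruct \<Rightarrow> bool" where
  "embeds M N \<longleftrightarrow> (\<exists>e. inj_on e (sdom M) \<and> e ` sdom M \<subseteq> sdom N \<and>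
     (\<forall>r\<in>ssig M. \<forall>xs. length xs = sar M r \<and> set xs \<subseteq> sdom M \<longrightarrow> (xs \<in> srel M r \<longleftrightarrow> map e xs \<in> srel N r)))"

text \<open>Finite structures in the signature of C (domains taken inside nat; every finite
  structure is isomorphic to one of these).\<close>
definition finite_struct_in_sig :: "('a, 'r) rstruct \<Rightarrow> (nat, 'r) rstruct \<Rightarrow> bool" where
  "finite_struct_in_sig C M \<longleftrightarrow> wf_struct M \<and> finite (sdom M) \<and> ssig M = ssig C \<and>
     (\<forall>r\<in>ssig C. sar M r = sar C r)"

definition finitely_bounded :: "('a, 'r) rstruct \<Rightarrow> bool" where
  "finitely_bounded C \<longleftrightarrow> finite (ssig C) \<and>
     (\<exists>F. finite F \<and> (\<forall>N\<in>F. finite_struct_in_sig C N) \<and>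
        (\<forall>M. finite_struct_in_sig C M \<longrightarrow> (embeds M C \<longleftrightarrow> \<not> (\<exists>N\<in>F. embeds N M))))"

definition csp_instance :: "('a, 'r) rstruct \<Rightarrow> ('r \<times> nat list) list \<Rightarrow> bool" where
  "csp_instance B inst \<longleftrightarrow> (\<forall>(r, vs) \<in> set inst. r \<in> ssig B \<and> length vs = sar B r)"

definition csp_sat :: "('a, 'r) rstruct \<Rightarrow> ('r \<times> nat list) list \<Rightarrow> bool" where
  "csp_sat B inst \<longleftrightarrow> (\<exists>s. (\<forall>(r, vs) \<in> set inst. set (map s vs) \<subseteq> sdom B \<and> map s vs \<in> srel B r))"

fun bin :: "nat \<Rightarrow> nat list" where
  "bin n = (if n < 2 then [n + 1] else (n mod 2 + 1) # bin (n div 2))"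

definition enc_atom :: "nat \<times> nat list \<Rightarrow> nat list" where
  "enc_atom a = bin (fst a) @ concat (map (\<lambda>v. 3 # bin v) (snd a)) @ [4]"

definition enc_inst :: "(nat \<times> nat list) list \<Rightarrow> nat list" where
  "enc_inst inst = concat (map enc_atom inst)"

text \<open>Deterministic single-tape Turing machines: states 0..<Q (0 start, 1 accept, 2 reject),
  tape symbols 0..<S (0 blank), transition function delta.\<close>
record tm =
  tm_Q :: nat
  tm_S :: nat
  tm_delta :: "nat \<Rightarrow> nat \<Rightarrow> nat \<times> nat \<times> int"

definition wf_tm :: "tm \<Rightarrow> bool" where
  "wf_tm M \<longleftrightarrow> tm_Q M \<ge> 3 \<and> tm_S M \<ge> 5 \<and>
     (\<forall>q<tm_Q M. \<forall>s<tm_S M. case tm_delta M q s of (q', w, m) \<Rightarrow>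
        q' < tm_Q M \<and> w < tm_S M \<and> m \<in> {-1, 0, 1})"

type_synonym config = "nat \<times> (int \<Rightarrow> nat) \<times> int"

definition tm_step :: "tm \<Rightarrow> config \<Rightarrow> config" where
  "tm_step M c = (case c of (q, tp, h) \<Rightarrow>
     if q = 1 \<or> q = 2 then (q, tp, h)
     else (case tm_delta M q (tp h) of (q', w, m) \<Rightarrow> (q', tp(h := w), h + m)))"

definition tm_init :: "nat list \<Rightarrow> config" where
  "tm_init w = (0, (\<lambda>i. if 0 \<le> i \<and> i < int (length w) then w ! nat i else 0), 0)"

definition csp_in_P :: "('a, nat) rstruct \<Rightarrow> bool" where
  "csp_in_P B \<longleftrightarrow> (\<exists>M c d. wf_tm M \<and> (\<forall>inst. csp_instance B inst \<longrightarrow>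
     (\<exists>t \<le> c * (length (enc_inst inst) + 1) ^ d.
        let q = fst ((tm_step M ^^ t) (tm_init (enc_inst inst))) in
        (q = 1 \<or> q = 2) \<and> (q = 1 \<longleftrightarrow> csp_sat B inst))))"

end

theory Submission
  imports Defs "HOL-Library.Nat_Bijection" "HOL-Library.Countable"
begin

text \<open>
  A non-trivial condition \<open>\<Sigma>\<close> is read as a conjunctive query: the variables are the identities of
  \<open>\<Sigma>\<close>, and every symbol \<open>f\<close> contributes one atom \<open>R\<^sub>f\<close> on the identities in which it occurs.
  Let \<open>\<bbbA>\<close> live on the variables of \<open>\<Sigma>\<close>, with \<open>R\<^sub>f\<close> consisting of the tuples that some fixed
  argument of \<open>f\<close> takes along its occurrences. The query holds in \<open>\<bbbA>\<close> iff projections satisfy \<open>\<Sigma>\<close>,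
  so it fails in \<open>\<bbbA>\<close>; a set of symbols that is minimal with this property gives a connected query.
  Let \<open>B\<close> be a universal structure in which the query fails. Polymorphisms satisfying \<open>\<Sigma>\<close>, applied to a
  copy of \<open>\<bbbA>\<close> in \<open>B\<close>, would produce a solution of the query in \<open>B\<close>. Universality of \<open>B\<close> yields
  a quasi near-unanimity polymorphism of every arity that exceeds the number of places of the query, and it
  reduces the CSP of \<open>B\<close> to evaluating the query on the instance.

  To see that \<open>B\<close> is a reduct of a finitely bounded homogeneous structure, expand structures by the
  primitive positive formulas obtained from subqueries by quantifying some of the variables.
  The resulting universal theory only needs two closure rules, and these give strong amalgamation:
  a subquery in a free amalgam splits into two parts that share variables in the common substructure only.
\<close>

section \<open>Structured programs on a Turing tape\<close>

text \<open>Connectedness decides whether a universal structure exists. If the query split into two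
  parts without common variables, each part could hold in a structure omitting the query, but no
  structure omitting the query could contain both; hence the minimal unsolvable set of symbols. The
  expansion is forced too: a solution of the query may arise across two amalgamated structures, half
  of it on each side, and the common part does not show this unless partial queries with free
  variables in it are recorded as relations. The quasi near-unanimity operation rests on counting: a
  majority vote changes each tuple in at most one coordinate, and a solution of the query involves
  one tuple per place, so with more coordinates than places some coordinate projects to a solution
  in \<open>B\<close>. Polynomial time refers to a concrete single-tape machine; the search for a
  solution of the query is therefore written with pointers into the input and compiled in two
  stages.\<close>

text \<open>A machine state is a stack of programs still to be run; only finitely many stacks are reachable.\<close>

datatype prog = Act "nat \<Rightarrow> nat \<times> int" | Seq prog prog | Cond "nat \<Rightarrow> bool" prog prog | Loop "nat \<Rightarrow> bool" prog

fun sstep :: "prog list \<Rightarrow> nat \<Rightarrow> prog list \<times> nat \<times> int" where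
  "sstep [] s = ([], s, 0)"
| "sstep (Act g # k) s = (k, fst (g s), snd (g s))"
| "sstep (Seq p q # k) s = (p # q # k, s, 0)"
| "sstep (Cond P p q # k) s = ((if P s then p else q) # k, s, 0)"
| "sstep (Loop P p # k) s = (if P s then p # Loop P p # k else k, s, 0)"

definition kstep :: "prog list \<times> (int \<Rightarrow> nat) \<times> int \<Rightarrow> prog list \<times> (int \<Rightarrow> nat) \<times> int" where
  "kstep c = (case c of (k, tp, h) \<Rightarrow> case sstep k (tp h) of (k', w, m) \<Rightarrow> (k', tp(h := w), h + m))"

text \<open>The quantifier over the stack \<open>k\<close> below \<open>p\<close> makes executions
  composable: a subprogram hands control to whatever waits beneath it, so runs of parts can be
  concatenated inside a larger program.\<close>

definition runs :: "prog \<Rightarrow> (int \<Rightarrow> nat) \<Rightarrow> int \<Rightarrow> nat \<Rightarrow> (int \<Rightarrow> nat) \<Rightarrow> int \<Rightarrow> bool" where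
  "runs p tp h t tp' h' \<longleftrightarrow> (\<forall>k. (kstep ^^ t) (p # k, tp, h) = (k, tp', h'))"

lemma funpow_trans:
  assumes "(f ^^ m) a = b" "(f ^^ n) b = c" shows "(f ^^ (m + n)) a = c"
  using assms by (simp add: funpow_add add.commute[of m])

lemma runs_Act: "runs (Act g) tp h 1 (tp(h := fst (g (tp h)))) (h + snd (g (tp h)))"
  by (simp add: runs_def kstep_def split: prod.splits)

lemma runs_Seq:
  assumes "runs p tp h t tp' h'" "runs q tp' h' u tp'' h''"
  shows "runs (Seq p q) tp h (Suc (t + u)) tp'' h''"
  unfolding runs_def
proof
  fix k
  have "(kstep ^^ t) (p # q # k, tp, h) = (q # k, tp', h')" "(kstep ^^ u) (q # k, tp', h') = (k, tp'', h'')"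
    using assms by (auto simp: runs_def)
  then have "(kstep ^^ (t + u)) (p # q # k, tp, h) = (k, tp'', h'')"
    by (rule funpow_trans)
  then show "(kstep ^^ Suc (t + u)) (Seq p q # k, tp, h) = (k, tp'', h'')"
    by (simp only: funpow_Suc_right o_def) (simp add: kstep_def)
qed

lemma runs_Cond:
  assumes "runs (if P (tp h) then p else q) tp h t tp' h'"
  shows "runs (Cond P p q) tp h (Suc t) tp' h'"
  using assms unfolding runs_def
  by (simp only: funpow_Suc_right o_def) (simp add: kstep_def)

lemma runs_Loop_False:
  assumes "\<not> P (tp h)" shows "runs (Loop P p) tp h 1 tp h"
  using assms by (simp add: runs_def kstep_def)

lemma runs_Loop_True:
  assumes "P (tp h)" "runs p tp h t tp' h'" "runs (Loop P p) tp' h' u tp'' h''"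
  shows "runs (Loop P p) tp h (Suc (t + u)) tp'' h''"
  unfolding runs_def
proof
  fix k
  have "(kstep ^^ (t + u)) (p # Loop P p # k, tp, h) = (k, tp'', h'')"
    using assms by (intro funpow_trans) (auto simp: runs_def)
  then show "(kstep ^^ Suc (t + u)) (Loop P p # k, tp, h) = (k, tp'', h'')"
    using assms(1) by (simp only: funpow_Suc_right o_def) (simp add: kstep_def)
qed

fun wf_prog :: "nat \<Rightarrow> prog \<Rightarrow> bool" where
  "wf_prog S (Act g) = (\<forall>s<S. fst (g s) < S \<and> snd (g s) \<in> {-1, 0, 1})"
| "wf_prog S (Seq p q) = (wf_prog S p \<and> wf_prog S q)"
| "wf_prog S (Cond P p q) = (wf_prog S p \<and> wf_prog S q)"
| "wf_prog S (Loop P p) = wf_prog S p"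

text \<open>Covers all stacks that arise while \<open>p\<close> runs above \<open>k\<close>, until
  \<open>k\<close> is exposed. The set is finite although loops may run forever, since each
  iteration restores the same stack.\<close>

fun conts :: "prog \<Rightarrow> prog list \<Rightarrow> prog list set" where
  "conts (Act g) k = {Act g # k}"
| "conts (Seq p q) k = {Seq p q # k} \<union> conts p (q # k) \<union> conts q k"
| "conts (Cond P p q) k = {Cond P p q # k} \<union> conts p k \<union> conts q k"
| "conts (Loop P p) k = {Loop P p # k} \<union> conts p (Loop P p # k)"

lemma finite_conts: "finite (conts p k)"
  by (induction p arbitrary: k) auto

lemma conts_self: "p # k \<in> conts p k"
  by (cases p) auto

lemma conts_step_any:
  assumes "k' \<in> conts p k"
  shows "fst (sstep k' s) \<in> insert k (conts p k)"
  using assms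
proof (induction p arbitrary: k k')
  case (Act g)
  then show ?case by auto
next
  case (Seq p q)
  from Seq.prems consider "k' = Seq p q # k" | "k' \<in> conts p (q # k)" | "k' \<in> conts q k" by auto
  then show ?case
    by cases (use conts_self[of p "q # k"] conts_self[of q k] Seq.IH(1)[of k' "q # k"] Seq.IH(2)[of k' k] in auto)
next
  case (Cond P p q)
  from Cond.prems consider "k' = Cond P p q # k" | "k' \<in> conts p k" | "k' \<in> conts q k" by auto
  then show ?case
    by cases (use conts_self[of p k] conts_self[of q k] Cond.IH(1)[of k' k] Cond.IH(2)[of k' k] in auto)
next
  case (Loop P p)
  from Loop.prems consider "k' = Loop P p # k" | "k' \<in> conts p (Loop P p # k)" by auto
  then show ?case
    by cases (use conts_self[of p "Loop P p # k"] Loop.IH[of k' "Loop P p # k"] in auto)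
qed

lemma conts_step:
  assumes "wf_prog S p" "k' \<in> conts p k" "s < S"
  shows "fst (snd (sstep k' s)) < S \<and> snd (snd (sstep k' s)) \<in> {-1, 0, 1}"
  using assms by (induction p arbitrary: k) auto

text \<open>The reachable stacks become states. The empty stack is a state as well; its single
  further step inspects the scanned symbol and accepts or rejects, which accounts for
  \<open>Suc t\<close>.\<close>

lemma tm_of_prog:
  assumes wf: "wf_prog S p" and S: "S \<ge> 5"
  shows "\<exists>M. wf_tm M \<and> (\<forall>w t tp' h'.
    runs p (\<lambda>i. if 0 \<le> i \<and> i < int (length w) then w ! nat i else 0) 0 t tp' h' \<longrightarrow>
      fst ((tm_step M ^^ Suc t) (tm_init w)) = (if acc (tp' h') then 1 else 2))"
proof -
  define K where "K = insert [] (conts p [])"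
  have finK: "finite K" by (simp add: K_def finite_conts)
  then obtain ix where ix: "bij_betw ix K {..<card K}"
    using ex_bij_betw_finite_nat atLeast0LessThan by metis
  \<comment> \<open>The start state must be 0 and the halting states are 1 and 2, so
    \<open>[p]\<close> is pinned to 0 and all other stacks are shifted by 3.\<close>
  define e where "e k = (if k = [p] then 0 else 3 + ix k)" for k
  have pK: "[p] \<in> K" by (simp add: K_def conts_self)
  have inj: "inj_on e K"
    using ix by (auto simp: inj_on_def bij_betw_def e_def)
  have eQ: "e k < 3 + card K" if "k \<in> K" for k
    using ix that by (auto simp: e_def bij_betw_def)
  have e12: "e k \<noteq> Suc 0" "e k \<noteq> 2" for k by (auto simp: e_def)
  define d where "d q = (if q \<in> e ` K then inv_into K e q else [])" for q
  have de: "d (e k) = k" if "k \<in> K" for k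
    using that inj by (auto simp: d_def)
  have dK: "d q \<in> K" for q
    using inv_into_into[of q e K] by (cases "q \<in> e ` K") (auto simp: d_def K_def)
  define M where "M = \<lparr>tm_Q = 3 + card K, tm_S = S, tm_delta = (\<lambda>q s.
     if d q = [] then (if acc s then 1 else 2, s, 0)
     else (e (fst (sstep (d q) s)), snd (sstep (d q) s)))\<rparr>"
  have stepK: "fst (sstep k s) \<in> K" if "k \<in> K" for k s
    using conts_step_any[of k p "[]" s] that by (auto simp: K_def)
  have "wf_tm M"
    unfolding wf_tm_def
  proof (intro conjI allI impI)
    show "tm_Q M \<ge> 3" "tm_S M \<ge> 5" using S by (auto simp: M_def)
    fix q s assume "q < tm_Q M" "s < tm_S M"
    then have s: "s < S" by (simp add: M_def)
    show "case tm_delta M q s of (q', w, m) \<Rightarrow> q' < tm_Q M \<and> w < tm_S M \<and> m \<in> {-1, 0, 1}"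
    proof (cases "d q = []")
      case True
      then show ?thesis using s finK pK by (auto simp: M_def)
    next
      case False
      then have "d q \<in> conts p []" using dK[of q] by (auto simp: K_def)
      from conts_step[OF wf this s] eQ[OF stepK[OF dK], of q s] False
      show ?thesis by (cases "sstep (d q) s") (auto simp: M_def)
    qed
  qed
  have step: "tm_step M (e k, tp, h) = (e k', tp', h')"
    if "kstep (k, tp, h) = (k', tp', h')" "k \<in> K" "k \<noteq> []" for k tp h k' tp' h'
    using that e12[of k] by (simp add: tm_step_def kstep_def M_def de split: prod.splits)
  have kK: "fst (kstep (k, c)) \<in> K" if "k \<in> K" for k c
    using stepK[OF that] by (auto simp: kstep_def split: prod.splits) (metis fst_conv)
  have nil: "(kstep ^^ n) ([], c) = ([], c)" for n c
    by (induction n) (auto simp: kstep_def split: prod.splits)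
  have sim: "fst ((tm_step M ^^ Suc t) (e k, tp, h)) = (if acc (tp' h') then 1 else 2)"
    if "(kstep ^^ t) (k, tp, h) = ([], tp', h')" "k \<in> K" "t = 0 \<or> fst ((kstep ^^ (t - 1)) (k, tp, h)) \<noteq> []"
    for t k tp h tp' h'
    using that
  proof (induction t arbitrary: k tp h)
    case 0
    then show ?case
      by (auto simp: tm_step_def M_def e12 de K_def)
  next
    case (Suc t)
    obtain k1 tp1 h1 where k1: "kstep (k, tp, h) = (k1, tp1, h1)" by (metis prod_cases3)
    have k0: "k \<noteq> []" using Suc.prems(3) nil by auto
    have "k1 \<in> K" using kK[OF Suc.prems(2), of "(tp, h)"] k1 by simp
    moreover have "(kstep ^^ t) (k1, tp1, h1) = ([], tp', h')"
      using Suc.prems(1) by (simp only: funpow_Suc_right o_def k1)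
    moreover have "t = 0 \<or> fst ((kstep ^^ (t - 1)) (k1, tp1, h1)) \<noteq> []"
    proof (cases t)
      case (Suc t')
      with Suc.prems(3) show ?thesis
        by (simp add: funpow_swap1 k1)
    qed simp
    ultimately have "fst ((tm_step M ^^ Suc t) (e k1, tp1, h1)) = (if acc (tp' h') then 1 else 2)"
      by (intro Suc.IH)
    then show ?case
      using step[OF k1 Suc.prems(2) k0] by (simp only: funpow_Suc_right o_def)
  qed
  have stay: "q = 1 \<or> q = 2 \<Longrightarrow> (tm_step M ^^ n) (q, c) = (q, c)" for q n c
    by (induction n) (auto simp: tm_step_def split: prod.splits)
  have "fst ((tm_step M ^^ Suc t) (tm_init w)) = (if acc (tp' h') then 1 else 2)"
    if r: "runs p (\<lambda>i. if 0 \<le> i \<and> i < int (length w) then w ! nat i else 0) 0 t tp' h'"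
    for w t tp' h'
  proof -
    define c where "c = (\<lambda>i. if 0 \<le> i \<and> i < int (length w) then w ! nat i else 0, 0::int)"
    have t: "(kstep ^^ t) ([p], c) = ([], tp', h')" using r by (auto simp: runs_def c_def)
    \<comment> \<open>\<open>runs\<close> does not exclude that the empty stack is reached before
      time \<open>t\<close>; \<open>kstep\<close> then idles, whereas the machine halts at once. So
      the first such time \<open>u\<close> is simulated, and the remaining \<open>t - u\<close>
      steps leave the halted machine unchanged.\<close>
    define u where "u = (LEAST u. fst ((kstep ^^ u) ([p], c)) = [])"
    have u: "fst ((kstep ^^ u) ([p], c)) = []"
      unfolding u_def by (rule LeastI[of _ t]) (simp add: t)
    have ut: "u \<le> t" unfolding u_def by (rule Least_le) (simp add: t)
    have "(kstep ^^ t) ([p], c) = (kstep ^^ (t - u)) ((kstep ^^ u) ([p], c))"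
      using ut by (metis funpow_add le_add_diff_inverse2 o_apply)
    then have ueq: "(kstep ^^ u) ([p], c) = ([], tp', h')"
      using u nil t by (metis prod.collapse)
    have "u = 0 \<or> fst ((kstep ^^ (u - 1)) ([p], c)) \<noteq> []"
      using not_less_Least[of "u - 1" "\<lambda>u. fst ((kstep ^^ u) ([p], c)) = []"]
      by (auto simp: u_def)
    with sim[of u "[p]" "fst c" "snd c" tp' h'] ueq pK
    have "fst ((tm_step M ^^ Suc u) (tm_init w)) = (if acc (tp' h') then 1 else 2)"
      by (simp add: tm_init_def c_def e_def)
    moreover obtain q c' where "(tm_step M ^^ Suc u) (tm_init w) = (q, c')" by (rule prod.exhaust)
    moreover have "(tm_step M ^^ Suc t) x = (tm_step M ^^ (t - u)) ((tm_step M ^^ Suc u) x)" for x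
      using ut by (metis Suc_diff_le add_Suc_right funpow_add le_add_diff_inverse2 o_apply)
    ultimately show ?thesis using stay[of q "t - u" c'] by (auto split: if_splits)
  qed
  with \<open>wf_tm M\<close> show ?thesis by blast
qed

section \<open>Programs with several pointers into the input\<close>

datatype pprog = PSkip | PInc nat | PCopy nat nat | PSeq pprog pprog
  | PIf nat "nat \<Rightarrow> bool" pprog pprog | PWhile nat "nat \<Rightarrow> bool" pprog

definition symb :: "nat list \<Rightarrow> nat \<Rightarrow> nat" where
  "symb w i = (if i < length w then w ! i else 0)"

text \<open>\<open>PInc\<close> may be applied only while the pointer is inside the word, so
  pointers range over the word and the one blank cell after it. \<open>PCopy\<close> asks for
  \<open>i \<noteq> j\<close> because its compilation first lifts mark \<open>i\<close> and then
  searches for mark \<open>j\<close>.\<close>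

inductive pex :: "nat list \<Rightarrow> nat \<Rightarrow> pprog \<Rightarrow> (nat \<Rightarrow> nat) \<Rightarrow> nat \<Rightarrow> (nat \<Rightarrow> nat) \<Rightarrow> bool"
  for w :: "nat list" and k :: nat where
  skip: "pex w k PSkip pos 1 pos"
| inc: "j < k \<Longrightarrow> pos j < length w \<Longrightarrow> pex w k (PInc j) pos 1 (pos(j := Suc (pos j)))"
| copy: "i < k \<Longrightarrow> j < k \<Longrightarrow> i \<noteq> j \<Longrightarrow> pex w k (PCopy i j) pos 1 (pos(i := pos j))"
| seq: "pex w k p pos t pos' \<Longrightarrow> pex w k q pos' u pos'' \<Longrightarrow> pex w k (PSeq p q) pos (Suc (t + u)) pos''"
| cond: "j < k \<Longrightarrow> pex w k (if P (symb w (pos j)) then p else q) pos t pos' \<Longrightarrow>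
    pex w k (PIf j P p q) pos (Suc t) pos'"
| while_False: "j < k \<Longrightarrow> \<not> P (symb w (pos j)) \<Longrightarrow> pex w k (PWhile j P p) pos 1 pos"
| while_True: "j < k \<Longrightarrow> P (symb w (pos j)) \<Longrightarrow> pex w k p pos t pos' \<Longrightarrow>
    pex w k (PWhile j P p) pos' u pos'' \<Longrightarrow> pex w k (PWhile j P p) pos (Suc (t + u)) pos''"

text \<open>A tape symbol stores an input symbol \<open>b < 5\<close> and the set of pointers parked on the cell;
  the additional mark \<open>k\<close> identifies the left end.\<close>

definition cell :: "nat \<Rightarrow> nat set \<Rightarrow> nat" where "cell b S = b + 5 * set_encode S"
definition marks :: "nat \<Rightarrow> nat set" where "marks x = set_decode (x div 5)"

lemma marks_cell: "b < 5 \<Longrightarrow> finite S \<Longrightarrow> marks (cell b S) = S"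
  by (simp add: marks_def cell_def)

lemma base_cell: "b < 5 \<Longrightarrow> cell b S mod 5 = b"
  by (simp add: cell_def)

text \<open>This is \<open>5 * 2 ^ (k + 1)\<close>, the number of pairs of an input symbol and a set
  of marks in \<open>{..k}\<close>.\<close>

definition nsym :: "nat \<Rightarrow> nat" where "nsym k = 5 * Suc (set_encode {..k})"

lemma cell_less: "b < 5 \<Longrightarrow> S \<subseteq> {..k} \<Longrightarrow> cell b S < nsym k"
proof -
  assume "b < 5" "S \<subseteq> {..k}"
  moreover have "set_encode S \<le> set_encode {..k}"
    unfolding set_encode_def using \<open>S \<subseteq> {..k}\<close> by (intro sum_mono2) auto
  ultimately show ?thesis by (simp add: cell_def nsym_def)
qed

text \<open>Keeps the transition function inside the alphabet even for pointer indices out of range,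
  so that \<open>wf_tr\<close> holds for every program without side conditions. On the cells that
  occur in a simulation it is the identity.\<close>

definition clip :: "nat \<Rightarrow> nat \<Rightarrow> nat" where "clip S x = (if x < S then x else 0)"

definition add_mark :: "nat \<Rightarrow> nat \<Rightarrow> nat \<Rightarrow> nat" where
  "add_mark k j x = clip (nsym k) (cell (x mod 5) (insert j (marks x)))"
definition del_mark :: "nat \<Rightarrow> nat \<Rightarrow> nat \<Rightarrow> nat" where
  "del_mark k j x = clip (nsym k) (cell (x mod 5) (marks x - {j}))"

text \<open>The head does not know on which side of it a mark lies; returning to the left end first
  makes a scan to the right sufficient.\<close>

definition seek :: "nat \<Rightarrow> nat \<Rightarrow> prog" where
  "seek k j = Seq (Loop (\<lambda>x. k \<notin> marks x) (Act (\<lambda>x. (x, -1))))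
     (Loop (\<lambda>x. j \<notin> marks x) (Act (\<lambda>x. (x, 1))))"

fun tr :: "nat \<Rightarrow> pprog \<Rightarrow> prog" where
  "tr k PSkip = Act (\<lambda>x. (x, 0))"
| "tr k (PInc j) = Seq (seek k j) (Seq (Act (\<lambda>x. (del_mark k j x, 1))) (Act (\<lambda>x. (add_mark k j x, 0))))"
| "tr k (PCopy i j) = Seq (seek k i) (Seq (Act (\<lambda>x. (del_mark k i x, 0)))
     (Seq (seek k j) (Act (\<lambda>x. (add_mark k i x, 0)))))"
| "tr k (PSeq p q) = Seq (tr k p) (tr k q)"
| "tr k (PIf j P p q) = Seq (seek k j) (Cond (\<lambda>x. P (x mod 5)) (tr k p) (tr k q))"
| "tr k (PWhile j P p) = Seq (seek k j) (Loop (\<lambda>x. P (x mod 5)) (Seq (tr k p) (seek k j)))"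

lemma nsym_pos: "nsym k \<ge> 5" by (simp add: nsym_def)

lemma wf_seek: "wf_prog S (seek k j)" by (simp add: seek_def)

lemma wf_tr: "wf_prog (nsym k) (tr k p)"
proof -
  have "clip (nsym k) x < nsym k" for x
    using nsym_pos[of k] by (auto simp: clip_def)
  then show ?thesis
    by (induction p) (auto simp: wf_seek add_mark_def del_mark_def)
qed

text \<open>Cell \<open>length w\<close> belongs to the tape proper, since pointers may stand just
  behind the word. An unmarked symbol is encoded by itself, hence the initial machine tape is
  \<open>tape w\<close> with all mark sets empty.\<close>

definition tape :: "nat list \<Rightarrow> (nat \<Rightarrow> nat set) \<Rightarrow> int \<Rightarrow> nat" where
  "tape w \<mu> i = (if 0 \<le> i \<and> i \<le> int (length w) then cell (symb w (nat i)) (\<mu> (nat i)) else 0)"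

definition parked :: "nat \<Rightarrow> (nat \<Rightarrow> nat) \<Rightarrow> nat \<Rightarrow> nat set" where
  "parked k pos i = {j. j < k \<and> pos j = i} \<union> (if i = 0 then {k} else {})"

locale mach =
  fixes w :: "nat list" and k :: nat
  assumes w5: "set w \<subseteq> {..<5}"
begin

abbreviation "n \<equiv> length w"

lemma sym5: "symb w i < 5"
  using w5 nth_mem[of i w] by (fastforce simp: symb_def)

lemma tape_at: "i \<le> n \<Longrightarrow> tape w \<mu> (int i) = cell (symb w i) (\<mu> i)"
  by (simp add: tape_def)

lemma marks_at: "i \<le> n \<Longrightarrow> \<mu> i \<subseteq> {..k} \<Longrightarrow> marks (tape w \<mu> (int i)) = \<mu> i"
  by (simp add: tape_at marks_cell sym5 finite_subset)

lemma base_at: "i \<le> n \<Longrightarrow> tape w \<mu> (int i) mod 5 = symb w i"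
  by (simp add: tape_at base_cell sym5)

lemma tape_upd: "i \<le> n \<Longrightarrow> (tape w \<mu>)(int i := cell (symb w i) S) = tape w (\<mu>(i := S))"
  by (auto simp: tape_def fun_eq_iff)

lemma add_at: "i \<le> n \<Longrightarrow> \<mu> i \<subseteq> {..k} \<Longrightarrow> j \<le> k \<Longrightarrow>
    add_mark k j (tape w \<mu> (int i)) = cell (symb w i) (insert j (\<mu> i))"
  using cell_less[of "symb w i" "insert j (\<mu> i)" k]
  by (simp add: add_mark_def marks_at base_at clip_def sym5)

lemma del_at: "i \<le> n \<Longrightarrow> \<mu> i \<subseteq> {..k} \<Longrightarrow>
    del_mark k j (tape w \<mu> (int i)) = cell (symb w i) (\<mu> i - {j})"
  using cell_less[of "symb w i" "\<mu> i - {j}" k]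
  by (auto simp: del_mark_def marks_at base_at clip_def sym5)

lemma scan_left:
  assumes "i \<le> n" "\<And>i. \<mu> i \<subseteq> {..k}" "\<And>i. k \<in> \<mu> i \<longleftrightarrow> i = 0"
  shows "runs (Loop (\<lambda>x. k \<notin> marks x) (Act (\<lambda>x. (x, -1)))) (tape w \<mu>) (int i) (Suc (2 * i)) (tape w \<mu>) 0"
  using assms(1)
proof (induction i)
  case 0
  then show ?case
    using runs_Loop_False[of "\<lambda>x. k \<notin> marks x" "tape w \<mu>" 0] marks_at[of 0 \<mu>] assms(2,3) by simp
next
  case (Suc i)
  have "runs (Act (\<lambda>x. (x, -1))) (tape w \<mu>) (int (Suc i)) 1 (tape w \<mu>) (int i)"
    using runs_Act[of "\<lambda>x. (x, -1)" "tape w \<mu>" "int (Suc i)"] by simp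
  moreover have "runs (Loop (\<lambda>x. k \<notin> marks x) (Act (\<lambda>x. (x, -1)))) (tape w \<mu>) (int i) (Suc (2 * i)) (tape w \<mu>) 0"
    using Suc by simp
  moreover have "k \<notin> marks (tape w \<mu> (int (Suc i)))"
    using marks_at[OF Suc.prems assms(2)] assms(3)[of "Suc i"] by simp
  ultimately show ?case
    using runs_Loop_True[of "\<lambda>x. k \<notin> marks x"] by fastforce
qed

lemma scan_right:
  assumes "c \<le> n" "i \<le> c" "\<And>i. \<mu> i \<subseteq> {..k}" "j \<in> \<mu> c" "\<And>i. i < c \<Longrightarrow> j \<notin> \<mu> i"
  shows "runs (Loop (\<lambda>x. j \<notin> marks x) (Act (\<lambda>x. (x, 1)))) (tape w \<mu>) (int i) (Suc (2 * (c - i))) (tape w \<mu>) (int c)"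
  using assms(2)
proof (induction i rule: inc_induct)
  case base
  then show ?case
    using runs_Loop_False[of "\<lambda>x. j \<notin> marks x" "tape w \<mu>" "int c"] marks_at[of c \<mu>] assms by simp
next
  case (step i)
  have "runs (Act (\<lambda>x. (x, 1))) (tape w \<mu>) (int i) 1 (tape w \<mu>) (int (Suc i))"
    using runs_Act[of "\<lambda>x. (x, 1)" "tape w \<mu>" "int i"] by (simp add: algebra_simps)
  moreover have "j \<notin> marks (tape w \<mu> (int i))"
    using marks_at[of i \<mu>] assms step by simp
  ultimately have "runs (Loop (\<lambda>x. j \<notin> marks x) (Act (\<lambda>x. (x, 1)))) (tape w \<mu>) (int i)
      (Suc (1 + Suc (2 * (c - Suc i)))) (tape w \<mu>) (int c)"
    using runs_Loop_True[of "\<lambda>x. j \<notin> marks x"] step.IH by blast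
  moreover have "Suc (1 + Suc (2 * (c - Suc i))) = Suc (2 * (c - i))" using step by simp
  ultimately show ?case by simp
qed

lemma runs_seek:
  assumes "i \<le> n" "c \<le> n" "\<And>i. \<mu> i \<subseteq> {..k}" "\<And>i. k \<in> \<mu> i \<longleftrightarrow> i = 0" "j \<in> \<mu> c" "\<And>i. i < c \<Longrightarrow> j \<notin> \<mu> i"
  shows "\<exists>t\<le>4 * n + 3. runs (seek k j) (tape w \<mu>) (int i) t (tape w \<mu>) (int c)"
proof -
  have "runs (seek k j) (tape w \<mu>) (int i) (Suc (Suc (2 * i) + Suc (2 * (c - 0)))) (tape w \<mu>) (int c)"
    unfolding seek_def using assms
    by (intro runs_Seq[OF scan_left]) (use scan_right[of c 0 \<mu> j] in auto)
  then show ?thesis using assms(1,2) by (intro exI[of _ "Suc (Suc (2 * i) + Suc (2 * (c - 0)))"]) auto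
qed

abbreviation "ptape pos \<equiv> tape w (parked k pos)"

lemma parked_props: "parked k pos i \<subseteq> {..k}" "k \<in> parked k pos i \<longleftrightarrow> i = 0"
  "j < k \<Longrightarrow> j \<in> parked k pos i \<longleftrightarrow> pos j = i"
  by (auto simp: parked_def)

lemma seek_ptr:
  assumes "i \<le> n" "j < k" "pos j \<le> n"
  shows "\<exists>t\<le>4 * n + 3. runs (seek k j) (ptape pos) (int i) t (ptape pos) (int (pos j))"
  by (rule runs_seek) (use assms parked_props in auto)

text \<open>The second update reads the mark sets after the first one; this covers the case
  \<open>i = pos j\<close>, where the lifted mark returns to the same cell.\<close>

lemma parked_move: "j < k \<Longrightarrow> (parked k pos)(pos j := parked k pos (pos j) - {j},
    i := insert j (((parked k pos)(pos j := parked k pos (pos j) - {j})) i)) = parked k (pos(j := i))"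
  by (auto simp: parked_def fun_eq_iff)

text \<open>The most expensive single instruction is \<open>PCopy\<close>, with two searches of at
  most \<open>4 * n + 3\<close> steps each and a few extra steps.\<close>

abbreviation "unit_cost \<equiv> 8 * n + 20"

text \<open>A loop is compiled into a pointer search followed by a machine loop; the induction over
  executions needs the behaviour of that machine loop on its own.\<close>

definition while_body where
  "while_body p pos t pos' \<longleftrightarrow> (case p of
     PWhile j P q \<Rightarrow> \<exists>u i'. u + (4 * n + 4) \<le> t * unit_cost \<and> i' \<le> n \<and>
       runs (Loop (\<lambda>x. P (x mod 5)) (Seq (tr k q) (seek k j))) (ptape pos) (int (pos j)) u (ptape pos') (int i')
   | _ \<Rightarrow> True)"

lemma runs_post:
  "runs q tp h u tp' (int i') \<Longrightarrow> u \<le> c \<Longrightarrow> i' \<le> n \<Longrightarrow> \<exists>u i'. u \<le> c \<and> i' \<le> n \<and> runs q tp h u tp' (int i')"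
  by blast

lemma runs_tr_aux:
  assumes "pex w k p pos t pos'" "\<forall>j<k. pos j \<le> n" "i \<le> n"
  shows "(\<forall>j<k. pos' j \<le> n) \<and> while_body p pos t pos' \<and>
    (\<exists>u i'. u \<le> t * unit_cost \<and> i' \<le> n \<and> runs (tr k p) (ptape pos) (int i) u (ptape pos') (int i'))"
  using assms
proof (induction arbitrary: i rule: pex.induct)
  case (skip pos)
  have "runs (tr k PSkip) (ptape pos) (int i) 1 (ptape pos) (int i)"
    using runs_Act[of "\<lambda>x. (x, 0)" "ptape pos" "int i"] by simp
  note R = runs_post[OF this, of "1 * unit_cost"]
  show ?case
    by (intro conjI R) (use skip in \<open>auto simp: while_body_def\<close>)
next
  case (inc j pos)
  let ?\<mu> = "parked k pos" and ?\<nu> = "(parked k pos)(pos j := parked k pos (pos j) - {j})"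
  obtain t where t: "t \<le> 4 * n + 3" "runs (seek k j) (ptape pos) (int i) t (ptape pos) (int (pos j))"
    using seek_ptr[of i j pos] inc by auto
  have pj: "pos j \<le> n" "Suc (pos j) \<le> n" using inc by auto
  have "runs (Act (\<lambda>x. (del_mark k j x, 1))) (ptape pos) (int (pos j)) 1 (tape w ?\<nu>) (int (Suc (pos j)))"
    using runs_Act[of "\<lambda>x. (del_mark k j x, 1)" "ptape pos" "int (pos j)"] pj
    by (simp add: del_at parked_props tape_upd algebra_simps)
  moreover have "runs (Act (\<lambda>x. (add_mark k j x, 0))) (tape w ?\<nu>) (int (Suc (pos j))) 1
      (ptape (pos(j := Suc (pos j)))) (int (Suc (pos j)))"
    using runs_Act[of "\<lambda>x. (add_mark k j x, 0)" "tape w ?\<nu>" "int (Suc (pos j))"] pj inc(1)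
      add_at[of "Suc (pos j)" ?\<nu> j] tape_upd[of "Suc (pos j)" ?\<nu> "insert j (?\<nu> (Suc (pos j)))"]
      parked_move[OF inc(1), of pos "Suc (pos j)"] parked_props(1)
    by simp
  ultimately have "runs (tr k (PInc j)) (ptape pos) (int i) (Suc (t + Suc (1 + 1))) (ptape (pos(j := Suc (pos j)))) (int (Suc (pos j)))"
    using t(2) unfolding tr.simps by (intro runs_Seq)
  note R = runs_post[OF this, of "1 * unit_cost"]
  show ?case
  proof (intro conjI R)
    show "\<forall>ja<k. (pos(j := Suc (pos j))) ja \<le> n" using inc.prems(1) pj by simp
    show "Suc (t + Suc (1 + 1)) \<le> 1 * unit_cost" using t(1) by simp
  qed (use pj in \<open>simp_all add: while_body_def\<close>)
next
  case (copy i' j pos)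
  let ?\<nu> = "(parked k pos)(pos i' := parked k pos (pos i') - {i'})"
  have pj: "pos i' \<le> n" "pos j \<le> n" using copy by auto
  obtain t where t: "t \<le> 4 * n + 3" "runs (seek k i') (ptape pos) (int i) t (ptape pos) (int (pos i'))"
    using seek_ptr[of i i' pos] copy by auto
  have 2: "runs (Act (\<lambda>x. (del_mark k i' x, 0))) (ptape pos) (int (pos i')) 1 (tape w ?\<nu>) (int (pos i'))"
    using runs_Act[of "\<lambda>x. (del_mark k i' x, 0)" "ptape pos" "int (pos i')"] pj
    by (simp add: del_at parked_props tape_upd)
  have "\<exists>u\<le>4 * n + 3. runs (seek k j) (tape w ?\<nu>) (int (pos i')) u (tape w ?\<nu>) (int (pos j))"
  proof (rule runs_seek)
    show "?\<nu> i \<subseteq> {..k}" for i using parked_props(1)[of pos i] by auto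
    show "k \<in> ?\<nu> i \<longleftrightarrow> i = 0" for i using parked_props(2)[of pos i] copy(1) by auto
    show "j \<in> ?\<nu> (pos j)" using parked_props(3)[OF copy(2)] copy(3) by simp
    show "j \<notin> ?\<nu> i" if "i < pos j" for i using parked_props(3)[OF copy(2), of pos i] that by auto
  qed (use pj in simp_all)
  then obtain u where u: "u \<le> 4 * n + 3" "runs (seek k j) (tape w ?\<nu>) (int (pos i')) u (tape w ?\<nu>) (int (pos j))"
    by blast
  have "?\<nu> (pos j) \<subseteq> {..k}" using parked_props(1) by auto
  then have 4: "runs (Act (\<lambda>x. (add_mark k i' x, 0))) (tape w ?\<nu>) (int (pos j)) 1
      (ptape (pos(i' := pos j))) (int (pos j))"
    using runs_Act[of "\<lambda>x. (add_mark k i' x, 0)" "tape w ?\<nu>" "int (pos j)"] pj copy(1)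
      add_at[of "pos j" ?\<nu> i'] tape_upd[of "pos j" ?\<nu> "insert i' (?\<nu> (pos j))"]
      parked_move[OF copy(1), of pos "pos j"]
    by simp
  have "runs (tr k (PCopy i' j)) (ptape pos) (int i) (Suc (t + Suc (1 + Suc (u + 1)))) (ptape (pos(i' := pos j))) (int (pos j))"
    using t(2) 2 u(2) 4 unfolding tr.simps by (intro runs_Seq)
  note R = runs_post[OF this, of "1 * unit_cost"]
  show ?case
  proof (intro conjI R)
    show "\<forall>ja<k. (pos(i' := pos j)) ja \<le> n" using copy.prems(1) pj by simp
    show "Suc (t + Suc (1 + Suc (u + 1))) \<le> 1 * unit_cost" using t(1) u(1) by simp
  qed (use pj in \<open>simp_all add: while_body_def\<close>)
next
  case (seq p pos t pos' q u pos'')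
  obtain a i1 where 1: "a \<le> t * unit_cost" "i1 \<le> n" "runs (tr k p) (ptape pos) (int i) a (ptape pos') (int i1)"
    and pos': "\<forall>j<k. pos' j \<le> n"
    using seq.IH(1)[OF seq.prems] by blast
  obtain b i2 where 2: "b \<le> u * unit_cost" "i2 \<le> n" "runs (tr k q) (ptape pos') (int i1) b (ptape pos'') (int i2)"
    and pos'': "\<forall>j<k. pos'' j \<le> n"
    using seq.IH(2)[OF pos' 1(2)] by blast
  have "runs (tr k (PSeq p q)) (ptape pos) (int i) (Suc (a + b)) (ptape pos'') (int i2)"
    using 1 2 by (simp add: runs_Seq)
  moreover have "Suc (a + b) \<le> Suc (t + u) * unit_cost" using 1 2 by (simp add: algebra_simps)
  moreover have "while_body (PSeq p q) pos (Suc (t + u)) pos''" by (simp add: while_body_def)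
  ultimately show ?case using pos'' 2(2) by blast
next
  case (cond j P pos p q t pos')
  obtain a where a: "a \<le> 4 * n + 3" "runs (seek k j) (ptape pos) (int i) a (ptape pos) (int (pos j))"
    using seek_ptr[of i j pos] cond by auto
  have pj: "pos j \<le> n" using cond by auto
  obtain b i2 where 2: "b \<le> t * unit_cost" "i2 \<le> n"
      "runs (tr k (if P (symb w (pos j)) then p else q)) (ptape pos) (int (pos j)) b (ptape pos') (int i2)"
    and pos': "\<forall>j<k. pos' j \<le> n"
    using cond.IH[OF cond.prems(1) pj] by blast
  have "runs (Cond (\<lambda>x. P (x mod 5)) (tr k p) (tr k q)) (ptape pos) (int (pos j)) (Suc b) (ptape pos') (int i2)"
    using 2(3) base_at[OF pj, of "parked k pos"] by (intro runs_Cond) (simp split: if_splits)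
  from runs_Seq[OF a(2) this]
  have "runs (tr k (PIf j P p q)) (ptape pos) (int i) (Suc (a + Suc b)) (ptape pos') (int i2)"
    by simp
  moreover have "Suc (a + Suc b) \<le> Suc t * unit_cost" using a 2 by (simp add: algebra_simps)
  moreover have "while_body (PIf j P p q) pos (Suc t) pos'" by (simp add: while_body_def)
  ultimately show ?case using pos' 2(2) by blast
next
  case (while_False j P pos p)
  let ?L = "Loop (\<lambda>x. P (x mod 5)) (Seq (tr k p) (seek k j))"
  obtain a where a: "a \<le> 4 * n + 3" "runs (seek k j) (ptape pos) (int i) a (ptape pos) (int (pos j))"
    using seek_ptr[of i j pos] while_False by auto
  have pj: "pos j \<le> n" using while_False by auto
  have L: "runs ?L (ptape pos) (int (pos j)) 1 (ptape pos) (int (pos j))"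
    using while_False base_at[OF pj, of "parked k pos"] by (intro runs_Loop_False) auto
  have "runs (tr k (PWhile j P p)) (ptape pos) (int i) (Suc (a + 1)) (ptape pos) (int (pos j))"
    using runs_Seq[OF a(2) L] by simp
  from runs_post[OF this, of "1 * unit_cost"] a pj
  have "\<exists>u i'. u \<le> 1 * unit_cost \<and> i' \<le> n \<and> runs (tr k (PWhile j P p)) (ptape pos) (int i) u (ptape pos) (int i')"
    by simp
  moreover have "while_body (PWhile j P p) pos 1 pos"
    unfolding while_body_def pprog.case
    by (rule exI[of _ 1], rule exI[of _ "pos j"]) (use L pj in simp)
  ultimately show ?case using while_False.prems(1) by blast
next
  case (while_True j P pos p t pos' u pos'')
  let ?L = "Loop (\<lambda>x. P (x mod 5)) (Seq (tr k p) (seek k j))"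
  obtain a where a: "a \<le> 4 * n + 3" "runs (seek k j) (ptape pos) (int i) a (ptape pos) (int (pos j))"
    using seek_ptr[of i j pos] while_True by auto
  have pj: "pos j \<le> n" using while_True by auto
  obtain b i2 where 2: "b \<le> t * unit_cost" "i2 \<le> n"
      "runs (tr k p) (ptape pos) (int (pos j)) b (ptape pos') (int i2)"
    and pos': "\<forall>j<k. pos' j \<le> n"
    using while_True.IH(1)[OF while_True.prems(1) pj] by blast
  have "while_body (PWhile j P p) pos' u pos''" and pos'': "\<forall>j<k. pos'' j \<le> n"
    using while_True.IH(2)[OF pos' 2(2)] by auto
  then obtain e i3 where e: "e + (4 * n + 4) \<le> u * unit_cost" "i3 \<le> n"
      "runs ?L (ptape pos') (int (pos' j)) e (ptape pos'') (int i3)"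
    by (auto simp: while_body_def)
  have pj': "pos' j \<le> n" using pos' while_True by auto
  obtain d where d: "d \<le> 4 * n + 3" "runs (seek k j) (ptape pos') (int i2) d (ptape pos') (int (pos' j))"
    using seek_ptr[of i2 j pos'] while_True(1) pj' 2(2) by auto
  have L: "runs ?L (ptape pos) (int (pos j)) (Suc (Suc (b + d) + e)) (ptape pos'') (int i3)"
    using 2(3) d(2) e(3) while_True(2) base_at[OF pj, of "parked k pos"]
    by (intro runs_Loop_True runs_Seq) auto
  \<comment> \<open>The reserve \<open>4 * n + 4\<close> of the induction hypothesis is passed on
    unchanged; it pays for the search that precedes the machine loop when the loop is entered from
    outside.\<close>
  have le: "Suc (Suc (b + d) + e) + (4 * n + 4) \<le> Suc (t + u) * unit_cost"
    using 2(1) d(1) e(1) by (simp add: algebra_simps)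
  have "runs (tr k (PWhile j P p)) (ptape pos) (int i) (Suc (a + Suc (Suc (b + d) + e))) (ptape pos'') (int i3)"
    using runs_Seq[OF a(2) L] by simp
  moreover have "Suc (a + Suc (Suc (b + d) + e)) \<le> Suc (t + u) * unit_cost"
    using a le by simp
  moreover have "while_body (PWhile j P p) pos (Suc (t + u)) pos''"
    unfolding while_body_def pprog.case using L le e(2) by blast
  ultimately show ?case using pos'' e(2) by blast
qed

lemma runs_tr:
  assumes "pex w k p pos t pos'" "\<forall>j<k. pos j \<le> n" "i \<le> n"
  obtains u i' where "u \<le> t * unit_cost" "i' \<le> n" "\<forall>j<k. pos' j \<le> n"
    "runs (tr k p) (ptape pos) (int i) u (ptape pos') (int i')"
  using runs_tr_aux[OF assms] by blast

end

text \<open>All pointers start at 0, so one initial action puts every mark, including the left-end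
  mark \<open>k\<close>, on the first cell. At the end pointer \<open>r\<close> is sought, and the
  presence of mark \<open>k\<close> there tells whether \<open>pos r = 0\<close>.\<close>

lemma tm_of_pprog:
  assumes "r < k"
  shows "\<exists>M. wf_tm M \<and> (\<forall>w t pos. set w \<subseteq> {..<5} \<and> pex w k p (\<lambda>_. 0) t pos \<longrightarrow>
    (\<exists>u \<le> 20 * Suc t * Suc (length w). fst ((tm_step M ^^ u) (tm_init w)) = (if pos r = 0 then 1 else 2)))"
proof -
  define P where "P = Seq (Act (\<lambda>x. (clip (nsym k) (cell (x mod 5) {..k}), 0))) (Seq (tr k p) (seek k r))"
  have "wf_prog (nsym k) P"
    using wf_tr wf_seek nsym_pos[of k] by (auto simp: P_def clip_def)
  from tm_of_prog[OF this nsym_pos, of "\<lambda>x. k \<in> marks x"] obtain M where M: "wf_tm M"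
    "\<And>w t tp' h'. runs P (\<lambda>i. if 0 \<le> i \<and> i < int (length w) then w ! nat i else 0) 0 t tp' h' \<Longrightarrow>
      fst ((tm_step M ^^ Suc t) (tm_init w)) = (if k \<in> marks (tp' h') then 1 else 2)"
    by blast
  have "\<exists>u \<le> 20 * Suc t * Suc (length w). fst ((tm_step M ^^ u) (tm_init w)) = (if pos r = 0 then 1 else 2)"
    if w: "set w \<subseteq> {..<5}" and ex: "pex w k p (\<lambda>_. 0) t pos" for w t pos
  proof -
    interpret mach w k by unfold_locales (use w in auto)
    let ?t0 = "\<lambda>i. if 0 \<le> i \<and> i < int (length w) then w ! nat i else 0"
    have t0: "?t0 = tape w (\<lambda>_. {})"
      by (auto simp: tape_def symb_def cell_def fun_eq_iff)
    have "parked k (\<lambda>_. 0) = (\<lambda>_. {})(0 := {..k})"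
      by (auto simp: parked_def fun_eq_iff)
    then have 1: "runs (Act (\<lambda>x. (clip (nsym k) (cell (x mod 5) {..k}), 0))) ?t0 0 1 (ptape (\<lambda>_. 0)) 0"
      using runs_Act[of "\<lambda>x. (clip (nsym k) (cell (x mod 5) {..k}), 0)" "tape w (\<lambda>_. {})" 0]
        tape_upd[of 0 "\<lambda>_. {}" "{..k}"] base_at[of 0 "\<lambda>_. {}"] cell_less[OF sym5, of "{..k}" k 0]
      unfolding t0 by (simp add: clip_def)
    obtain u i' where 2: "u \<le> t * unit_cost" "i' \<le> length w" "\<forall>j<k. pos j \<le> length w"
      "runs (tr k p) (ptape (\<lambda>_. 0)) 0 u (ptape pos) (int i')"
      using runs_tr[OF ex, of 0] by auto
    obtain v where 3: "v \<le> 4 * length w + 3" "runs (seek k r) (ptape pos) (int i') v (ptape pos) (int (pos r))"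
      using seek_ptr[OF 2(2) assms, of pos] 2(3) assms by auto
    have "runs P ?t0 0 (Suc (1 + Suc (u + v))) (ptape pos) (int (pos r))"
      unfolding P_def using 1 2 3 by (intro runs_Seq)
    from M(2)[OF this] have "fst ((tm_step M ^^ Suc (Suc (1 + Suc (u + v)))) (tm_init w)) = (if pos r = 0 then 1 else 2)"
      using marks_at[of "pos r" "parked k pos"] 2(3) assms parked_props(1,2) by auto
    moreover have "Suc (Suc (1 + Suc (u + v))) \<le> 20 * Suc t * Suc (length w)"
      using 2(1) 3(1) by (simp add: algebra_simps)
    ultimately show ?thesis by blast
  qed
  then show ?thesis using M(1) by blast
qed

section \<open>Evaluating a fixed conjunctive query in polynomial time\<close>

text \<open>Total correctness with time bound \<open>T\<close>. The postcondition is an arbitrary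
  predicate, so the specification of a later command can be nested inside it;
  \<open>does_seq\<close> has this form.\<close>

definition does :: "nat list \<Rightarrow> nat \<Rightarrow> pprog \<Rightarrow> (nat \<Rightarrow> nat) \<Rightarrow> nat \<Rightarrow> ((nat \<Rightarrow> nat) \<Rightarrow> bool) \<Rightarrow> bool" where
  "does w k p pos T Q \<longleftrightarrow> (\<exists>t\<le>T. \<exists>pos'. pex w k p pos t pos' \<and> Q pos')"

lemma does_mono: "does w k p pos T Q \<Longrightarrow> T \<le> T' \<Longrightarrow> (\<And>pos'. Q pos' \<Longrightarrow> Q' pos') \<Longrightarrow> does w k p pos T' Q'"
  unfolding does_def by (meson order_trans)

lemma does_le: "does w k p pos T Q \<Longrightarrow> T \<le> T' \<Longrightarrow> does w k p pos T' Q"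
  by (rule does_mono)

lemma does_skip: "Q pos \<Longrightarrow> does w k PSkip pos 1 Q"
  unfolding does_def using pex.skip by blast

lemma does_inc: "j < k \<Longrightarrow> pos j < length w \<Longrightarrow> Q (pos(j := Suc (pos j))) \<Longrightarrow> does w k (PInc j) pos 1 Q"
  unfolding does_def using pex.inc by blast

lemma does_copy: "i < k \<Longrightarrow> j < k \<Longrightarrow> i \<noteq> j \<Longrightarrow> Q (pos(i := pos j)) \<Longrightarrow> does w k (PCopy i j) pos 1 Q"
  unfolding does_def using pex.copy by blast

lemma does_seq:
  assumes "does w k p pos T (\<lambda>pos'. does w k q pos' U Q)"
  shows "does w k (PSeq p q) pos (Suc (T + U)) Q"
proof -
  obtain t pos' u pos'' where "t \<le> T" "u \<le> U" "pex w k p pos t pos'" "pex w k q pos' u pos''" "Q pos''"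
    using assms unfolding does_def by blast
  then show ?thesis unfolding does_def
    by (intro exI[of _ "Suc (t + u)"] conjI exI[of _ pos'']) (auto intro: pex.seq)
qed

lemma does_if:
  assumes "j < k" "does w k (if P (symb w (pos j)) then p else q) pos T Q"
  shows "does w k (PIf j P p q) pos (Suc T) Q"
proof -
  obtain t pos' where "t \<le> T" "pex w k (if P (symb w (pos j)) then p else q) pos t pos'" "Q pos'"
    using assms unfolding does_def by blast
  then show ?thesis unfolding does_def
    using pex.cond[where P = P and j = j and pos = pos, OF assms(1)] by (intro exI[of _ "Suc t"] conjI exI[of _ pos']) auto
qed

lemma does_while_False:
  assumes "j < k" "\<not> P (symb w (pos j))" "Q pos"
  shows "does w k (PWhile j P p) pos 1 Q"
  unfolding does_def using pex.while_False[where P = P and j = j and pos = pos, OF assms(1,2)] assms(3) by blast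

lemma does_while_True:
  assumes "j < k" "P (symb w (pos j))" "does w k p pos T (\<lambda>pos'. does w k (PWhile j P p) pos' U Q)"
  shows "does w k (PWhile j P p) pos (Suc (T + U)) Q"
proof -
  obtain t pos' u pos'' where "t \<le> T" "u \<le> U" "pex w k p pos t pos'" "pex w k (PWhile j P p) pos' u pos''" "Q pos''"
    using assms(3) unfolding does_def by blast
  then show ?thesis unfolding does_def
    by (intro exI[of _ "Suc (t + u)"] conjI exI[of _ pos'']) (auto intro: pex.while_True[where P = P and j = j and pos = pos, OF assms(1,2)])
qed

lemma does_scan:
  assumes "j < k" "\<And>i. a \<le> i \<Longrightarrow> i < b \<Longrightarrow> P (symb w i)" "\<not> P (symb w b)" "a \<le> b" "b \<le> length w"
    "Q (pos(j := b))" "pos j = a"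
  shows "does w k (PWhile j P (PInc j)) pos (2 * length w + 1) Q"
proof -
  have "does w k (PWhile j P (PInc j)) pos (2 * (b - a) + 1) Q"
    using assms(4,2,6,7)
  proof (induction a arbitrary: pos rule: inc_induct)
    case base
    then have "Q pos" by (metis fun_upd_triv)
    then show ?case using does_while_False[where P = P and j = j, OF assms(1)] assms(3) base by simp
  next
    case (step a)
    have "does w k (PWhile j P (PInc j)) pos (Suc (1 + (2 * (b - Suc a) + 1))) Q"
    proof (rule does_while_True[where P = P, OF assms(1)], use step in simp, rule does_inc[OF assms(1)])
      show "does w k (PWhile j P (PInc j)) (pos(j := Suc (pos j))) (2 * (b - Suc a) + 1) Q"
        using step.prems step.hyps by (intro step.IH) (simp_all del: fun_upd_apply add: fun_upd_same)
    qed (use step assms in auto)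
    moreover have "Suc (1 + (2 * (b - Suc a) + 1)) = 2 * (b - a) + 1" using step(2) by simp
    ultimately show ?case by simp
  qed
  then show ?thesis by (rule does_mono) (use assms in auto)
qed

section \<open>Reading numerals in an encoded instance\<close>

definition occurs :: "nat list \<Rightarrow> nat \<Rightarrow> nat list \<Rightarrow> bool" where
  "occurs w a us \<longleftrightarrow> (\<exists>pre post. w = pre @ us @ post \<and> length pre = a)"

lemma occurs_append: "occurs w a (us @ vs) \<Longrightarrow> occurs w a us \<and> occurs w (a + length us) vs"
  unfolding occurs_def by (metis append.assoc length_append)

lemma occurs_le: "occurs w a us \<Longrightarrow> a + length us \<le> length w"
  by (auto simp: occurs_def)

lemma occurs_nth: "occurs w a us \<Longrightarrow> i < length us \<Longrightarrow> symb w (a + i) = us ! i"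
  by (auto simp: occurs_def symb_def nth_append)

lemma occurs_Cons: "occurs w a (x # us) \<Longrightarrow> symb w a = x \<and> a < length w \<and> occurs w (Suc a) us"
  using occurs_nth[of w a "x # us" 0] occurs_append[of w a "[x]" us] occurs_le[of w a "x # us"] by auto

lemma set_bin: "set (bin n) \<subseteq> {1, 2}"
proof (induction n rule: bin.induct)
  case (1 n)
  then show ?case by (subst bin.simps) auto
qed

declare bin.simps [simp del]

lemma bin_nonempty: "bin n \<noteq> []"
  by (subst bin.simps) auto

lemma bin_inj: "bin m = bin n \<Longrightarrow> m = n"
proof (induction m arbitrary: n rule: bin.induct)
  case (1 m)
  show ?case
  proof (cases "m < 2")
    case True
    then have bm: "bin m = [m + 1]" by (subst bin.simps) simp
    show ?thesis
    proof (cases "n < 2")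
      case True
      then have "bin n = [n + 1]" by (subst bin.simps) simp
      then show ?thesis using bm 1 by simp
    next
      case False
      then have "bin n = (n mod 2 + 1) # bin (n div 2)" by (subst bin.simps) simp
      then show ?thesis using bm 1 bin_nonempty[of "n div 2"] by simp
    qed
  next
    case False
    then have bm: "bin m = (m mod 2 + 1) # bin (m div 2)" by (subst bin.simps) simp
    show ?thesis
    proof (cases "n < 2")
      case True
      then have "bin n = [n + 1]" by (subst bin.simps) simp
      then show ?thesis using bm 1 bin_nonempty[of "m div 2"] by simp
    next
      case False
      then have bn: "bin n = (n mod 2 + 1) # bin (n div 2)" by (subst bin.simps) simp
      then have "m mod 2 = n mod 2" "bin (m div 2) = bin (n div 2)" using bm 1(2) by auto
      then show ?thesis using 1(1)[OF \<open>\<not> m < 2\<close>, of "n div 2"] by (metis div_mult_mod_eq)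
    qed
  qed
qed

text \<open>Every variable is introduced by 3 and the atom ends in 4, so each numeral of an atom is
  followed by 3 or 4 and never by another digit.\<close>

abbreviation tail :: "nat list \<Rightarrow> nat list" where
  "tail vs \<equiv> concat (map (\<lambda>v. 3 # bin v) vs) @ [4]"

lemma enc_atom_eq: "enc_atom (f, vs) = bin f @ tail vs"
  by (simp add: enc_atom_def)

lemma tail_split: "\<exists>d us. d \<in> {3, 4} \<and> tail vs = d # us"
  by (cases vs) auto

fun goto_var :: "nat \<Rightarrow> nat \<Rightarrow> pprog" where
  "goto_var j 0 = PSeq (PWhile j (\<lambda>x. x \<noteq> 3) (PInc j)) (PInc j)"
| "goto_var j (Suc i) = PSeq (PSeq (PWhile j (\<lambda>x. x \<noteq> 3) (PInc j)) (PInc j)) (goto_var j i)"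

lemma does_next_var:
  assumes "j < k" "occurs w (pos j) (us @ 3 # rest)" "set us \<subseteq> {1, 2}"
    "\<And>b. occurs w b rest \<Longrightarrow> Q (pos(j := b))"
  shows "does w k (PSeq (PWhile j (\<lambda>x. x \<noteq> 3) (PInc j)) (PInc j)) pos (2 * length w + 3) Q"
proof -
  let ?b = "pos j + length us"
  have o: "occurs w (pos j) us" "symb w ?b = 3" "?b < length w" "occurs w (Suc ?b) rest"
    using occurs_append[OF assms(2)] occurs_Cons by blast+
  have "does w k (PSeq (PWhile j (\<lambda>x. x \<noteq> 3) (PInc j)) (PInc j)) pos (Suc (2 * length w + 1 + 1)) Q"
  proof (rule does_seq, rule does_scan[OF assms(1), where a = "pos j" and b = ?b])
    fix i assume "pos j \<le> i" "i < ?b"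
    then have "symb w i = us ! (i - pos j)" "i - pos j < length us"
      using occurs_nth[OF o(1), of "i - pos j"] by auto
    then have "symb w i \<in> {1, 2}" using assms(3) nth_mem by fastforce
    then show "symb w i \<noteq> 3" by auto
  next
    show "does w k (PInc j) (pos(j := ?b)) 1 Q"
      using assms(1,4) o by (intro does_inc) auto
  qed (use o in auto)
  then show ?thesis by (rule does_mono) auto
qed

text \<open>The prefix \<open>us\<close> is the unread rest of the current numeral: the symbol
  number at the start, a skipped variable later in the induction.\<close>

lemma does_goto_var:
  assumes "j < k" "i < length vs" "occurs w (pos j) (us @ tail vs)" "set us \<subseteq> {1, 2}"
    "\<And>b d. occurs w b (bin (vs ! i) @ [d]) \<Longrightarrow> d \<in> {3, 4} \<Longrightarrow> Q (pos(j := b))"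
  shows "does w k (goto_var j i) pos ((i + 1) * (2 * length w + 4)) Q"
  using assms(2-)
proof (induction i arbitrary: vs us pos)
  case 0
  then obtain v vs' where vs: "vs = v # vs'" by (cases vs) auto
  obtain d ds where d: "d \<in> {3, 4}" "tail vs' = d # ds" using tail_split by blast
  have "does w k (goto_var j 0) pos (2 * length w + 3) Q"
    unfolding goto_var.simps
  proof (rule does_next_var[OF assms(1)])
    show "occurs w (pos j) (us @ 3 # bin v @ tail vs')" using 0 vs by simp
    fix b assume "occurs w b (bin v @ tail vs')"
    then have "occurs w b ((bin v @ [d]) @ ds)" using d(2) by simp
    then have "occurs w b (bin (vs ! 0) @ [d])" using occurs_append vs by fastforce
    then show "Q (pos(j := b))" using d(1) by (rule 0(4))
  qed (use 0 in auto)
  then show ?case by (rule does_mono) auto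
next
  case (Suc i)
  then obtain v vs' where vs: "vs = v # vs'" by (cases vs) auto
  have "does w k (goto_var j (Suc i)) pos (Suc ((2 * length w + 3) + (i + 1) * (2 * length w + 4))) Q"
    unfolding goto_var.simps
  proof (rule does_seq, rule does_next_var[OF assms(1)])
    show "occurs w (pos j) (us @ 3 # bin v @ tail vs')" using Suc vs by simp
    fix b assume b: "occurs w b (bin v @ tail vs')"
    show "does w k (goto_var j i) (pos(j := b)) ((i + 1) * (2 * length w + 4)) Q"
    proof (rule Suc.IH)
      show "occurs w ((pos(j := b)) j) (bin v @ tail vs')" using b by simp
      fix c d assume "occurs w c (bin (vs' ! i) @ [d])" "d \<in> {3, 4}"
      then have "Q (pos(j := c))" by (intro Suc.prems(4)[of c d]) (simp_all add: vs)
      then show "Q (pos(j := b, j := c))" by (simp only: fun_upd_upd)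
    qed (use Suc.prems vs set_bin in auto)
  qed (use Suc in auto)
  then show ?case by (rule does_mono) (simp_all add: algebra_simps)
qed

locale alg =
  fixes V :: "nat \<Rightarrow> nat list" and s :: nat
begin

text \<open>The pointers below \<open>s\<close> select one atom of the instance for each atom of the query. \<open>Z\<close> stays
  at position 0, \<open>X\<close> and \<open>Y\<close> are scratch, and \<open>R\<close> leaves position 0 once a solution has been found.\<close>

abbreviation "Z \<equiv> s"
abbreviation "X \<equiv> s + 1"
abbreviation "Y \<equiv> s + 2"
abbreviation "R \<equiv> s + 3"
abbreviation "k \<equiv> s + 4"

definition agree :: "(nat \<Rightarrow> nat) \<Rightarrow> (nat \<Rightarrow> nat) \<Rightarrow> bool" where
  "agree pos' pos \<longleftrightarrow> (\<forall>j. j \<noteq> X \<and> j \<noteq> Y \<longrightarrow> pos' j = pos j)"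

text \<open>A mismatch is recorded in the position of \<open>X\<close>: behind the word it reads 0,
  which stops the loop of \<open>cmp\<close> and is neither of the terminators 3 and 4.\<close>

definition cmp_fail :: pprog where "cmp_fail = PWhile X (\<lambda>x. x \<noteq> 0) (PInc X)"
definition cmp_both :: pprog where "cmp_both = PSeq (PInc X) (PInc Y)"
definition cmp_step :: pprog where
  "cmp_step = PIf X (\<lambda>x. x = 1) (PIf Y (\<lambda>x. x = 1) cmp_both cmp_fail) (PIf Y (\<lambda>x. x = 2) cmp_both cmp_fail)"
definition cmp :: pprog where "cmp = PWhile X (\<lambda>x. x = 1 \<or> x = 2) cmp_step"

lemma does_cmp_step:
  assumes "symb w (pos X) \<in> {1, 2}"
    and "symb w (pos Y) = symb w (pos X) \<Longrightarrow> does w k cmp_both pos T Q"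
    and "symb w (pos Y) \<noteq> symb w (pos X) \<Longrightarrow> does w k cmp_fail pos T Q"
  shows "does w k cmp_step pos (T + 2) Q"
proof -
  have "does w k cmp_step pos (Suc (Suc T)) Q"
    unfolding cmp_step_def using assms
    by (intro does_if) (auto intro!: does_if)
  then show ?thesis by (rule does_mono) auto
qed

lemma does_cmp_fail:
  assumes "set w \<subseteq> {1..<5}" "pos X \<le> length w" "Q (pos(X := length w))"
  shows "does w k cmp_fail pos (2 * length w + 1) Q"
  unfolding cmp_fail_def
proof (rule does_scan[where a = "pos X" and b = "length w"])
  fix i assume "i < length w"
  then have "w ! i \<in> {1..<5}" using assms(1) nth_mem by blast
  then show "symb w i \<noteq> 0" using \<open>i < length w\<close> by (auto simp: symb_def)
qed (use assms in \<open>auto simp: symb_def\<close>)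

text \<open>Equal numerals bring both pointers to terminators. A proper prefix on either side is
  detected too: an early end at \<open>Y\<close> counts as a digit mismatch, an early end at
  \<open>X\<close> leaves \<open>Y\<close> on a digit.\<close>

lemma does_cmp:
  assumes w: "set w \<subseteq> {1..<5}"
    and "occurs w (pos X) (us @ [d])" "occurs w (pos Y) (vs @ [e])"
    and "set us \<subseteq> {1, 2}" "set vs \<subseteq> {1, 2}" and de: "d \<in> {3, 4}" "e \<in> {3, 4}"
    and Q: "\<And>pos'. agree pos' pos \<Longrightarrow>
      (us = vs \<longleftrightarrow> symb w (pos' X) \<in> {3, 4} \<and> symb w (pos' Y) \<in> {3, 4}) \<Longrightarrow> Q pos'"
  shows "does w k cmp pos (10 * length us + 2 * length w + 20) Q"
  using assms(2-5) Q
proof (induction us arbitrary: vs pos)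
  case Nil
  have x: "symb w (pos X) = d" using Nil.prems occurs_Cons by fastforce
  have y: "vs = [] \<longleftrightarrow> symb w (pos Y) \<in> {3, 4}"
    using Nil.prems(2,4) de occurs_Cons[of w "pos Y"] by (cases vs) auto
  have "does w k cmp pos 1 Q"
    unfolding cmp_def using x y de
    by (intro does_while_False Nil.prems(5)) (auto simp: agree_def)
  then show ?case by (rule does_mono) auto
next
  case (Cons u us)
  have x: "symb w (pos X) = u" "u \<in> {1, 2}" "pos X < length w" "occurs w (Suc (pos X)) (us @ [d])"
    using Cons.prems(1,3) occurs_Cons[of w "pos X" u] by auto
  have y: "pos Y < length w" using Cons.prems(2) occurs_le[of w "pos Y"] by fastforce
  have fail: "does w k cmp_fail pos (2 * length w + 1) (\<lambda>pos'. does w k cmp pos' (10 * length us + 10) Q)"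
    if "u # us \<noteq> vs"
  proof (rule does_cmp_fail[OF w])
    have "does w k cmp (pos(X := length w)) 1 Q"
      unfolding cmp_def using that
      by (intro does_while_False Cons.prems(5)) (auto simp: agree_def symb_def)
    then show "does w k cmp (pos(X := length w)) (10 * length us + 10) Q"
      by (rule does_mono) auto
  qed (use x in auto)
  show ?case
  proof (cases "symb w (pos Y) = u")
    case True
    then obtain vs' where vs: "vs = u # vs'"
      using Cons.prems(2) occurs_Cons[of w "pos Y"] x(2) de by (cases vs) auto
    have oy: "occurs w (Suc (pos Y)) (vs' @ [e])" using Cons.prems(2) vs occurs_Cons[of w "pos Y"] by auto
    have "does w k cmp pos (Suc (Suc (1 + 1) + 2 + (10 * length us + 2 * length w + 20))) Q"
      unfolding cmp_def
    proof (rule does_while_True, simp, use x in simp, fold cmp_def, rule does_cmp_step, use x in simp, goal_cases)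
      case 1
      show ?case unfolding cmp_both_def
      proof (rule does_seq, rule does_inc, simp, use x in simp, rule does_inc, simp, use y in simp)
        show "does w k cmp (pos(X := Suc (pos X), Y := Suc ((pos(X := Suc (pos X))) Y)))
          (10 * length us + 2 * length w + 20) Q"
          using Cons.prems x oy vs
          by (intro Cons.IH[of _ vs']) (auto simp: agree_def)
      qed
    qed (use True x in simp)
    then show ?thesis by (rule does_mono) auto
  next
    case False
    then have ne: "u # us \<noteq> vs" using Cons.prems(2) occurs_Cons[of w "pos Y"] by (cases vs) auto
    have "does w k cmp pos (Suc ((2 * length w + 1) + 2 + (10 * length us + 10))) Q"
      unfolding cmp_def
      by (rule does_while_True, simp, use x in simp, fold cmp_def, rule does_cmp_step)
        (use x False fail[OF ne] in simp_all)
    then show ?thesis by (rule does_mono) auto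
  qed
qed

fun digits :: "nat list \<Rightarrow> pprog \<Rightarrow> pprog" where
  "digits [] p = p"
| "digits (d # ds) p = PIf X (\<lambda>x. x = d) (PSeq (PInc X) (digits ds p)) PSkip"

text \<open>The separator 3 is matched together with the digits, so that a numeral of which
  \<open>bin f\<close> is a proper prefix is rejected.\<close>

definition sym_check :: "nat \<Rightarrow> pprog \<Rightarrow> pprog" where
  "sym_check f p = PSeq (PCopy X f) (digits (bin f @ [3]) p)"

definition eq_check :: "nat \<times> nat \<times> nat \<times> nat \<Rightarrow> pprog \<Rightarrow> pprog" where
  "eq_check q p = (case q of (f, i, g, j) \<Rightarrow>
     PSeq (PCopy X f) (PSeq (goto_var X i) (PSeq (PCopy Y g) (PSeq (goto_var Y j)
       (PSeq cmp (PIf X (\<lambda>x. x = 3 \<or> x = 4) (PIf Y (\<lambda>x. x = 3 \<or> x = 4) p PSkip) PSkip))))))"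

text \<open>A check takes its continuation as an argument and runs it iff the tested condition \<open>b\<close> holds.\<close>

definition checker :: "nat list \<Rightarrow> ((nat \<Rightarrow> nat) \<Rightarrow> bool) \<Rightarrow> (pprog \<Rightarrow> pprog) \<Rightarrow> bool \<Rightarrow> nat \<Rightarrow> bool" where
  "checker w I c b T \<longleftrightarrow> (\<forall>pos p U Q. I pos \<longrightarrow>
     (b \<longrightarrow> (\<forall>pos'. agree pos' pos \<longrightarrow> does w k p pos' U Q)) \<longrightarrow>
     (\<not> b \<longrightarrow> (\<forall>pos'. agree pos' pos \<longrightarrow> Q pos')) \<longrightarrow> does w k (c p) pos (T + U) Q)"

lemma agree_trans: "agree a b \<Longrightarrow> agree b c \<Longrightarrow> agree a c"
  by (simp add: agree_def)

text \<open>Nesting the continuations makes the tests run in order and stop at the first failure, so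
  the costs add up. The invariant survives because a check moves only the scratch pointers.\<close>

lemma checker_foldr:
  assumes "\<And>x. x \<in> set xs \<Longrightarrow> checker w I (c x) (b x) (T x)"
    and "\<And>pos pos'. I pos \<Longrightarrow> agree pos' pos \<Longrightarrow> I pos'"
  shows "checker w I (foldr c xs) (\<forall>x\<in>set xs. b x) (Suc (sum_list (map T xs)))"
  using assms(1)
proof (induction xs)
  case Nil
  then show ?case by (auto simp: checker_def agree_def intro: does_mono)
next
  case (Cons x xs)
  have x: "checker w I (c x) (b x) (T x)" using Cons by simp
  have xs: "checker w I (foldr c xs) (\<forall>x\<in>set xs. b x) (Suc (sum_list (map T xs)))" using Cons by simp
  show ?case
    unfolding checker_def
  proof (intro allI impI, goal_cases)
    case (1 pos p U Q)
    have "does w k (c x (foldr c xs p)) pos (T x + (Suc (sum_list (map T xs)) + U)) Q"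
    proof (rule x[unfolded checker_def, rule_format])
      show "I pos" by fact
    next
      fix pos' assume p: "b x" "agree pos' pos"
      show "does w k (foldr c xs p) pos' (Suc (sum_list (map T xs)) + U) Q"
        using 1 p agree_trans[OF _ p(2)] assms(2)[OF 1(1) p(2)]
        by (intro xs[unfolded checker_def, rule_format]) auto
    qed (use 1 in auto)
    moreover have "T x + (Suc (sum_list (map T xs)) + U) = Suc (sum_list (map T (x # xs))) + U" by simp
    ultimately show ?case by (simp only: foldr_Cons o_apply)
  qed
qed

text \<open>The pattern contains no 0, so a matched symbol lies inside the word and
  \<open>PInc\<close> is permitted there.\<close>

lemma does_digits:
  assumes "0 \<notin> set ds"
    and "\<And>pos'. \<forall>i<length ds. symb w (pos X + i) = ds ! i \<Longrightarrow> agree pos' pos \<Longrightarrow> does w k p pos' U Q"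
    and "\<And>pos'. \<not> (\<forall>i<length ds. symb w (pos X + i) = ds ! i) \<Longrightarrow> agree pos' pos \<Longrightarrow> Q pos'"
  shows "does w k (digits ds p) pos (3 * length ds + 2 + U) Q"
  using assms
proof (induction ds arbitrary: pos)
  case Nil
  then have "does w k (digits [] p) pos U Q" by (simp add: agree_def)
  then show ?case by (rule does_mono) auto
next
  case (Cons d ds)
  have *: "(\<forall>i<length (d # ds). symb w (pos X + i) = (d # ds) ! i) \<longleftrightarrow>
    symb w (pos X) = d \<and> (\<forall>i<length ds. symb w (Suc (pos X) + i) = ds ! i)"
    by (auto simp: less_Suc_eq_0_disj)
  show ?case
  proof (cases "symb w (pos X) = d")
    case True
    have "does w k (digits (d # ds) p) pos (Suc (Suc (1 + (3 * length ds + 2 + U)))) Q"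
      unfolding digits.simps
    proof (rule does_if, simp, simp only: True simp_thms if_True, rule does_seq, rule does_inc)
      show "does w k (digits ds p) (pos(X := Suc (pos X))) (3 * length ds + 2 + U) Q"
        using Cons.prems(1) Cons.prems(2,3)[unfolded *] True
        by (intro Cons.IH) (auto simp: agree_def)
    qed (use Cons.prems True in \<open>auto simp: symb_def split: if_splits\<close>)
    then show ?thesis by (rule does_mono) auto
  next
    case False
    have "does w k (digits (d # ds) p) pos (Suc 1) Q"
      unfolding digits.simps using False Cons.prems(3)[of pos, unfolded *]
      by (intro does_if) (auto intro!: does_skip[simplified] simp: agree_def)
    then show ?thesis by (rule does_mono) auto
  qed
qed


text \<open>Numerals consist of 1 and 2 only, so the final 3 prevents either word from being a
  proper prefix of the other; \<open>bin_inj\<close> does the rest.\<close>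

lemma bin_match:
  assumes "occurs w a (bin g @ [3])"
  shows "(\<forall>i<length (bin f @ [3]). symb w (a + i) = (bin f @ [3]) ! i) \<longleftrightarrow> f = g"
proof
  assume m: "\<forall>i<length (bin f @ [3]). symb w (a + i) = (bin f @ [3]) ! i"
  have *: "(bin f @ [3]) ! i = (bin g @ [3]) ! i" if "i \<le> length (bin f)" "i \<le> length (bin g)" for i
    using m occurs_nth[OF assms, of i] that by simp
  have 3: "(bin h @ [3]) ! i \<noteq> 3" if "i < length (bin h)" for h i
  proof -
    have "bin h ! i \<in> {1, 2}" using that set_bin[of h] nth_mem by blast
    then show ?thesis using that by (auto simp: nth_append)
  qed
  have "length (bin f) = length (bin g)"
  proof (rule ccontr)
    assume "length (bin f) \<noteq> length (bin g)"
    then consider "length (bin f) < length (bin g)" | "length (bin g) < length (bin f)" by linarith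
    then show False
      by cases (use *[of "length (bin f)"] *[of "length (bin g)"] 3[of "length (bin f)" g] 3[of "length (bin g)" f] in auto)
  qed
  moreover have "bin f ! i = bin g ! i" if "i < length (bin f)" "i < length (bin g)" for i
    using *[of i] that by (simp add: nth_append)
  ultimately have "bin f = bin g" by (intro nth_equalityI) auto
  then show "f = g" by (rule bin_inj)
qed (use occurs_nth[OF assms] in simp)

lemma sym_checker:
  assumes "f < s" "I = (\<lambda>pos. \<forall>f<s. pos f = A f)" "occurs w (A f) (bin g @ [3])"
  shows "checker w I (sym_check f) (f = g) (3 * length (bin f) + 10)"
  unfolding checker_def
proof (intro allI impI, goal_cases)
  case (1 pos p U Q)
  have "pos f = A f" using 1 assms by simp
  then have m: "(\<forall>i<length (bin f @ [3]). symb w ((pos(X := pos f)) X + i) = (bin f @ [3]) ! i) \<longleftrightarrow> f = g"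
    using bin_match[OF assms(3)] by simp
  have ag: "agree pos' (pos(X := pos f)) \<Longrightarrow> agree pos' pos" for pos'
    by (simp add: agree_def)
  have "does w k (sym_check f p) pos (Suc (1 + (3 * length (bin f @ [3]) + 2 + U))) Q"
    unfolding sym_check_def
  proof (rule does_seq, rule does_copy)
    show "does w k (digits (bin f @ [3]) p) (pos(X := pos f)) (3 * length (bin f @ [3]) + 2 + U) Q"
    proof (rule does_digits)
      show "0 \<notin> set (bin f @ [3])" using set_bin[of f] by auto
    qed (use 1 m ag in blast)+
  qed (use assms in auto)
  then show ?case by (rule does_mono) auto
qed

lemma eq_checker:
  assumes "f < s" "g < s" "I = (\<lambda>pos. \<forall>f<s. pos f = A f)" "set w \<subseteq> {1..<5}"
    "occurs w (A f) (bin f' @ tail us)" "i < length us"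
    "occurs w (A g) (bin g' @ tail vs)" "j < length vs"
  shows "checker w I (eq_check (f, i, g, j)) (us ! i = vs ! j) ((i + j + 10) * (20 * length w + 20))"
  unfolding checker_def
proof (intro allI impI, goal_cases)
  case (1 pos p U Q)
  have A: "pos f = A f" "pos g = A g" using 1 assms by auto
  let ?n = "length w"
  let ?t = "PIf X (\<lambda>x. x = 3 \<or> x = 4) (PIf Y (\<lambda>x. x = 3 \<or> x = 4) p PSkip) PSkip"
  have tests: "does w k ?t pos' (Suc (Suc (1 + U))) Q"
    if "agree pos' pos" "us ! i = vs ! j \<longleftrightarrow> symb w (pos' X) \<in> {3, 4} \<and> symb w (pos' Y) \<in> {3, 4}" for pos'
  proof -
    have p: "us ! i = vs ! j \<Longrightarrow> does w k p pos' (1 + U) Q"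
      by (rule does_mono[of _ _ _ _ U]) (use 1 that in auto)
    have q: "us ! i \<noteq> vs ! j \<Longrightarrow> does w k PSkip pos' T Q" if "T > 0" for T
      by (rule does_mono, rule does_skip) (use 1 that \<open>agree pos' pos\<close> in auto)
    show ?thesis
      by (intro does_if; use that p q in \<open>auto intro!: does_if\<close>)
  qed
  have "does w k (eq_check (f, i, g, j) p) pos
     (Suc (1 + Suc ((i + 1) * (2 * ?n + 4) + Suc (1 + Suc ((j + 1) * (2 * ?n + 4) +
        Suc ((12 * ?n + 20) + Suc (Suc (1 + U)))))))) Q"
    unfolding eq_check_def prod.case
  proof (rule does_seq, rule does_copy)
    let ?p1 = "pos(X := pos f)"
    show "does w k (PSeq (goto_var X i) (PSeq (PCopy Y g) (PSeq (goto_var Y j)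
       (PSeq cmp ?t)))) ?p1
       (Suc ((i + 1) * (2 * ?n + 4) + Suc (1 + Suc ((j + 1) * (2 * ?n + 4) +
        Suc ((12 * ?n + 20) + Suc (Suc (1 + U))))))) Q"
    proof (rule does_seq, rule does_goto_var)
      show "i < length us" by fact
      show "occurs w (?p1 X) (bin f' @ tail us)" using assms A by simp
      fix b d assume b: "occurs w b (bin (us ! i) @ [d])" "d \<in> {3, 4}"
      let ?p2 = "?p1(X := b)"
      show "does w k (PSeq (PCopy Y g) (PSeq (goto_var Y j)
        (PSeq cmp ?t))) ?p2
        (Suc (1 + Suc ((j + 1) * (2 * ?n + 4) + Suc ((12 * ?n + 20) + Suc (Suc (1 + U)))))) Q"
      proof (rule does_seq, rule does_copy)
        let ?p3 = "?p2(Y := ?p2 g)"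
        show "does w k (PSeq (goto_var Y j)
          (PSeq cmp ?t)) ?p3
          (Suc ((j + 1) * (2 * ?n + 4) + Suc ((12 * ?n + 20) + Suc (Suc (1 + U))))) Q"
        proof (rule does_seq, rule does_goto_var)
          show "j < length vs" by fact
          show "occurs w (?p3 Y) (bin g' @ tail vs)" using assms A by simp
          fix c e assume c: "occurs w c (bin (vs ! j) @ [e])" "e \<in> {3, 4}"
          let ?p4 = "?p3(Y := c)"
          show "does w k (PSeq cmp ?t) ?p4
            (Suc ((12 * ?n + 20) + Suc (Suc (1 + U)))) Q"
          proof (rule does_seq, rule does_le[OF does_cmp])
            show "set w \<subseteq> {1..<5}" by fact
            show "occurs w (?p4 X) (bin (us ! i) @ [d])" "occurs w (?p4 Y) (bin (vs ! j) @ [e])"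
              using b c by simp_all
            show "d \<in> {3, 4}" "e \<in> {3, 4}" by fact+
            show "10 * length (bin (us ! i)) + 2 * ?n + 20 \<le> 12 * ?n + 20"
              using occurs_le[OF b(1)] by simp
            fix pos' assume ag: "agree pos' ?p4"
              "bin (us ! i) = bin (vs ! j) \<longleftrightarrow> symb w (pos' X) \<in> {3, 4} \<and> symb w (pos' Y) \<in> {3, 4}"
            have "agree pos' pos" using ag(1) by (simp add: agree_def)
            moreover have "us ! i = vs ! j \<longleftrightarrow> bin (us ! i) = bin (vs ! j)"
              using bin_inj by auto
            ultimately show "does w k ?t pos' (Suc (Suc (1 + U))) Q"
              using ag(2) by (intro tests) simp_all
          qed (use set_bin in auto)
        qed (use set_bin in auto)
      qed (use assms in auto)
    qed (use set_bin in auto)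
  qed (use assms in auto)
  then show ?case by (rule does_mono) (auto simp: algebra_simps)
qed

end

lemma set_enc_inst: "set (enc_inst inst) \<subseteq> {1..<5}"
proof -
  have "set (enc_atom a) \<subseteq> {1..<5}" for a
  proof -
    have "set (bin n) \<subseteq> {1..<5}" for n using set_bin[of n] by auto
    then show ?thesis by (auto simp: enc_atom_def simp del: atLeastLessThan_iff) auto
  qed
  then show ?thesis by (auto simp: enc_inst_def)
qed

section \<open>Exhaustive search over the choices of an instance atom for each query atom\<close>

definition off :: "(nat \<times> nat list) list \<Rightarrow> nat \<Rightarrow> nat" where
  "off inst i = length (enc_inst (take i inst))"

lemma off_Suc: "i < length inst \<Longrightarrow> off inst (Suc i) = off inst i + length (enc_atom (inst ! i))"
  by (simp add: off_def enc_inst_def take_Suc_conv_app_nth)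

lemma off_length: "off inst (length inst) = length (enc_inst inst)"
  by (simp add: off_def)

lemma occurs_atom:
  assumes "i < length inst" shows "occurs (enc_inst inst) (off inst i) (enc_atom (inst ! i))"
  unfolding occurs_def
proof (intro exI conjI)
  show "enc_inst inst = enc_inst (take i inst) @ enc_atom (inst ! i) @ enc_inst (drop (Suc i) inst)"
    using id_take_nth_drop[OF assms] by (metis concat.simps(2) concat_append enc_inst_def list.map(2) map_append)
qed (simp add: off_def)

context alg
begin

text \<open>Agreement on these pairs of places is what makes a choice of instance atoms come from a
  single map of the variables.\<close>

definition pairs :: "(nat \<times> nat \<times> nat \<times> nat) list" where
  "pairs = [(f, i, g, j). f \<leftarrow> [0..<s], i \<leftarrow> [0..<length (V f)], g \<leftarrow> [0..<s], j \<leftarrow> [0..<length (V g)], V f ! i = V g ! j]"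

lemma set_pairs: "set pairs = {(f, i, g, j). f < s \<and> i < length (V f) \<and> g < s \<and> j < length (V g) \<and> V f ! i = V g ! j}"
  by (auto simp: pairs_def)

definition ok :: "(nat \<times> nat list) list \<Rightarrow> (nat \<Rightarrow> nat) \<Rightarrow> bool" where
  "ok inst J \<longleftrightarrow> (\<forall>f<s. fst (inst ! J f) = f) \<and>
     (\<forall>(f, i, g, j)\<in>set pairs. snd (inst ! J f) ! i = snd (inst ! J g) ! j)"

text \<open>Excluding nullary atoms guarantees that a symbol number is followed by the separator 3,
  as \<open>sym_check\<close> expects.\<close>

definition valid :: "(nat \<times> nat list) list \<Rightarrow> bool" where
  "valid inst \<longleftrightarrow> (\<forall>(r, vs)\<in>set inst. r < s \<and> length vs = length (V r) \<and> V r \<noteq> [])"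

text \<open>Resetting \<open>R\<close> before the increment keeps it at 1 however many solutions are
  found, so the increment stays within the word.\<close>

definition mark_found :: pprog where "mark_found = PSeq (PCopy R Z) (PInc R)"

definition check_all :: pprog where
  "check_all = foldr sym_check [0..<s] (foldr eq_check pairs mark_found)"

definition eq_cost :: "nat \<times> nat \<times> nat \<times> nat \<Rightarrow> nat" where "eq_cost q = (case q of (f, i, g, j) \<Rightarrow> (i + j + 10) * 20)"
definition check_cost :: nat where
  "check_cost = sum_list (map (\<lambda>f. 3 * length (bin f) + 10) [0..<s]) + sum_list (map eq_cost pairs) + 10"

lemma does_check_all:
  assumes "valid inst" "s > 0"
    and J: "\<And>f. f < s \<Longrightarrow> J f < length inst \<and> pos f = off inst (J f)" "pos Z = 0"
  shows "does (enc_inst inst) k check_all pos (check_cost * Suc (length (enc_inst inst)))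
    (\<lambda>pos'. (\<forall>j\<le>s. pos' j = pos j) \<and> (pos' R \<noteq> 0 \<longleftrightarrow> pos R \<noteq> 0 \<or> ok inst J))"
proof -
  let ?w = "enc_inst inst" and ?I = "\<lambda>p. \<forall>f<s. p f = off inst (J f)"
  let ?Q = "\<lambda>pos'. (\<forall>j\<le>s. pos' j = pos j) \<and> (pos' R \<noteq> 0 \<longleftrightarrow> pos R \<noteq> 0 \<or> ok inst J)"
  let ?bs = "\<forall>f\<in>set [0..<s]. f = fst (inst ! J f)"
  let ?be = "\<forall>q\<in>set pairs. case q of (f, i, g, j) \<Rightarrow> snd (inst ! J f) ! i = snd (inst ! J g) ! j"
  have occ: "occurs ?w (off inst (J f)) (bin (fst (inst ! J f)) @ tail (snd (inst ! J f)))" if "f < s" for f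
    using occurs_atom[of "J f" inst] J that by (metis enc_atom_eq prod.collapse)
  have len: "length (snd (inst ! J f)) = length (V (fst (inst ! J f)))" "snd (inst ! J f) \<noteq> []" if "f < s" for f
  proof -
    obtain r vs where rv: "inst ! J f = (r, vs)" by (rule prod.exhaust)
    then have "(r, vs) \<in> set inst" using J(1)[OF that] by (metis nth_mem)
    then show "length (snd (inst ! J f)) = length (V (fst (inst ! J f)))" "snd (inst ! J f) \<noteq> []"
      using assms(1) rv by (auto simp: valid_def)
  qed
  have I: "?I p \<Longrightarrow> agree p' p \<Longrightarrow> ?I p'" for p p' by (simp add: agree_def)
  have S: "checker ?w ?I (foldr sym_check [0..<s]) ?bs (Suc (sum_list (map (\<lambda>f. 3 * length (bin f) + 10) [0..<s])))"
  proof (rule checker_foldr)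
    fix f assume "f \<in> set [0..<s]"
    then have f: "f < s" by simp
    obtain v vs where v: "snd (inst ! J f) = v # vs" using len[OF f] by (cases "snd (inst ! J f)") auto
    have "occurs ?w (off inst (J f)) ((bin (fst (inst ! J f)) @ [3]) @ bin v @ tail vs)"
      using occ[OF f] by (simp add: v)
    then show "checker ?w ?I (sym_check f) (f = fst (inst ! J f)) (3 * length (bin f) + 10)"
      using occurs_append f by (intro sym_checker[where A = "\<lambda>f. off inst (J f)"]) blast+
  qed (rule I)
  \<comment> \<open>The equality tests are specified only after the symbols have been verified,
    because only then do the chosen atoms have the lengths for which the places in
    \<open>pairs\<close> exist.\<close>
  have E: "checker ?w ?I (foldr eq_check pairs) ?be (Suc (sum_list (map (\<lambda>q. eq_cost q * Suc (length ?w)) pairs)))"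
    if bs: ?bs
  proof (rule checker_foldr)
    fix q assume q: "q \<in> set pairs"
    obtain f i g j where fi: "q = (f, i, g, j)" by (cases q)
    with q have *: "f < s" "i < length (V f)" "g < s" "j < length (V g)" by (auto simp: set_pairs)
    then have "fst (inst ! J f) = f" "fst (inst ! J g) = g" using bs by auto
    then have "i < length (snd (inst ! J f))" "j < length (snd (inst ! J g))" using * len by auto
    then have "checker ?w ?I (eq_check (f, i, g, j)) (snd (inst ! J f) ! i = snd (inst ! J g) ! j)
        ((i + j + 10) * (20 * length ?w + 20))"
      using occ * set_enc_inst by (intro eq_checker[where A = "\<lambda>f. off inst (J f)"]) auto
    then show "checker ?w ?I (eq_check q) (case q of (f, i, g, j) \<Rightarrow> snd (inst ! J f) ! i = snd (inst ! J g) ! j)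
        (eq_cost q * Suc (length ?w))"
      by (simp add: fi eq_cost_def algebra_simps)
  qed (rule I)
  have "off inst (J 0) < length ?w" 
    using occurs_le[OF occ[of 0]] assms(2) by simp
  then have w: "length ?w > 0" by linarith
  have fin: "does ?w k mark_found p 3 ?Q" if "agree p pos" "ok inst J" for p
  proof -
    have "does ?w k mark_found p (Suc (1 + 1)) ?Q"
      unfolding mark_found_def
      by (intro does_seq does_copy does_inc) (use that w J(2) in \<open>auto simp: agree_def\<close>)
    then show ?thesis by (rule does_le) simp
  qed
  have okeq: "ok inst J \<longleftrightarrow> ?bs \<and> ?be" by (auto simp: ok_def)
  have "does ?w k check_all pos (Suc (sum_list (map (\<lambda>f. 3 * length (bin f) + 10) [0..<s]))
     + (Suc (sum_list (map (\<lambda>q. eq_cost q * Suc (length ?w)) pairs)) + 3)) ?Q"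
    unfolding check_all_def
  proof (rule S[unfolded checker_def, rule_format])
    show "pos f = off inst (J f)" if "f < s" for f using J(1) that by blast
  next
    fix p assume p: "f \<in> set [0..<s] \<Longrightarrow> f = fst (inst ! J f)" "agree p pos" for f
    then have bs: ?bs by blast
    show "does ?w k (foldr eq_check pairs mark_found) p (Suc (sum_list (map (\<lambda>q. eq_cost q * Suc (length ?w)) pairs)) + 3) ?Q"
    proof (rule E[OF bs, unfolded checker_def, rule_format], goal_cases)
      case (1 f)
      then show ?case using J(1) p(2) by (simp add: agree_def)
    next
      case (2 p')
      then have "ok inst J" using bs unfolding okeq by blast
      then show ?case using fin agree_trans[OF 2(2) p(2)] by blast
    next
      case (3 p')
      then have "\<not> ok inst J" unfolding okeq by blast
      then show ?case using agree_trans[OF 3(2) p(2)] by (simp add: agree_def)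
    qed
  next
    fix p assume p: "\<not> ?bs" "agree p pos"
    then have "\<not> ok inst J" unfolding okeq by blast
    then show "?Q p" using p(2) by (simp add: agree_def)
  qed
  moreover have "sum_list (map (\<lambda>q. eq_cost q * Suc (length ?w)) pairs) = sum_list (map eq_cost pairs) * Suc (length ?w)"
    by (simp only: sum_list_mult_const)
  ultimately show ?thesis
    by (elim does_le) (simp add: check_cost_def algebra_simps)
qed

definition for_atoms :: "nat \<Rightarrow> pprog \<Rightarrow> pprog" where
  "for_atoms f body = PSeq (PCopy f Z) (PWhile f (\<lambda>x. x \<noteq> 0)
     (PSeq body (PSeq (PWhile f (\<lambda>x. x \<noteq> 4) (PInc f)) (PInc f))))"

text \<open>Pointer \<open>f\<close> runs through the starts of the atoms. The body has to leave
  \<open>f\<close>, the larger selectors and \<open>Z\<close> in place, and \<open>R\<close>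
  collects the disjunction over all rounds.\<close>

lemma does_for_atoms:
  assumes f: "f < s" and Z: "pos Z = 0"
    and body: "\<And>i pos'. i < length inst \<Longrightarrow> pos' f = off inst i \<Longrightarrow> \<forall>j. f < j \<and> j \<le> s \<longrightarrow> pos' j = pos j \<Longrightarrow>
      does (enc_inst inst) k body pos' T (\<lambda>pos''. (\<forall>j. f \<le> j \<and> j \<le> s \<longrightarrow> pos'' j = pos' j) \<and> (pos'' R \<noteq> 0 \<longleftrightarrow> pos' R \<noteq> 0 \<or> B i))"
  shows "does (enc_inst inst) k (for_atoms f body) pos (Suc (length (enc_inst inst)) * (T + 2 * length (enc_inst inst) + 7))
    (\<lambda>pos'. (\<forall>j. f < j \<and> j \<le> s \<longrightarrow> pos' j = pos j) \<and> (pos' R \<noteq> 0 \<longleftrightarrow> pos R \<noteq> 0 \<or> (\<exists>i<length inst. B i)))"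
proof -
  let ?w = "enc_inst inst"
  let ?n = "length ?w"
  let ?L = "PWhile f (\<lambda>x. x \<noteq> 0) (PSeq body (PSeq (PWhile f (\<lambda>x. x \<noteq> 4) (PInc f)) (PInc f)))"
  have iter: "does ?w k ?L pos' ((length inst - i) * (T + 2 * ?n + 5) + 1)
    (\<lambda>pos''. (\<forall>j. f < j \<and> j \<le> s \<longrightarrow> pos'' j = pos j) \<and> (pos'' R \<noteq> 0 \<longleftrightarrow> pos' R \<noteq> 0 \<or> (\<exists>i'<length inst. i \<le> i' \<and> B i')))"
    if "i \<le> length inst" "pos' f = off inst i" "\<forall>j. f < j \<and> j \<le> s \<longrightarrow> pos' j = pos j" for i pos'
    using that
  proof (induction i arbitrary: pos' rule: inc_induct)
    case base
    have "does ?w k ?L pos' 1 (\<lambda>pos''. (\<forall>j. f < j \<and> j \<le> s \<longrightarrow> pos'' j = pos j) \<and>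
      (pos'' R \<noteq> 0 \<longleftrightarrow> pos' R \<noteq> 0 \<or> (\<exists>i'<length inst. length inst \<le> i' \<and> B i')))"
      using f base by (intro does_while_False) (auto simp: symb_def off_length)
    then show ?case by (rule does_le) simp
  next
    case (step i)
    let ?Q = "\<lambda>pos''. (\<forall>j. f < j \<and> j \<le> s \<longrightarrow> pos'' j = pos j) \<and>
      (pos'' R \<noteq> 0 \<longleftrightarrow> pos' R \<noteq> 0 \<or> (\<exists>i'<length inst. i \<le> i' \<and> B i'))"
    obtain r vs where rv: "inst ! i = (r, vs)" by fastforce
    define us where "us = bin r @ concat (map (\<lambda>v. 3 # bin v) vs)"
    have enc: "enc_atom (inst ! i) = us @ [4]" by (simp add: rv us_def enc_atom_def)
    have "4 \<notin> set (bin m)" for m using set_bin[of m] by auto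
    then have us: "4 \<notin> set us" by (auto simp: us_def)
    have occ: "occurs ?w (off inst i) (us @ [4])" using occurs_atom[of i inst] step enc by simp
    then have occ': "occurs ?w (off inst i) us" "symb ?w (off inst i + length us) = 4"
      using occurs_append[of ?w "off inst i" us "[4]"] occurs_Cons[of ?w _ 4 "[]"] by auto
    have le: "off inst i + length us < ?n" using occurs_le[OF occ] by simp
    have "?w ! off inst i \<in> {1..<5}" using set_enc_inst le nth_mem by (meson add_lessD1 subsetD)
    then have nz: "symb ?w (off inst i) \<noteq> 0" using le by (auto simp: symb_def)
    let ?rest = "(length inst - Suc i) * (T + 2 * ?n + 5) + 1"
    have "does ?w k ?L pos' (Suc (Suc (T + Suc ((2 * ?n + 1) + 1)) + ?rest)) ?Q"
    proof (rule does_while_True)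
      show "does ?w k (PSeq body (PSeq (PWhile f (\<lambda>x. x \<noteq> 4) (PInc f)) (PInc f))) pos'
        (Suc (T + Suc ((2 * ?n + 1) + 1))) (\<lambda>p. does ?w k ?L p ?rest ?Q)"
      proof (rule does_seq, rule does_mono[OF body[OF _ step.prems]])
        fix p assume p: "(\<forall>j. f \<le> j \<and> j \<le> s \<longrightarrow> p j = pos' j) \<and> (p R \<noteq> 0 \<longleftrightarrow> pos' R \<noteq> 0 \<or> B i)"
        show "does ?w k (PSeq (PWhile f (\<lambda>x. x \<noteq> 4) (PInc f)) (PInc f)) p (Suc ((2 * ?n + 1) + 1)) (\<lambda>p. does ?w k ?L p ?rest ?Q)"
        proof (rule does_seq, rule does_scan[where a = "off inst i" and b = "off inst i + length us"])
          fix c assume "off inst i \<le> c" "c < off inst i + length us"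
          then have "symb ?w c = us ! (c - off inst i)" "c - off inst i < length us"
            using occurs_nth[OF occ'(1), of "c - off inst i"] by auto
          then show "symb ?w c \<noteq> 4" using us nth_mem by metis
        next
          show "p f = off inst i" using p step.prems(1) f by simp
          let ?p = "p(f := off inst i + length us)"
          show "does ?w k (PInc f) ?p 1 (\<lambda>p. does ?w k ?L p ?rest ?Q)"
          proof (rule does_inc)
            let ?p' = "?p(f := Suc (?p f))"
            have "does ?w k ?L ?p' ?rest (\<lambda>pos''. (\<forall>j. f < j \<and> j \<le> s \<longrightarrow> pos'' j = pos j) \<and>
              (pos'' R \<noteq> 0 \<longleftrightarrow> ?p' R \<noteq> 0 \<or> (\<exists>i'<length inst. Suc i \<le> i' \<and> B i')))"
            proof (rule step.IH)
              show "?p' f = off inst (Suc i)" using off_Suc[of i inst] step enc by simp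
              show "\<forall>j. f < j \<and> j \<le> s \<longrightarrow> ?p' j = pos j" using p step.prems(2) by auto
            qed
            moreover have "(\<exists>i'<length inst. i \<le> i' \<and> B i') \<longleftrightarrow> B i \<or> (\<exists>i'<length inst. Suc i \<le> i' \<and> B i')"
              using step.hyps(2) by (metis Suc_leD Suc_leI le_neq_implies_less order_refl)
            moreover have "?p' R = p R" using f by simp
            ultimately show "does ?w k ?L ?p' ?rest ?Q"
              using p by (elim does_mono) auto
          qed (use f le in auto)
        qed (use f le occ' in auto)
      qed (use step in auto)
    qed (use f nz step in auto)
    moreover have "Suc (Suc (T + Suc ((2 * ?n + 1) + 1)) + ?rest) = (length inst - i) * (T + 2 * ?n + 5) + 1"
    proof -
      have "length inst - i = Suc (length inst - Suc i)" using step.hyps(2) by simp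
      then show ?thesis by simp
    qed
    ultimately show ?case by simp
  qed
  have "length inst \<le> ?n"
  proof (induction inst)
    case (Cons a inst)
    then show ?case using bin_nonempty[of "fst a"] by (simp add: enc_inst_def enc_atom_def)
  qed (simp add: enc_inst_def)
  have "does ?w k (for_atoms f body) pos (Suc (1 + ((length inst - 0) * (T + 2 * ?n + 5) + 1)))
    (\<lambda>pos'. (\<forall>j. f < j \<and> j \<le> s \<longrightarrow> pos' j = pos j) \<and> (pos' R \<noteq> 0 \<longleftrightarrow> pos R \<noteq> 0 \<or> (\<exists>i<length inst. B i)))"
    unfolding for_atoms_def
  proof (rule does_seq, rule does_copy)
    have "does ?w k ?L (pos(f := pos Z)) ((length inst - 0) * (T + 2 * ?n + 5) + 1)
     (\<lambda>pos''. (\<forall>j. f < j \<and> j \<le> s \<longrightarrow> pos'' j = pos j) \<and> (pos'' R \<noteq> 0 \<longleftrightarrow> (pos(f := pos Z)) R \<noteq> 0 \<or> (\<exists>i'<length inst. 0 \<le> i' \<and> B i')))"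
      by (rule iter) (use Z f in \<open>auto simp: off_def enc_inst_def\<close>)
    then show "does ?w k ?L (pos(f := pos Z)) ((length inst - 0) * (T + 2 * ?n + 5) + 1)
       (\<lambda>pos'. (\<forall>j. f < j \<and> j \<le> s \<longrightarrow> pos' j = pos j) \<and> (pos' R \<noteq> 0 \<longleftrightarrow> pos R \<noteq> 0 \<or> (\<exists>i<length inst. B i)))"
      by (rule does_mono) (use f in auto)
  qed (use f in auto)
  then show ?thesis
  proof (rule does_le)
    have "length inst * (T + 2 * ?n + 5) \<le> ?n * (T + 2 * ?n + 7)"
      using \<open>length inst \<le> ?n\<close> by (intro mult_le_mono) auto
    then show "Suc (1 + ((length inst - 0) * (T + 2 * ?n + 5) + 1)) \<le> Suc ?n * (T + 2 * ?n + 7)" by simp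
  qed
qed

fun nest :: "nat \<Rightarrow> pprog" where
  "nest 0 = check_all"
| "nest (Suc i) = for_atoms i (nest i)"

lemma ok_cong: "(\<And>f. f < s \<Longrightarrow> J f = J' f) \<Longrightarrow> ok inst J = ok inst J'"
  by (auto simp: ok_def set_pairs)

text \<open>Pointers from \<open>i\<close> on stay at the atoms given by \<open>J\<close>; the loops
  inside \<open>nest i\<close> move those below \<open>i\<close>, so the outcome concerns all
  \<open>J'\<close> that extend the fixed part.\<close>

definition nest_spec :: "nat \<Rightarrow> nat \<Rightarrow> nat \<Rightarrow> bool" where
  "nest_spec i c d \<longleftrightarrow> (\<forall>inst J pos. valid inst \<longrightarrow> (\<forall>f. i \<le> f \<and> f < s \<longrightarrow> J f < length inst \<and> pos f = off inst (J f)) \<longrightarrow>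
    pos Z = 0 \<longrightarrow> does (enc_inst inst) k (nest i) pos (c * Suc (length (enc_inst inst)) ^ d)
    (\<lambda>pos'. (\<forall>j. i \<le> j \<and> j \<le> s \<longrightarrow> pos' j = pos j) \<and> (pos' R \<noteq> 0 \<longleftrightarrow> pos R \<noteq> 0 \<or>
      (\<exists>J'. (\<forall>f<s. J' f < length inst) \<and> (\<forall>f. i \<le> f \<and> f < s \<longrightarrow> J' f = J f) \<and> ok inst J'))))"

lemma does_nest:
  assumes "i \<le> s" "s > 0"
  shows "\<exists>c d. nest_spec i c d"
  using assms(1)
proof (induction i)
  case 0
  show ?case
  proof (rule exI[of _ check_cost], rule exI[of _ 1], unfold nest_spec_def, intro allI impI)
    fix inst J and pos :: "nat \<Rightarrow> nat"
    assume v: "valid inst" and J: "\<forall>f. 0 \<le> f \<and> f < s \<longrightarrow> J f < length inst \<and> pos f = off inst (J f)" and Z: "pos Z = 0"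
    have "(\<exists>J'. (\<forall>f<s. J' f < length inst) \<and> (\<forall>f. 0 \<le> f \<and> f < s \<longrightarrow> J' f = J f) \<and> ok inst J') \<longleftrightarrow> ok inst J"
    proof
      assume "\<exists>J'. (\<forall>f<s. J' f < length inst) \<and> (\<forall>f. 0 \<le> f \<and> f < s \<longrightarrow> J' f = J f) \<and> ok inst J'"
      then show "ok inst J" using ok_cong by (metis zero_le)
    qed (use J in blast)
    moreover have "does (enc_inst inst) k check_all pos (check_cost * Suc (length (enc_inst inst)))
      (\<lambda>pos'. (\<forall>j\<le>s. pos' j = pos j) \<and> (pos' R \<noteq> 0 \<longleftrightarrow> pos R \<noteq> 0 \<or> ok inst J))"
      using J Z by (intro does_check_all[OF v assms(2)]) auto
    ultimately show "does (enc_inst inst) k (nest 0) pos (check_cost * Suc (length (enc_inst inst)) ^ 1)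
      (\<lambda>pos'. (\<forall>j. 0 \<le> j \<and> j \<le> s \<longrightarrow> pos' j = pos j) \<and> (pos' R \<noteq> 0 \<longleftrightarrow> pos R \<noteq> 0 \<or>
        (\<exists>J'. (\<forall>f<s. J' f < length inst) \<and> (\<forall>f. 0 \<le> f \<and> f < s \<longrightarrow> J' f = J f) \<and> ok inst J')))"
      by simp
  qed
next
  case (Suc i)
  then obtain c d where cd: "nest_spec i c d" by auto
  show ?case
  \<comment> \<open>One factor \<open>Suc n\<close>, with \<open>n\<close> the input length, bounds
    the number of rounds; the other absorbs the overhead \<open>2 * n + 7\<close> of a round, which
    also contributes the 7.\<close>
  proof (rule exI[of _ "c + 7"], rule exI[of _ "d + 2"], unfold nest_spec_def, intro allI impI)
    fix inst J and pos :: "nat \<Rightarrow> nat"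
    assume v: "valid inst" and J: "\<forall>f. Suc i \<le> f \<and> f < s \<longrightarrow> J f < length inst \<and> pos f = off inst (J f)" and Z: "pos Z = 0"
    let ?n = "length (enc_inst inst)"
    let ?B = "\<lambda>a. \<exists>J'. (\<forall>f<s. J' f < length inst) \<and> (\<forall>f. i \<le> f \<and> f < s \<longrightarrow> J' f = (J(i := a)) f) \<and> ok inst J'"
    have i: "i < s" using Suc.prems by simp
    have "does (enc_inst inst) k (for_atoms i (nest i)) pos (Suc ?n * (c * Suc ?n ^ d + 2 * ?n + 7))
      (\<lambda>pos'. (\<forall>j. i < j \<and> j \<le> s \<longrightarrow> pos' j = pos j) \<and> (pos' R \<noteq> 0 \<longleftrightarrow> pos R \<noteq> 0 \<or> (\<exists>a<length inst. ?B a)))"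
    proof (rule does_for_atoms[where pos = pos, OF i Z])
      fix a p assume a: "a < length inst" "p i = off inst a" and p: "\<forall>j. i < j \<and> j \<le> s \<longrightarrow> p j = pos j"
      show "does (enc_inst inst) k (nest i) p (c * Suc ?n ^ d)
        (\<lambda>pos''. (\<forall>j. i \<le> j \<and> j \<le> s \<longrightarrow> pos'' j = p j) \<and> (pos'' R \<noteq> 0 \<longleftrightarrow> p R \<noteq> 0 \<or> ?B a))"
        by (rule cd[unfolded nest_spec_def, rule_format, OF v]) (use a p J Z i in auto)
    qed
    moreover have "(\<exists>a<length inst. ?B a) \<longleftrightarrow>
      (\<exists>J'. (\<forall>f<s. J' f < length inst) \<and> (\<forall>f. Suc i \<le> f \<and> f < s \<longrightarrow> J' f = J f) \<and> ok inst J')" (is "_ \<longleftrightarrow> ?C")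
    proof
      assume "\<exists>a<length inst. ?B a"
      then obtain J' a where J': "\<forall>f<s. J' f < length inst" "\<forall>f. i \<le> f \<and> f < s \<longrightarrow> J' f = (J(i := a)) f" "ok inst J'"
        by blast
      then have "\<forall>f. Suc i \<le> f \<and> f < s \<longrightarrow> J' f = J f" by auto
      with J' show ?C by blast
    next
      assume ?C
      then obtain J' where J': "\<forall>f<s. J' f < length inst" "\<forall>f. Suc i \<le> f \<and> f < s \<longrightarrow> J' f = J f" "ok inst J'"
        by blast
      then have "\<forall>f. i \<le> f \<and> f < s \<longrightarrow> J' f = (J(i := J' i)) f" by (auto simp: Suc_le_eq)
      with J' i show "\<exists>a<length inst. ?B a" by blast
    qed
    moreover have "Suc ?n * (c * Suc ?n ^ d + 2 * ?n + 7) \<le> (c + 7) * Suc ?n ^ (d + 2)"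
    proof -
      have "c * Suc ?n ^ d * 1 \<le> c * Suc ?n ^ d * Suc ?n" by (intro mult_le_mono) auto
      moreover have "(2 * ?n + 7) * 1 \<le> 7 * Suc ?n * Suc ?n ^ d" by (intro mult_le_mono) auto
      ultimately have "c * Suc ?n ^ d + 2 * ?n + 7 \<le> (c + 7) * Suc ?n ^ (d + 1)"
        by (simp add: algebra_simps)
      then have "Suc ?n * (c * Suc ?n ^ d + 2 * ?n + 7) \<le> Suc ?n * ((c + 7) * Suc ?n ^ (d + 1))"
        by (rule mult_le_mono2)
      then show ?thesis by (simp add: algebra_simps)
    qed
    ultimately show "does (enc_inst inst) k (nest (Suc i)) pos ((c + 7) * Suc ?n ^ (d + 2))
      (\<lambda>pos'. (\<forall>j. Suc i \<le> j \<and> j \<le> s \<longrightarrow> pos' j = pos j) \<and> (pos' R \<noteq> 0 \<longleftrightarrow> pos R \<noteq> 0 \<or> ?C))"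
      unfolding nest.simps by (elim does_mono) (simp_all add: Suc_le_eq)
  qed
qed

text \<open>A variable receives the entry at any place where it occurs; the equalities collected in
  \<open>pairs\<close> make the choice irrelevant.\<close>

lemma ok_iff_hom:
  assumes "valid inst"
  shows "(\<exists>J. (\<forall>f<s. J f < length inst) \<and> ok inst J) \<longleftrightarrow> (\<exists>y. \<forall>f<s. (f, map y (V f)) \<in> set inst)"
proof
  assume "\<exists>J. (\<forall>f<s. J f < length inst) \<and> ok inst J"
  then obtain J where J: "\<And>f. f < s \<Longrightarrow> J f < length inst" "ok inst J" by blast
  define vs where "vs f = snd (inst ! J f)" for f
  have mem: "(f, vs f) \<in> set inst" if "f < s" for f
    using J nth_mem[OF J(1)[OF that]] that by (metis ok_def prod.collapse vs_def)
  have len: "length (vs f) = length (V f)" if "f < s" for f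
    using assms mem[OF that] by (auto simp: valid_def)
  define y where "y v = (SOME x. \<exists>f i. f < s \<and> i < length (V f) \<and> V f ! i = v \<and> x = vs f ! i)" for v
  have "y (V f ! i) = vs f ! i" if fi: "f < s" "i < length (V f)" for f i
  proof -
    have "\<exists>g j. g < s \<and> j < length (V g) \<and> V g ! j = V f ! i \<and> y (V f ! i) = vs g ! j"
      unfolding y_def by (rule someI[of _ "vs f ! i"]) (use fi in blast)
    then obtain g j where "g < s" "j < length (V g)" "V g ! j = V f ! i" "y (V f ! i) = vs g ! j" by blast
    moreover from this have "(f, i, g, j) \<in> set pairs" using fi by (simp add: set_pairs)
    ultimately show ?thesis using J(2) by (auto simp: ok_def vs_def)
  qed
  then have "map y (V f) = vs f" if "f < s" for f
    using len[OF that] that by (intro nth_equalityI) auto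
  then show "\<exists>y. \<forall>f<s. (f, map y (V f)) \<in> set inst" using mem by metis
next
  assume "\<exists>y. \<forall>f<s. (f, map y (V f)) \<in> set inst"
  then obtain y where "\<forall>f<s. (f, map y (V f)) \<in> set inst" by blast
  then have "\<forall>f. \<exists>j. f < s \<longrightarrow> j < length inst \<and> inst ! j = (f, map y (V f))"
    by (metis in_set_conv_nth)
  then obtain J where J: "\<And>f. f < s \<Longrightarrow> J f < length inst \<and> inst ! J f = (f, map y (V f))"
    by metis
  then have "ok inst J"
    by (auto simp: ok_def set_pairs)
  with J show "\<exists>J. (\<forall>f<s. J f < length inst) \<and> ok inst J" by blast
qed

text \<open>Acceptance means that no solution was found, because in the intended CSP an instance is
  satisfiable exactly when the query fails in it.\<close>

theorem hom_query_in_P: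
  assumes "s > 0"
  shows "\<exists>M c d. wf_tm M \<and> (\<forall>inst. valid inst \<longrightarrow> (\<exists>t \<le> c * (length (enc_inst inst) + 1) ^ d.
     let q = fst ((tm_step M ^^ t) (tm_init (enc_inst inst))) in
     (q = 1 \<or> q = 2) \<and> (q = 1 \<longleftrightarrow> \<not> (\<exists>y. \<forall>f<s. (f, map y (V f)) \<in> set inst))))"
proof -
  obtain M where M: "wf_tm M" "\<And>w t pos. set w \<subseteq> {..<5} \<Longrightarrow> pex w k (nest s) (\<lambda>_. 0) t pos \<Longrightarrow>
    \<exists>u \<le> 20 * Suc t * Suc (length w). fst ((tm_step M ^^ u) (tm_init w)) = (if pos R = 0 then 1 else 2)"
    using tm_of_pprog[of R k "nest s"] by auto
  obtain c d where cd: "nest_spec s c d"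
    using does_nest[of s] assms by auto
  have "\<exists>t \<le> (20 * (c + 1)) * (length (enc_inst inst) + 1) ^ (d + 1).
     let q = fst ((tm_step M ^^ t) (tm_init (enc_inst inst))) in
     (q = 1 \<or> q = 2) \<and> (q = 1 \<longleftrightarrow> \<not> (\<exists>y. \<forall>f<s. (f, map y (V f)) \<in> set inst))"
    if v: "valid inst" for inst
  proof -
    let ?w = "enc_inst inst"
    obtain t pos where t: "t \<le> c * Suc (length ?w) ^ d" "pex ?w k (nest s) (\<lambda>_. 0) t pos"
      "pos R \<noteq> 0 \<longleftrightarrow> (\<exists>J'. (\<forall>f<s. J' f < length inst) \<and> ok inst J')"
      using cd[unfolded nest_spec_def, THEN spec[of _ inst], THEN spec[of _ "\<lambda>_. 0"], THEN spec[of _ "\<lambda>_. 0"]] v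
      unfolding does_def by auto
    have "set ?w \<subseteq> {..<5}" using set_enc_inst[of inst] by auto
    then obtain u where u: "u \<le> 20 * Suc t * Suc (length ?w)"
      "fst ((tm_step M ^^ u) (tm_init ?w)) = (if pos R = 0 then 1 else 2)"
      using M(2) t(2) by blast
    have "1 \<le> Suc (length ?w) ^ d" by simp
    then have "Suc t \<le> c * Suc (length ?w) ^ d + 1 * Suc (length ?w) ^ d" using t(1) by linarith
    then have "Suc t \<le> (c + 1) * Suc (length ?w) ^ d" by (simp only: add_mult_distrib)
    then have "20 * Suc t * Suc (length ?w) \<le> 20 * ((c + 1) * Suc (length ?w) ^ d) * Suc (length ?w)"
      by (intro mult_le_mono) auto
    then have "u \<le> (20 * (c + 1)) * (length ?w + 1) ^ (d + 1)" using u(1) by (simp add: algebra_simps)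
    then show ?thesis
      using u(2) t(3) ok_iff_hom[OF v] by (intro exI[of _ u]) (auto simp: Let_def)
  qed
  with M(1) show ?thesis by blast
qed

end

section \<open>Fraisse limits of strong amalgamation classes\<close>

type_synonym fact = "nat \<times> nat list"

definition rest :: "fact set \<Rightarrow> nat set \<Rightarrow> fact set" where
  "rest \<Phi> A = {(r, xs). (r, xs) \<in> \<Phi> \<and> set xs \<subseteq> A}"

definition ren :: "(nat \<Rightarrow> nat) \<Rightarrow> fact set \<Rightarrow> fact set" where
  "ren h \<Phi> = (\<lambda>(r, xs). (r, map h xs)) ` \<Phi>"

lemma rest_rest: "rest (rest \<Phi> A) B = rest \<Phi> (A \<inter> B)"
  by (auto simp: rest_def)

lemma in_rest: "(r, xs) \<in> rest \<Phi> A \<longleftrightarrow> (r, xs) \<in> \<Phi> \<and> set xs \<subseteq> A"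
  by (simp add: rest_def)

lemma in_ren: "(r, ys) \<in> ren h \<Phi> \<longleftrightarrow> (\<exists>xs. ys = map h xs \<and> (r, xs) \<in> \<Phi>)"
  by (auto simp: ren_def)

lemma ren_ren: "ren g (ren h \<Phi>) = ren (g \<circ> h) \<Phi>"
  by (force simp: ren_def image_image)

lemma ren_cong: "(\<And>r xs x. (r, xs) \<in> \<Phi> \<Longrightarrow> x \<in> set xs \<Longrightarrow> g x = h x) \<Longrightarrow> ren g \<Phi> = ren h \<Phi>"
  unfolding ren_def by (rule image_cong) (auto intro: map_cong)

lemma ren_rest_cong: "(\<And>x. x \<in> A \<Longrightarrow> g x = h x) \<Longrightarrow> ren g (rest \<Phi> A) = ren h (rest \<Phi> A)"
  by (rule ren_cong) (auto simp: rest_def)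

lemma map_in_image: "set ys \<subseteq> h ` A \<Longrightarrow> \<exists>xs. ys = map h xs \<and> set xs \<subseteq> A"
  by (metis lists_eq_set lists_image mem_Collect_eq image_iff)

lemma in_ren_map:
  assumes "inj_on h A" "set xs \<subseteq> A" "\<And>r xs. (r, xs) \<in> \<Phi> \<Longrightarrow> set xs \<subseteq> A"
  shows "(r, map h xs) \<in> ren h \<Phi> \<longleftrightarrow> (r, xs) \<in> \<Phi>"
proof
  assume "(r, map h xs) \<in> ren h \<Phi>"
  then obtain ys where ys: "map h xs = map h ys" "(r, ys) \<in> \<Phi>" by (auto simp: in_ren)
  have "inj_on h (set xs \<union> set ys)" using assms(2) assms(3)[OF ys(2)] by (intro inj_on_subset[OF assms(1)]) auto
  then show "(r, xs) \<in> \<Phi>" using ys by (metis inj_on_map_eq_map)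
qed (auto simp: in_ren)

lemma rest_ren:
  assumes "inj_on h A" "B \<subseteq> A" "\<And>r xs. (r, xs) \<in> \<Phi> \<Longrightarrow> set xs \<subseteq> A"
  shows "rest (ren h \<Phi>) (h ` B) = ren h (rest \<Phi> B)"
proof (rule set_eqI, safe)
  fix r ys assume "(r, ys) \<in> rest (ren h \<Phi>) (h ` B)"
  then obtain xs where xs: "ys = map h xs" "(r, xs) \<in> \<Phi>" "h ` set xs \<subseteq> h ` B" by (auto simp: in_rest in_ren)
  have "set xs \<subseteq> B"
  proof
    fix x assume x: "x \<in> set xs"
    then obtain b where "b \<in> B" "h x = h b" using xs(3) by blast
    then show "x \<in> B" using inj_onD[OF assms(1), of x b] assms(2) assms(3)[OF xs(2)] x by auto
  qed
  then show "(r, ys) \<in> ren h (rest \<Phi> B)" using xs by (auto simp: in_rest in_ren)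
qed (fastforce simp: in_rest in_ren)

definition piso :: "fact set \<Rightarrow> fact set \<Rightarrow> nat set \<Rightarrow> (nat \<Rightarrow> nat) \<Rightarrow> bool" where
  "piso \<Theta> \<Phi> X h \<longleftrightarrow> inj_on h X \<and> (\<forall>r xs. set xs \<subseteq> X \<longrightarrow> ((r, xs) \<in> \<Theta> \<longleftrightarrow> (r, map h xs) \<in> \<Phi>))"

text \<open>The image form fits the closure properties of \<open>K\<close>, which speak about
  \<open>ren\<close> and \<open>rest\<close>.\<close>

lemma piso_alt: "piso \<Theta> \<Phi> X h \<longleftrightarrow> inj_on h X \<and> rest \<Phi> (h ` X) = ren h (rest \<Theta> X)"
proof (cases "inj_on h X")
  case inj: True
  show ?thesis
  proof
    assume p: "piso \<Theta> \<Phi> X h"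
    have "rest \<Phi> (h ` X) = ren h (rest \<Theta> X)"
    proof (rule set_eqI, safe)
      fix r ys assume "(r, ys) \<in> rest \<Phi> (h ` X)"
      then obtain xs where "ys = map h xs" "set xs \<subseteq> X" "(r, ys) \<in> \<Phi>"
        using map_in_image[of ys h X] by (auto simp: in_rest)
      then show "(r, ys) \<in> ren h (rest \<Theta> X)" using p by (auto simp: piso_def in_ren in_rest)
    qed (use p in \<open>fastforce simp: piso_def in_ren in_rest\<close>)
    then show "inj_on h X \<and> rest \<Phi> (h ` X) = ren h (rest \<Theta> X)" using inj by simp
  next
    assume e: "inj_on h X \<and> rest \<Phi> (h ` X) = ren h (rest \<Theta> X)"
    have "(r, xs) \<in> \<Theta> \<longleftrightarrow> (r, map h xs) \<in> \<Phi>" if "set xs \<subseteq> X" for r xs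
    proof -
      have "(r, map h xs) \<in> \<Phi> \<longleftrightarrow> (r, map h xs) \<in> rest \<Phi> (h ` X)" using that by (auto simp: in_rest)
      also have "\<dots> \<longleftrightarrow> (r, xs) \<in> rest \<Theta> X"
        using e in_ren_map[OF inj that, of "rest \<Theta> X"] by (auto simp: in_rest)
      finally show ?thesis using that by (simp add: in_rest)
    qed
    then show "piso \<Theta> \<Phi> X h" using inj by (simp add: piso_def)
  qed
qed (simp add: piso_def)

lemma piso_inverse:
  assumes "piso \<Theta> \<Phi> X h" "\<And>x. x \<in> X \<Longrightarrow> g (h x) = x"
  shows "piso \<Phi> \<Theta> (h ` X) g"
  unfolding piso_def
proof (intro conjI allI impI)
  show "inj_on g (h ` X)" using assms(2) by (auto simp: inj_on_def)
  fix r ys assume "set ys \<subseteq> h ` X"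
  then obtain xs where xs: "ys = map h xs" "set xs \<subseteq> X" using map_in_image by metis
  then have "map g ys = xs" using assms(2) by (auto simp: map_idI subset_iff)
  then show "(r, ys) \<in> \<Phi> \<longleftrightarrow> (r, map g ys) \<in> \<Theta>" using assms(1) xs by (auto simp: piso_def)
qed

text \<open>Common skeleton of the one-sided and the back-and-forth construction: \<open>P\<close>
  says which approximations are kept, and \<open>S n\<close> is the extra demand on stage
  \<open>n\<close>, void when only an embedding is built.\<close>

lemma chain_limit:
  assumes "P X0 h0"
    and step: "\<And>n X h. P X h \<Longrightarrow> \<exists>X' h'. P X' h' \<and> X \<subseteq> X' \<and> (\<forall>x\<in>X. h' x = h x) \<and> n \<in> X' \<and> S n X' h'"
  shows "\<exists>g::nat \<Rightarrow> nat. (\<forall>x\<in>X0. g x = h0 x) \<and>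
    (\<forall>n::nat. \<exists>X h. P X h \<and> {..n} \<subseteq> X \<and> (\<forall>x\<in>X. g x = h x) \<and> S n X h)"
proof -
  let ?R = "\<lambda>n (X, h) (X', h'). X \<subseteq> X' \<and> (\<forall>x\<in>X. h' x = h x) \<and> n \<in> X' \<and> S n X' h'"
  have "\<exists>f. \<forall>n. (case f n of (X, h) \<Rightarrow> P X h \<and> (n = 0 \<longrightarrow> X = X0 \<and> h = h0)) \<and> ?R n (f n) (f (Suc n))"
  proof (rule dependent_nat_choice)
    show "\<exists>x. case x of (X, h) \<Rightarrow> P X h \<and> ((0::nat) = 0 \<longrightarrow> X = X0 \<and> h = h0)"
      using assms(1) by auto
  next
    fix x and n :: nat
    assume "case x of (X, h) \<Rightarrow> P X h \<and> (n = 0 \<longrightarrow> X = X0 \<and> h = h0)"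
    moreover obtain X h where x: "x = (X, h)" by (rule prod.exhaust)
    ultimately obtain X' h' where "P X' h' \<and> X \<subseteq> X' \<and> (\<forall>x\<in>X. h' x = h x) \<and> n \<in> X' \<and> S n X' h'"
      using step[of X h n] by auto
    then show "\<exists>y. (case y of (X, h) \<Rightarrow> P X h \<and> (Suc n = 0 \<longrightarrow> X = X0 \<and> h = h0)) \<and> ?R n x y"
      by (intro exI[of _ "(X', h')"]) (simp add: x)
  qed
  then obtain f where f: "\<forall>n. (case f n of (X, h) \<Rightarrow> P X h \<and> (n = 0 \<longrightarrow> X = X0 \<and> h = h0)) \<and> ?R n (f n) (f (Suc n))"
    by (rule exE)
  define X where "X n = fst (f n)" for n
  define h where "h n = snd (f n)" for n
  have P: "P (X n) (h n)" for n using f[THEN spec, of n] by (simp add: X_def h_def split: prod.splits)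
  have z: "X 0 = X0" "h 0 = h0" using f[THEN spec, of 0] by (simp_all add: X_def h_def split: prod.splits)
  have R: "X n \<subseteq> X (Suc n)" "\<And>x. x \<in> X n \<Longrightarrow> h (Suc n) x = h n x" "n \<in> X (Suc n)" "S n (X (Suc n)) (h (Suc n))" for n
    using f[THEN spec, of n] by (auto simp: X_def h_def split: prod.splits)
  have mono: "X m \<subseteq> X n \<and> (\<forall>x\<in>X m. h n x = h m x)" if "m \<le> n" for m n
    using that
  proof (induction n rule: dec_induct)
    case (step n)
    then show ?case using R(1)[of n] R(2)[of _ n] by (auto simp: subset_iff)
  qed simp
  \<comment> \<open>Stage \<open>Suc x\<close> is guaranteed to have \<open>x\<close> in its domain,
    and the stages agree where both are defined.\<close>
  define g where "g x = h (Suc x) x" for x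
  have g: "g x = h n x" if "x \<in> X n" for x n
    using mono[of n "Suc x"] mono[of "Suc x" n] R(3)[of x] that by (cases "n \<le> Suc x") (auto simp: g_def)
  have "{..n} \<subseteq> X (Suc n)" for n
  proof
    fix m assume "m \<in> {..n}"
    then show "m \<in> X (Suc n)" using R(3)[of m] mono[of "Suc m" "Suc n"] by auto
  qed
  then show ?thesis using P R(4) g z by metis
qed

text \<open>Injectivity and every single fact concern finitely many points, which some stage
  covers.\<close>

lemma piso_limit:
  assumes "\<And>n. \<exists>X h. piso \<Theta> \<Phi> X h \<and> {..n} \<subseteq> X \<and> (\<forall>x\<in>X. g x = h x)"
  shows "piso \<Theta> \<Phi> UNIV g"
  unfolding piso_def
proof (intro conjI allI impI)
  show "inj g"
  proof (rule injI)
    fix x y assume "g x = g y"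
    moreover obtain X h where "piso \<Theta> \<Phi> X h" "{..max x y} \<subseteq> X" "\<forall>x\<in>X. g x = h x" using assms by blast
    moreover have "x \<in> {..max x y}" "y \<in> {..max x y}" by auto
    ultimately show "x = y" by (metis inj_onD piso_def subsetD)
  qed
  fix r xs
  obtain X h where X: "piso \<Theta> \<Phi> X h" "{..Max (set (0 # xs))} \<subseteq> X" "\<forall>x\<in>X. g x = h x" using assms by blast
  have "set xs \<subseteq> {..Max (set (0 # xs))}" using Max_ge[of "set (0 # xs)"] by (auto simp del: Max_insert)
  then have "set xs \<subseteq> X" using X(2) by blast
  moreover from this have "map g xs = map h xs" using X(3) by (intro map_cong) auto
  ultimately show "(r, xs) \<in> \<Theta> \<longleftrightarrow> (r, map g xs) \<in> \<Phi>" using X(1) by (simp only: piso_def)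
qed

text \<open>\<open>K_amalgam\<close> is strong amalgamation: it takes place on
  \<open>A \<union> B\<close> itself, so points outside \<open>A \<inter> B\<close> are never
  identified. Excluding empty argument lists makes the empty structure unique, so any two members
  with disjoint domains can be amalgamated over it.\<close>

locale amalgamation_class =
  fixes K :: "nat set \<Rightarrow> fact set \<Rightarrow> bool"
  assumes K_finite: "K A \<Phi> \<Longrightarrow> finite A \<and> finite \<Phi>"
    and K_facts: "K A \<Phi> \<Longrightarrow> (r, xs) \<in> \<Phi> \<Longrightarrow> set xs \<subseteq> A \<and> xs \<noteq> []"
    and K_empty: "K {} {}"
    and K_point: "\<exists>\<Phi>. K {0} \<Phi>"
    and K_ren: "K A \<Phi> \<Longrightarrow> inj_on h A \<Longrightarrow> K (h ` A) (ren h \<Phi>)"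
    and K_rest: "K A \<Phi> \<Longrightarrow> B \<subseteq> A \<Longrightarrow> K B (rest \<Phi> B)"
    and K_amalgam: "K A \<Phi> \<Longrightarrow> K B \<Psi> \<Longrightarrow> rest \<Phi> (A \<inter> B) = rest \<Psi> (A \<inter> B) \<Longrightarrow>
      \<exists>\<Theta>. K (A \<union> B) \<Theta> \<and> rest \<Theta> A = \<Phi> \<and> rest \<Theta> B = \<Psi>"
begin

lemma rest_self: "K A \<Phi> \<Longrightarrow> A \<subseteq> B \<Longrightarrow> rest \<Phi> B = \<Phi>"
  using K_facts by (fastforce simp: rest_def)

text \<open>The new point is renamed to some \<open>c\<close> outside \<open>A\<close> because
  \<open>b\<close> may already belong to \<open>A\<close> with other facts; amalgamation over
  \<open>X\<close> then applies.\<close>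

lemma extend_by_point:
  assumes A: "K A \<Phi>" and X: "X \<subseteq> A" and b: "b \<notin> X" and \<Psi>: "K (insert b X) \<Psi>" "rest \<Psi> X = rest \<Phi> X"
    and c: "c \<notin> A"
  shows "\<exists>\<Theta>. K (insert c A) \<Theta> \<and> rest \<Theta> A = \<Phi> \<and> rest \<Theta> (insert c X) = ren (id(b := c)) \<Psi>"
proof -
  let ?h = "id(b := c)"
  have cX: "c \<notin> X" using c X by auto
  have inj: "inj_on ?h (insert b X)" using cX b by (auto simp: inj_on_def)
  have im: "?h ` insert b X = insert c X" "?h ` X = X" using b by auto
  have K: "K (insert c X) (ren ?h \<Psi>)" using K_ren[OF \<Psi>(1) inj] im by metis
  have "rest (ren ?h \<Psi>) (?h ` X) = ren ?h (rest \<Psi> X)"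
    by (rule rest_ren[OF inj]) (use K_facts[OF \<Psi>(1)] in auto)
  also have "\<dots> = ren id (rest \<Psi> X)" by (rule ren_rest_cong) (use b in auto)
  finally have e: "rest (ren ?h \<Psi>) X = rest \<Phi> X" using \<Psi>(2) im by (simp add: ren_def)
  have int: "A \<inter> insert c X = X" using X c by auto
  obtain \<Theta> where "K (A \<union> insert c X) \<Theta>" "rest \<Theta> A = \<Phi>" "rest \<Theta> (insert c X) = ren ?h \<Psi>"
    using K_amalgam[OF A K] e int by auto
  moreover have "A \<union> insert c X = insert c A" using X by auto
  ultimately show ?thesis by auto
qed

text \<open>Discarding the first component of the pair makes every task recur at arbitrarily late
  stages, in particular after its points have entered the domain.\<close>

definition task :: "nat \<Rightarrow> nat list \<times> nat \<times> fact list" where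
  "task n = from_nat (snd (prod_decode n))"

lemma task_infinite: "\<exists>n\<ge>m. task n = t"
proof -
  have "task (prod_encode (m, to_nat t)) = t" by (simp add: task_def)
  then show ?thesis using le_prod_encode_1 by blast
qed

definition solves :: "nat set \<Rightarrow> fact set \<Rightarrow> nat list \<times> nat \<times> fact list \<Rightarrow> nat set \<Rightarrow> fact set \<Rightarrow> bool" where
  "solves A \<Phi> t A' \<Theta> \<longleftrightarrow> (case t of (X, b, \<Psi>) \<Rightarrow>
     set X \<subseteq> A \<and> b \<notin> set X \<and> K (insert b (set X)) (set \<Psi>) \<and> rest (set \<Psi>) (set X) = rest \<Phi> (set X) \<longrightarrow>
     (\<exists>c\<in>A'. c \<notin> set X \<and> rest \<Theta> (insert c (set X)) = ren (id(b := c)) (set \<Psi>)))"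

lemma add_point:
  assumes "K A \<Phi>"
  shows "\<exists>\<Theta>. K (insert n A) \<Theta> \<and> rest \<Theta> A = \<Phi>"
proof (cases "n \<in> A")
  case True
  then show ?thesis using assms rest_self[OF assms, of A] by (metis insert_absorb subset_refl)
next
  case False
  obtain \<Psi> where "K {0} \<Psi>" using K_point by blast
  moreover have "rest \<Phi>' {} = {}" if "K A \<Phi>'" for A \<Phi>'
    using K_facts[OF that] by (fastforce simp: rest_def)
  ultimately show ?thesis
    using extend_by_point[OF assms, of "{}" 0 \<Psi> n] False assms by auto
qed

lemma step_exists:
  assumes "K A \<Phi>"
  shows "\<exists>A' \<Theta>. K A' \<Theta> \<and> A \<subseteq> A' \<and> rest \<Theta> A = \<Phi> \<and> n \<in> A' \<and> solves A \<Phi> (task n) A' \<Theta>"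
proof -
  obtain X b \<Psi> where t: "task n = (X, b, \<Psi>)" by (rule prod_cases3)
  obtain c where c: "c \<notin> A" using K_finite[OF assms] ex_new_if_finite infinite_UNIV_nat by metis
  have "\<exists>A1 \<Theta>1. K A1 \<Theta>1 \<and> A \<subseteq> A1 \<and> rest \<Theta>1 A = \<Phi> \<and> solves A \<Phi> (task n) A1 \<Theta>1"
  proof (cases "set X \<subseteq> A \<and> b \<notin> set X \<and> K (insert b (set X)) (set \<Psi>) \<and> rest (set \<Psi>) (set X) = rest \<Phi> (set X)")
    case True
    then obtain \<Theta> where "K (insert c A) \<Theta> \<and> rest \<Theta> A = \<Phi> \<and> rest \<Theta> (insert c (set X)) = ren (id(b := c)) (set \<Psi>)"
      using extend_by_point[OF assms _ _ _ _ c] by metis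
    then show ?thesis using True c by (intro exI[of _ "insert c A"] exI[of _ \<Theta>]) (auto simp: solves_def t)
  next
    case False
    then show ?thesis using assms rest_self[OF assms] by (intro exI[of _ A] exI[of _ \<Phi>]) (auto simp: solves_def t)
  qed
  then obtain A1 \<Theta>1 where 1: "K A1 \<Theta>1" "A \<subseteq> A1" "rest \<Theta>1 A = \<Phi>" "solves A \<Phi> (task n) A1 \<Theta>1" by blast
  obtain \<Theta> where 2: "K (insert n A1) \<Theta>" "rest \<Theta> A1 = \<Theta>1" using add_point[OF 1(1)] by blast
  have "rest \<Theta> A = \<Phi>" using 1(2,3) 2(2) rest_rest[of \<Theta> A1 A] by (simp add: Int_absorb1)
  moreover have "solves A \<Phi> (task n) (insert n A1) \<Theta>"
    unfolding solves_def t prod.case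
  proof
    assume X: "set X \<subseteq> A \<and> b \<notin> set X \<and> K (insert b (set X)) (set \<Psi>) \<and> rest (set \<Psi>) (set X) = rest \<Phi> (set X)"
    then obtain c where c: "c \<in> A1" "c \<notin> set X" "rest \<Theta>1 (insert c (set X)) = ren (id(b := c)) (set \<Psi>)"
      using 1(4) unfolding solves_def t prod.case by blast
    have "A1 \<inter> insert c (set X) = insert c (set X)" using X c(1) 1(2) by blast
    then have "rest \<Theta> (insert c (set X)) = rest \<Theta>1 (insert c (set X))"
      using 2(2) rest_rest[of \<Theta> A1 "insert c (set X)"] by simp
    then show "\<exists>c\<in>insert n A1. c \<notin> set X \<and> rest \<Theta> (insert c (set X)) = ren (id(b := c)) (set \<Psi>)"
      using c by auto
  qed
  ultimately show ?thesis using 2 1(2) by blast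
qed

text \<open>Stage \<open>n\<close> adds the point \<open>n\<close>, so the domain becomes all of
  \<open>nat\<close>; later stages restrict to earlier ones, so the union of the fact sets has no
  new facts on old points.\<close>

theorem generic_exists:
  "\<exists>\<Phi>. (\<forall>A. finite A \<longrightarrow> K A (rest \<Phi> A)) \<and>
    (\<forall>X b \<Psi>. finite X \<longrightarrow> b \<notin> X \<longrightarrow> K (insert b X) \<Psi> \<longrightarrow> rest \<Psi> X = rest \<Phi> X \<longrightarrow>
      (\<exists>c. c \<notin> X \<and> rest \<Phi> (insert c X) = ren (id(b := c)) \<Psi>))"
proof -
  let ?R = "\<lambda>n (A, \<Phi>) (A', \<Theta>). A \<subseteq> A' \<and> rest \<Theta> A = \<Phi> \<and> n \<in> A' \<and> solves A \<Phi> (task n) A' \<Theta>"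
  have "\<exists>f. \<forall>n. (case f n of (A, \<Phi>) \<Rightarrow> K A \<Phi>) \<and> ?R n (f n) (f (Suc n))"
  proof (rule dependent_nat_choice)
    show "\<exists>x. case x of (A, \<Phi>) \<Rightarrow> K A \<Phi>" using K_empty by auto
  next
    fix x and n :: nat
    assume "case x of (A, \<Phi>) \<Rightarrow> K A \<Phi>"
    moreover obtain A \<Phi> where x: "x = (A, \<Phi>)" by (rule prod.exhaust)
    ultimately obtain A' \<Theta> where "K A' \<Theta> \<and> A \<subseteq> A' \<and> rest \<Theta> A = \<Phi> \<and> n \<in> A' \<and> solves A \<Phi> (task n) A' \<Theta>"
      using step_exists[of A \<Phi> n] by auto
    then show "\<exists>y. (case y of (A, \<Phi>) \<Rightarrow> K A \<Phi>) \<and> ?R n x y"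
      by (intro exI[of _ "(A', \<Theta>)"]) (simp add: x)
  qed
  then obtain f where f: "\<forall>n. (case f n of (A, \<Phi>) \<Rightarrow> K A \<Phi>) \<and> ?R n (f n) (f (Suc n))"
    by (rule exE)
  define A where "A n = fst (f n)" for n
  define F where "F n = snd (f n)" for n
  have K: "K (A n) (F n)" for n using f[THEN spec, of n] by (simp add: A_def F_def split: prod.splits)
  have R: "A n \<subseteq> A (Suc n)" "rest (F (Suc n)) (A n) = F n" "n \<in> A (Suc n)"
    "solves (A n) (F n) (task n) (A (Suc n)) (F (Suc n))" for n
    using f[THEN spec, of n] by (auto simp: A_def F_def split: prod.splits)
  have mono: "A m \<subseteq> A n \<and> rest (F n) (A m) = F m" if "m \<le> n" for m n
    using that
  proof (induction n rule: dec_induct)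
    case base
    then show ?case using rest_self[OF K] by simp
  next
    case (step n)
    then have "rest (F (Suc n)) (A m) = rest (rest (F (Suc n)) (A n)) (A m)"
      by (simp add: rest_rest Int_absorb1)
    then show ?case using step R(1)[of n] R(2)[of n] by auto
  qed
  define \<Phi> where "\<Phi> = (\<Union>n. F n)"
  have restA: "rest \<Phi> (A n) = F n" for n
  proof (rule set_eqI, safe)
    fix r xs assume "(r, xs) \<in> rest \<Phi> (A n)"
    then obtain m where m: "(r, xs) \<in> F m" "set xs \<subseteq> A n" by (auto simp: \<Phi>_def in_rest)
    show "(r, xs) \<in> F n"
    proof (cases "m \<le> n")
      case True
      then show ?thesis using mono[of m n] m by (metis in_rest)
    next
      case False
      then show ?thesis using mono[of n m] m by (metis in_rest nat_le_linear)
    qed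
  next
    fix r xs assume "(r, xs) \<in> F n"
    then show "(r, xs) \<in> rest \<Phi> (A n)" using K_facts[OF K] by (auto simp: \<Phi>_def in_rest)
  qed
  have cover: "\<exists>n. X \<subseteq> A n" if "finite X" for X
    using that
  proof (induction X rule: finite_induct)
    case (insert x X)
    then obtain n where "X \<subseteq> A n" by blast
    then have "insert x X \<subseteq> A (max n (Suc x))" using mono[of n "max n (Suc x)"] mono[of "Suc x" "max n (Suc x)"] R(3)[of x] by auto
    then show ?case by blast
  qed auto
  show ?thesis
  proof (intro exI[of _ \<Phi>] conjI allI impI)
    fix X :: "nat set" assume "finite X"
    then obtain n where "X \<subseteq> A n" using cover by blast
    then show "K X (rest \<Phi> X)" using K_rest[OF K] restA rest_rest[of \<Phi> "A n" X] by (metis Int_absorb1)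
  next
    fix X b \<Psi> assume X: "finite X" "b \<notin> X" "K (insert b X) \<Psi>" "rest \<Psi> X = rest \<Phi> X"
    obtain m where m: "X \<subseteq> A m" using cover X(1) by blast
    obtain xs where xs: "set xs = X" using X(1) finite_list by blast
    obtain ps where ps: "set ps = \<Psi>" using K_finite[OF X(3)] finite_list by blast
    \<comment> \<open>The stage has to come after \<open>X\<close> has entered the domain, since
      \<open>solves\<close> is vacuous before.\<close>
    obtain n where n: "n \<ge> m" "task n = (xs, b, ps)" using task_infinite by blast
    have Xn: "X \<subseteq> A n" using m mono[OF n(1)] by blast
    have "rest \<Psi> X = rest (F n) X" using X(4) restA[of n] rest_rest[of \<Phi> "A n" X] Xn by (metis Int_absorb1)
    then obtain c where c: "c \<in> A (Suc n)" "c \<notin> X" "rest (F (Suc n)) (insert c X) = ren (id(b := c)) \<Psi>"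
      using R(4)[of n] X xs ps Xn unfolding solves_def n(2) prod.case by blast
    have "insert c X \<subseteq> A (Suc n)" using c(1) Xn R(1)[of n] by blast
    then have "rest \<Phi> (insert c X) = ren (id(b := c)) \<Psi>"
      using c(3) restA[of "Suc n"] rest_rest[of \<Phi> "A (Suc n)"] by (metis Int_absorb1)
    then show "\<exists>c. c \<notin> X \<and> rest \<Phi> (insert c X) = ren (id(b := c)) \<Psi>" using c(2) by blast
  qed
qed

end

locale generic = amalgamation_class +
  fixes \<Phi> :: "fact set"
  assumes local_K: "finite A \<Longrightarrow> K A (rest \<Phi> A)"
    and extension: "finite X \<Longrightarrow> b \<notin> X \<Longrightarrow> K (insert b X) \<Psi> \<Longrightarrow> rest \<Psi> X = rest \<Phi> X \<Longrightarrow>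
      \<exists>c. c \<notin> X \<and> rest \<Phi> (insert c X) = ren (id(b := c)) \<Psi>"
begin

text \<open>The image of \<open>a\<close> first gets an arbitrary fresh name \<open>b\<close>, which
  describes the required one-point extension as a member of \<open>K\<close>;
  \<open>extension\<close> then supplies a realisation \<open>c\<close>.\<close>

lemma forth:
  assumes X: "finite X" and p: "piso \<Theta> \<Phi> X h" and a: "a \<notin> X" and K: "K (insert a X) (rest \<Theta> (insert a X))"
  shows "\<exists>c. piso \<Theta> \<Phi> (insert a X) (h(a := c))"
proof -
  obtain b where b: "b \<notin> h ` X" using X ex_new_if_finite[OF infinite_UNIV_nat, of "h ` X"] by auto
  let ?g = "h(a := b)" and ?T = "rest \<Theta> (insert a X)"
  have inj: "inj_on h X" and eq: "rest \<Phi> (h ` X) = ren h (rest \<Theta> X)" using p by (auto simp: piso_alt)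
  have im: "?g ` X = h ` X" using a by auto
  have injg: "inj_on ?g (insert a X)" using inj a b im by (auto simp: inj_on_def)
  have "K (insert b (h ` X)) (ren ?g ?T)" using K_ren[OF K injg] a im by (simp add: insert_commute)
  moreover have "rest (ren ?g ?T) (h ` X) = rest \<Phi> (h ` X)"
  proof -
    have "rest (ren ?g ?T) (?g ` X) = ren ?g (rest ?T X)"
      by (rule rest_ren[OF injg]) (auto simp: in_rest)
    also have "rest ?T X = rest \<Theta> X" by (auto simp: rest_def)
    also have "ren ?g (rest \<Theta> X) = ren h (rest \<Theta> X)" by (rule ren_rest_cong) (use a in auto)
    finally show ?thesis by (simp only: im eq)
  qed
  ultimately obtain c where c: "c \<notin> h ` X" "rest \<Phi> (insert c (h ` X)) = ren (id(b := c)) (ren ?g ?T)"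
    using extension[OF _ b, of "ren ?g ?T"] X by auto
  have "ren (id(b := c)) (ren ?g ?T) = ren (h(a := c)) ?T"
    unfolding ren_ren by (rule ren_rest_cong) (use b in auto)
  moreover have "h(a := c) ` insert a X = insert c (h ` X)" using a by auto
  moreover have "inj_on (h(a := c)) (insert a X)" using inj a c(1) by (auto simp: inj_on_def)
  ultimately show ?thesis using c(2) by (metis piso_alt)
qed

lemma embed_finite:
  assumes "K A \<Theta>" shows "\<exists>e. piso \<Theta> \<Phi> A e"
proof -
  have "\<exists>e. piso \<Theta> \<Phi> X e" if "finite X" "X \<subseteq> A" for X
    using that
  proof (induction X rule: finite_induct)
    case empty
    have "rest \<Phi> {} = {}" using local_K[of "{}"] K_facts[of "{}" "rest \<Phi> {}"] by fastforce
    moreover have "rest \<Theta> {} = {}" using K_facts[OF assms] by (fastforce simp: rest_def)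
    ultimately show ?case by (simp add: piso_alt ren_def)
  next
    case (insert x X)
    then show ?case using forth[of X \<Theta> _ x] K_rest[OF assms insert.prems] by auto
  qed
  then show ?thesis using K_finite[OF assms] by auto
qed

lemma embed_countable:
  assumes "\<And>A. finite A \<Longrightarrow> K A (rest \<Theta> A)"
  shows "\<exists>e. piso \<Theta> \<Phi> UNIV e"
proof -
  have no0: "rest F {} = {}" if "\<And>A. finite A \<Longrightarrow> K A (rest F A)" for F
    using K_facts[OF that[of "{}"]] by (auto simp: rest_def)
  have "\<exists>g. (\<forall>x\<in>{}. g x = id x) \<and>
    (\<forall>n. \<exists>X h. (finite X \<and> piso \<Theta> \<Phi> X h) \<and> {..n} \<subseteq> X \<and> (\<forall>x\<in>X. g x = h x) \<and> True)"
  proof (rule chain_limit)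
    show "finite {} \<and> piso \<Theta> \<Phi> {} id"
      using no0[OF assms] no0[OF local_K] by (simp add: piso_alt ren_def)
    fix n :: nat and X and h :: "nat \<Rightarrow> nat" assume X: "finite X \<and> piso \<Theta> \<Phi> X h"
    show "\<exists>X' h'. (finite X' \<and> piso \<Theta> \<Phi> X' h') \<and> X \<subseteq> X' \<and> (\<forall>x\<in>X. h' x = h x) \<and> n \<in> X' \<and> True"
    proof (cases "n \<in> X")
      case False
      then obtain c where "piso \<Theta> \<Phi> (insert n X) (h(n := c))" using forth[of X \<Theta> h n] X assms by auto
      then show ?thesis using X False by (intro exI[of _ "insert n X"] exI[of _ "h(n := c)"]) auto
    qed (use X in blast)
  qed
  then obtain g where "(\<forall>x\<in>{}. g x = id x) \<and>
    (\<forall>n. \<exists>X h. (finite X \<and> piso \<Theta> \<Phi> X h) \<and> {..n} \<subseteq> X \<and> (\<forall>x\<in>X. g x = h x) \<and> True)"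
    by (rule exE)
  then have "\<exists>X h. piso \<Theta> \<Phi> X h \<and> {..n} \<subseteq> X \<and> (\<forall>x\<in>X. g x = h x)" for n
    by meson
  then have "piso \<Theta> \<Phi> UNIV g" by (rule piso_limit)
  then show ?thesis by (rule exI[of _ g])
qed

text \<open>Back and forth: each stage puts \<open>n\<close> into the domain and then into the
  range, the latter by applying \<open>forth\<close> to the inverse map.\<close>

lemma homogeneous_generic:
  assumes X: "finite X" and p: "piso \<Phi> \<Phi> X h"
  shows "\<exists>g. bij g \<and> piso \<Phi> \<Phi> UNIV g \<and> (\<forall>x\<in>X. g x = h x)"
proof -
  have "\<exists>g. (\<forall>x\<in>X. g x = h x) \<and>
    (\<forall>n. \<exists>X h. (finite X \<and> piso \<Phi> \<Phi> X h) \<and> {..n} \<subseteq> X \<and> (\<forall>x\<in>X. g x = h x) \<and> n \<in> h ` X)"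
  proof (rule chain_limit)
    show "finite X \<and> piso \<Phi> \<Phi> X h" using assms by simp
    fix n :: nat and X and h :: "nat \<Rightarrow> nat" assume Xh: "finite X \<and> piso \<Phi> \<Phi> X h"
    have "\<exists>Y k. finite Y \<and> piso \<Phi> \<Phi> Y k \<and> X \<subseteq> Y \<and> (\<forall>x\<in>X. k x = h x) \<and> n \<in> Y"
    proof (cases "n \<in> X")
      case False
      then obtain c where "piso \<Phi> \<Phi> (insert n X) (h(n := c))" using forth[of X \<Phi> h n] Xh local_K by auto
      then show ?thesis using Xh False by (intro exI[of _ "insert n X"] exI[of _ "h(n := c)"]) auto
    qed (use Xh in blast)
    then obtain Y k where Y: "finite Y" "piso \<Phi> \<Phi> Y k" "X \<subseteq> Y" "\<And>x. x \<in> X \<Longrightarrow> k x = h x" "n \<in> Y" by blast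
    have "\<exists>Y' k'. finite Y' \<and> piso \<Phi> \<Phi> Y' k' \<and> Y \<subseteq> Y' \<and> (\<forall>x\<in>Y. k' x = k x) \<and> n \<in> k' ` Y'"
    proof (cases "n \<in> k ` Y")
      case False
      have inj: "inj_on k Y" using Y(2) by (simp add: piso_def)
      let ?i = "inv_into Y k"
      have "piso \<Phi> \<Phi> (k ` Y) ?i" by (rule piso_inverse[OF Y(2)]) (use inj in auto)
      then obtain c where c: "piso \<Phi> \<Phi> (insert n (k ` Y)) (?i(n := c))"
        using forth[of "k ` Y" \<Phi> ?i n] False Y(1) local_K by auto
      have "(?i(n := c)) ` (k ` Y) = ?i ` (k ` Y)" by (rule image_cong) (use False in auto)
      then have im: "(?i(n := c)) ` insert n (k ` Y) = insert c Y"
        using inv_into_image_cancel[OF inj subset_refl] by (simp only: image_insert fun_upd_same)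
      have cY: "c \<notin> Y"
      proof
        assume "c \<in> Y"
        then have "(?i(n := c)) n = (?i(n := c)) (k c)" using False inj by auto
        moreover have "inj_on (?i(n := c)) (insert n (k ` Y))" using c by (simp only: piso_def)
        ultimately have "n = k c" using \<open>c \<in> Y\<close> by (elim inj_onD) auto
        then show False using False \<open>c \<in> Y\<close> by blast
      qed
      have "piso \<Phi> \<Phi> (insert c Y) (k(c := n))"
      proof -
        have "(k(c := n)) ((?i(n := c)) y) = y" if "y \<in> insert n (k ` Y)" for y
          using that False cY inj f_inv_into_f[of y k Y] inv_into_into[of y k Y] by (cases "y = n") auto
        from piso_inverse[OF c this] show ?thesis by (simp only: im)
      qed
      then show ?thesis using Y(1) cY by (intro exI[of _ "insert c Y"] exI[of _ "k(c := n)"]) auto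
    qed (use Y in blast)
    then obtain Y' k' where "finite Y'" "piso \<Phi> \<Phi> Y' k'" "Y \<subseteq> Y'" "\<And>x. x \<in> Y \<Longrightarrow> k' x = k x" "n \<in> k' ` Y'" by blast
    then show "\<exists>X' h'. (finite X' \<and> piso \<Phi> \<Phi> X' h') \<and> X \<subseteq> X' \<and> (\<forall>x\<in>X. h' x = h x) \<and> n \<in> X' \<and> n \<in> h' ` X'"
      using Y by (intro exI[of _ Y'] exI[of _ k']) auto
  qed
  then obtain g where g: "(\<forall>x\<in>X. g x = h x) \<and>
    (\<forall>n. \<exists>X h. (finite X \<and> piso \<Phi> \<Phi> X h) \<and> {..n} \<subseteq> X \<and> (\<forall>x\<in>X. g x = h x) \<and> n \<in> h ` X)"
    by (rule exE)
  then have "\<exists>X h. piso \<Phi> \<Phi> X h \<and> {..n} \<subseteq> X \<and> (\<forall>x\<in>X. g x = h x)" for n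
    by meson
  then have piso: "piso \<Phi> \<Phi> UNIV g" by (rule piso_limit)
  have "surj g"
  proof -
    have "\<exists>x. g x = n" for n
    proof -
    obtain X h where "\<forall>x\<in>X. g x = h x" "n \<in> h ` X" using g by meson
    then show ?thesis by auto
    qed
    then show ?thesis by (metis surj_def)
  qed
  then have "bij g" using piso by (simp add: bij_def piso_def)
  then show ?thesis using g piso by (intro exI[of _ g]) simp
qed

end

section \<open>The amalgamation class of a connected query\<close>

text \<open>Relation symbol of the formula that conjoins the atoms in \<open>P\<close> and
  quantifies all their variables outside \<open>T\<close>. In \<open>fact_of\<close> the free
  variables are listed in increasing order.\<close>

definition code :: "nat set \<Rightarrow> nat set \<Rightarrow> nat" where
  "code P T = prod_encode (set_encode P, set_encode T)"

definition fact_of :: "nat set \<Rightarrow> nat set \<Rightarrow> (nat \<Rightarrow> nat) \<Rightarrow> fact" where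
  "fact_of P T y = (code P T, map y (sorted_list_of_set T))"

lemma code_inject:
  "finite P \<Longrightarrow> finite T \<Longrightarrow> finite P' \<Longrightarrow> finite T' \<Longrightarrow> code P T = code P' T' \<longleftrightarrow> P = P' \<and> T = T'"
  by (simp add: code_def set_encode_eq)

lemma fact_of_inject:
  assumes "finite P" "finite T" "finite P'" "finite T'" "fact_of P T y = fact_of P' T' y'"
  shows "P = P' \<and> T = T' \<and> (\<forall>t\<in>T. y t = y' t)"
  using assms by (auto simp: fact_of_def code_inject)

lemma list_as_map:
  assumes "finite T" "length xs = card T"
  shows "\<exists>y. xs = map y (sorted_list_of_set T)"
proof -
  define y where "y = the \<circ> map_of (zip (sorted_list_of_set T) xs)"
  have "xs = map y (sorted_list_of_set T)"
    using assms by (intro nth_equalityI) (auto simp: y_def map_of_zip_nth)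
  then show ?thesis by blast
qed

locale query =
  fixes V :: "nat \<Rightarrow> nat list" and s :: nat
  assumes s_pos: "s > 0"
    and V_nonempty: "f < s \<Longrightarrow> V f \<noteq> []"
    and connected: "P1 \<union> P2 = {..<s} \<Longrightarrow> P1 \<noteq> {} \<Longrightarrow> P2 \<noteq> {} \<Longrightarrow>
      (\<Union>f\<in>P1. set (V f)) \<inter> (\<Union>f\<in>P2. set (V f)) \<noteq> {}"
begin

abbreviation "Fs \<equiv> {..<s}"

definition vars :: "nat set \<Rightarrow> nat set" where "vars P = (\<Union>f\<in>P. set (V f))"

lemma vars_simps [simp]: "vars {} = {}" "vars (P \<union> P') = vars P \<union> vars P'" "vars {f} = set (V f)"
  by (auto simp: vars_def)

lemma vars_mono: "P \<subseteq> P' \<Longrightarrow> vars P \<subseteq> vars P'"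
  by (auto simp: vars_def)

definition wfp :: "nat set \<Rightarrow> nat set \<Rightarrow> bool" where "wfp P T \<longleftrightarrow> P \<subseteq> Fs \<and> T \<subseteq> vars P"

lemma wfp_finite: "wfp P T \<Longrightarrow> finite P \<and> finite T"
  unfolding wfp_def vars_def by (meson finite_UN finite_lessThan finite_subset List.finite_set)

lemma wfp_empty [simp]: "wfp {} {}" by (simp add: wfp_def)

lemma Fs_nonempty: "{} \<noteq> Fs" using s_pos by auto

text \<open>\<open>asserts \<Phi> P T y\<close> means that the atoms in \<open>P\<close> hold when the variables in \<open>T\<close> take the values
  \<open>y\<close> and the others are quantified existentially. Without free variables there is no such fact: by
  convention, the whole query is false and its proper parts are true.\<close>

definition asserts :: "fact set \<Rightarrow> nat set \<Rightarrow> nat set \<Rightarrow> (nat \<Rightarrow> nat) \<Rightarrow> bool" where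
  "asserts \<Phi> P T y \<longleftrightarrow> (if T = {} then P \<noteq> Fs else fact_of P T y \<in> \<Phi>)"

lemma asserts_cong: "wfp P T \<Longrightarrow> (\<And>t. t \<in> T \<Longrightarrow> y t = y' t) \<Longrightarrow> asserts \<Phi> P T y = asserts \<Phi> P T y'"
  using wfp_finite[of P T] by (auto simp: asserts_def fact_of_def intro!: arg_cong2[of _ _ _ _ "(\<in>)"] map_cong)

text \<open>The first rule drops atoms and quantifies variables. The second conjoins two formulas;
  variables common to both must be free in both, as witnesses chosen separately need not agree.
  Since the whole query without free variables is false by convention, coherence also forbids that a
  solution of the query be derived.\<close>

definition coherent :: "fact set \<Rightarrow> bool" where
  "coherent \<Phi> \<longleftrightarrow>
    (\<forall>P T P' T' y. wfp P T \<and> P' \<subseteq> P \<and> T' \<subseteq> T \<and> wfp P' T' \<and> asserts \<Phi> P T y \<longrightarrow> asserts \<Phi> P' T' y) \<and>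
    (\<forall>P1 T1 P2 T2 y. wfp P1 T1 \<and> wfp P2 T2 \<and> vars P1 \<inter> vars P2 \<subseteq> T1 \<inter> T2 \<and> asserts \<Phi> P1 T1 y \<and> asserts \<Phi> P2 T2 y
     \<longrightarrow> asserts \<Phi> (P1 \<union> P2) (T1 \<union> T2) y)"

lemma wfp_Un: "wfp P T \<Longrightarrow> wfp P' T' \<Longrightarrow> wfp (P \<union> P') (T \<union> T')"
  by (auto simp: wfp_def)

definition facts :: "nat set \<Rightarrow> fact set" where
  "facts A = {fact_of P T y | P T y. wfp P T \<and> T \<noteq> {} \<and> y ` T \<subseteq> A}"

definition K :: "nat set \<Rightarrow> fact set \<Rightarrow> bool" where
  "K A \<Phi> \<longleftrightarrow> finite A \<and> \<Phi> \<subseteq> facts A \<and> coherent \<Phi>"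

lemma finite_facts: "finite A \<Longrightarrow> finite (facts A)"
proof -
  assume A: "finite A"
  have fin: "finite (vars Fs)" by (simp add: vars_def)
  have "facts A \<subseteq> (\<lambda>(P, T, xs). (code P T, xs)) ` (Pow Fs \<times> Pow (vars Fs) \<times> {xs. set xs \<subseteq> A \<and> length xs \<le> card (vars Fs)})"
  proof
    fix q assume "q \<in> facts A"
    then obtain P T y where q: "q = fact_of P T y" "wfp P T" "y ` T \<subseteq> A" by (auto simp: facts_def)
    have "T \<subseteq> vars Fs" "P \<subseteq> Fs" using q(2) vars_mono[of P Fs] by (auto simp: wfp_def)
    moreover have "set (map y (sorted_list_of_set T)) \<subseteq> A" using q(3) wfp_finite[OF q(2)] by simp
    moreover have "card T \<le> card (vars Fs)" using \<open>T \<subseteq> vars Fs\<close> fin by (simp add: card_mono)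
    ultimately show "q \<in> (\<lambda>(P, T, xs). (code P T, xs)) ` (Pow Fs \<times> Pow (vars Fs) \<times> {xs. set xs \<subseteq> A \<and> length xs \<le> card (vars Fs)})"
      unfolding q(1) fact_of_def by (intro image_eqI[of _ _ "(P, T, map y (sorted_list_of_set T))"]) auto
  qed
  moreover have "finite {xs. set xs \<subseteq> A \<and> length xs \<le> card (vars Fs)}"
    using finite_lists_length_le[OF A] by simp
  ultimately show ?thesis using fin by (auto intro: finite_subset)
qed

lemma asserts_rest: "wfp P T \<Longrightarrow> asserts (rest \<Phi> A) P T y \<longleftrightarrow> asserts \<Phi> P T y \<and> y ` T \<subseteq> A"
  using wfp_finite[of P T] by (auto simp: asserts_def fact_of_def in_rest)

lemma coherentI:
  assumes "\<And>P T P' T' y. wfp P T \<Longrightarrow> P' \<subseteq> P \<Longrightarrow> T' \<subseteq> T \<Longrightarrow> wfp P' T' \<Longrightarrow> asserts \<Phi> P T y \<Longrightarrow> asserts \<Phi> P' T' y"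
    and "\<And>P1 T1 P2 T2 y. wfp P1 T1 \<Longrightarrow> wfp P2 T2 \<Longrightarrow> vars P1 \<inter> vars P2 \<subseteq> T1 \<inter> T2 \<Longrightarrow>
      asserts \<Phi> P1 T1 y \<Longrightarrow> asserts \<Phi> P2 T2 y \<Longrightarrow> asserts \<Phi> (P1 \<union> P2) (T1 \<union> T2) y"
  shows "coherent \<Phi>"
  unfolding coherent_def by (intro conjI allI impI; elim conjE; rule assms; assumption)

lemma coherent_restrict:
  assumes "coherent \<Phi>" "wfp P T" "P' \<subseteq> P" "T' \<subseteq> T" "wfp P' T'" "asserts \<Phi> P T y"
  shows "asserts \<Phi> P' T' y"
  using assms(1)[unfolded coherent_def, THEN conjunct1, rule_format, of P T P' T' y] assms by simp

lemma coherent_glue: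
  assumes "coherent \<Phi>" "wfp P1 T1" "wfp P2 T2" "vars P1 \<inter> vars P2 \<subseteq> T1 \<inter> T2"
    "asserts \<Phi> P1 T1 y" "asserts \<Phi> P2 T2 y"
  shows "asserts \<Phi> (P1 \<union> P2) (T1 \<union> T2) y"
  using assms(1)[unfolded coherent_def, THEN conjunct2, rule_format, of P1 T1 P2 T2 y] assms by simp

lemma coherent_rest:
  assumes "coherent \<Phi>" shows "coherent (rest \<Phi> A)"
proof (rule coherentI)
  fix P T P' T' y assume *: "wfp P T" "P' \<subseteq> P" "T' \<subseteq> T" "wfp P' T'" "asserts (rest \<Phi> A) P T y"
  then have "asserts \<Phi> P T y" "y ` T \<subseteq> A" by (simp_all add: asserts_rest)
  then have "asserts \<Phi> P' T' y" "y ` T' \<subseteq> A" using coherent_restrict[OF assms *(1-4)] *(3) by auto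
  then show "asserts (rest \<Phi> A) P' T' y" using *(4) by (simp add: asserts_rest)
next
  fix P1 T1 P2 T2 y
  assume *: "wfp P1 T1" "wfp P2 T2" "vars P1 \<inter> vars P2 \<subseteq> T1 \<inter> T2" "asserts (rest \<Phi> A) P1 T1 y" "asserts (rest \<Phi> A) P2 T2 y"
  then have "asserts \<Phi> P1 T1 y" "asserts \<Phi> P2 T2 y" "y ` (T1 \<union> T2) \<subseteq> A" by (auto simp: asserts_rest)
  then show "asserts (rest \<Phi> A) (P1 \<union> P2) (T1 \<union> T2) y"
    using coherent_glue[OF assms *(1-3)] wfp_Un[OF *(1,2)] by (simp add: asserts_rest)
qed

lemma facts_rest: "\<Phi> \<subseteq> facts A \<Longrightarrow> rest \<Phi> B \<subseteq> facts B"
proof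
  fix q assume *: "\<Phi> \<subseteq> facts A" "q \<in> rest \<Phi> B"
  obtain r xs where q: "q = (r, xs)" by (rule prod.exhaust)
  then have "q \<in> facts A" using * by (auto simp: in_rest)
  then obtain P T y where "q = fact_of P T y" "wfp P T" "T \<noteq> {}" by (auto simp: facts_def)
  moreover from this have "y ` T \<subseteq> B" using * q wfp_finite[of P T] by (auto simp: in_rest fact_of_def)
  ultimately show "q \<in> facts B" by (auto simp: facts_def)
qed

text \<open>An instance of a rule involves the values of a single \<open>y\<close> on variables of
  the query, hence at most \<open>card (vars Fs)\<close> points. Finite boundedness rests on
  this.\<close>

lemma coherent_local:
  assumes "\<And>A. finite A \<Longrightarrow> card A \<le> card (vars Fs) \<Longrightarrow> coherent (rest \<Phi> A)"
  shows "coherent \<Phi>"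
proof -
  have fin: "finite (vars Fs)" by (simp add: vars_def)
  have th: "coherent (rest \<Phi> (y ` T))" if "wfp P T" for y :: "nat \<Rightarrow> nat" and P T
  proof (rule assms)
    have "T \<subseteq> vars Fs" using that vars_mono[of P Fs] by (auto simp: wfp_def)
    then have "card T \<le> card (vars Fs)" using fin by (simp add: card_mono)
    then show "card (y ` T) \<le> card (vars Fs)" using card_image_le[of T y] wfp_finite[OF that] by linarith
  qed (use wfp_finite[OF that] in simp)
  show ?thesis
  proof (rule coherentI)
    fix P T P' T' y assume *: "wfp P T" "P' \<subseteq> P" "T' \<subseteq> T" "wfp P' T'" "asserts \<Phi> P T y"
    then have "asserts (rest \<Phi> (y ` T)) P T y" by (simp add: asserts_rest)
    from coherent_restrict[OF th[OF *(1)] *(1-4) this]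
    show "asserts \<Phi> P' T' y" using *(4) by (simp add: asserts_rest)
  next
    fix P1 T1 P2 T2 y
    assume *: "wfp P1 T1" "wfp P2 T2" "vars P1 \<inter> vars P2 \<subseteq> T1 \<inter> T2" "asserts \<Phi> P1 T1 y" "asserts \<Phi> P2 T2 y"
    let ?A = "y ` (T1 \<union> T2)"
    have "asserts (rest \<Phi> ?A) P1 T1 y" "asserts (rest \<Phi> ?A) P2 T2 y" using * by (auto simp: asserts_rest)
    from coherent_glue[OF th[OF wfp_Un[OF *(1,2)]] *(1-3) this]
    show "asserts \<Phi> (P1 \<union> P2) (T1 \<union> T2) y" using wfp_Un[OF *(1,2)] by (simp add: asserts_rest)
  qed
qed

lemma asserts_ren:
  assumes "inj_on h A" "\<Phi> \<subseteq> facts A" "wfp P T"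
  shows "asserts (ren h \<Phi>) P T y \<longleftrightarrow> y ` T \<subseteq> h ` A \<and> asserts \<Phi> P T (inv_into A h \<circ> y)"
proof (cases "T = {}")
  case False
  let ?g = "inv_into A h" and ?l = "sorted_list_of_set T"
  have T: "finite T" using wfp_finite[OF assms(3)] by simp
  show ?thesis
  proof
    assume "asserts (ren h \<Phi>) P T y"
    then obtain xs where xs: "map y ?l = map h xs" "(code P T, xs) \<in> \<Phi>"
      using False by (auto simp: asserts_def fact_of_def in_ren)
    have "set xs \<subseteq> A"
      using assms(2) xs(2) by (fastforce simp: facts_def fact_of_def dest: wfp_finite)
    then have "xs = map ?g (map h xs)" using assms(1) by (auto intro!: map_idI[symmetric] simp: subset_iff)
    then have "xs = map (?g \<circ> y) ?l" unfolding xs(1)[symmetric] map_map .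
    moreover have "y ` T = h ` set xs" using xs(1) T by (metis list.set_map set_sorted_list_of_set)
    ultimately show "y ` T \<subseteq> h ` A \<and> asserts \<Phi> P T (?g \<circ> y)"
      using xs(2) False \<open>set xs \<subseteq> A\<close> by (auto simp: asserts_def fact_of_def)
  next
    assume *: "y ` T \<subseteq> h ` A \<and> asserts \<Phi> P T (?g \<circ> y)"
    then have "map y ?l = map h (map (?g \<circ> y) ?l)"
      using T by (auto simp: f_inv_into_f)
    then show "asserts (ren h \<Phi>) P T y"
      using * False by (auto simp: asserts_def fact_of_def in_ren)
  qed
qed (simp add: asserts_def)

lemma K_rename:
  assumes "K A \<Phi>" "inj_on h A"
  shows "K (h ` A) (ren h \<Phi>)"
proof -
  have \<Phi>: "\<Phi> \<subseteq> facts A" "coherent \<Phi>" "finite A" using assms by (auto simp: K_def)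
  have "ren h \<Phi> \<subseteq> facts (h ` A)"
  proof
    fix q assume "q \<in> ren h \<Phi>"
    then obtain r xs where "q = (r, map h xs)" "(r, xs) \<in> \<Phi>" by (auto simp: ren_def)
    moreover from this have "(r, xs) \<in> facts A" using \<Phi>(1) by blast
    then obtain P T y where "(r, xs) = fact_of P T y" "wfp P T" "T \<noteq> {}" "y ` T \<subseteq> A"
      by (auto simp: facts_def)
    ultimately have "q = fact_of P T (h \<circ> y)" "wfp P T" "T \<noteq> {}" "y ` T \<subseteq> A"
      by (auto simp: fact_of_def)
    moreover from this have "(h \<circ> y) ` T \<subseteq> h ` A" by auto
    ultimately show "q \<in> facts (h ` A)" unfolding facts_def by blast
  qed
  moreover have "coherent (ren h \<Phi>)"
  proof (rule coherentI)
    fix P T P' T' y assume *: "wfp P T" "P' \<subseteq> P" "T' \<subseteq> T" "wfp P' T'" "asserts (ren h \<Phi>) P T y"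
    then have "asserts \<Phi> P T (inv_into A h \<circ> y)" "y ` T \<subseteq> h ` A"
      by (simp_all add: asserts_ren[OF assms(2) \<Phi>(1)])
    moreover from this have "y ` T' \<subseteq> h ` A" using *(3) by blast
    ultimately show "asserts (ren h \<Phi>) P' T' y"
      using coherent_restrict[OF \<Phi>(2) *(1-4)] *(4) by (simp add: asserts_ren[OF assms(2) \<Phi>(1)])
  next
    fix P1 T1 P2 T2 y
    assume *: "wfp P1 T1" "wfp P2 T2" "vars P1 \<inter> vars P2 \<subseteq> T1 \<inter> T2" "asserts (ren h \<Phi>) P1 T1 y" "asserts (ren h \<Phi>) P2 T2 y"
    then have "asserts \<Phi> P1 T1 (inv_into A h \<circ> y)" "asserts \<Phi> P2 T2 (inv_into A h \<circ> y)" "y ` (T1 \<union> T2) \<subseteq> h ` A"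
      by (auto simp: asserts_ren[OF assms(2) \<Phi>(1)])
    then show "asserts (ren h \<Phi>) (P1 \<union> P2) (T1 \<union> T2) y"
      using coherent_glue[OF \<Phi>(2) *(1-3)] wfp_Un[OF *(1,2)] by (simp add: asserts_ren[OF assms(2) \<Phi>(1)])
  qed
  ultimately show ?thesis using \<Phi>(3) by (simp add: K_def)
qed

definition theory_of :: "nat set \<Rightarrow> (nat set \<Rightarrow> nat set \<Rightarrow> (nat \<Rightarrow> nat) \<Rightarrow> bool) \<Rightarrow> fact set" where
  "theory_of A H = {fact_of P T y | P T y. wfp P T \<and> T \<noteq> {} \<and> y ` T \<subseteq> A \<and> H P T y}"

text \<open>The hypotheses concern what is lost when \<open>H\<close> is stored as facts: values of
  \<open>y\<close> outside \<open>T\<close>, points outside \<open>A\<close>, and the case without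
  free variables, which no fact records.\<close>

lemma asserts_theory_of:
  assumes "wfp P T"
    and "\<And>P T y y'. wfp P T \<Longrightarrow> \<forall>t\<in>T. y t = y' t \<Longrightarrow> H P T y \<Longrightarrow> H P T y'"
    and "\<And>P y. wfp P {} \<Longrightarrow> H P {} y \<longleftrightarrow> P \<noteq> Fs"
    and "\<And>P T y. H P T y \<Longrightarrow> y ` T \<subseteq> A"
  shows "asserts (theory_of A H) P T y \<longleftrightarrow> H P T y"
proof (cases "T = {}")
  case False
  have "fact_of P T y \<in> theory_of A H \<longleftrightarrow> H P T y"
  proof
    assume "fact_of P T y \<in> theory_of A H"
    then obtain P' T' y' where *: "fact_of P T y = fact_of P' T' y'" "wfp P' T'" "H P' T' y'"
      by (auto simp: theory_of_def)
    then have "P' = P \<and> T' = T \<and> (\<forall>t\<in>T'. y' t = y t)"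
      using fact_of_inject[of P' T' P T y' y] wfp_finite[OF *(2)] wfp_finite[OF assms(1)] by auto
    then show "H P T y" using assms(2)[OF *(2), of y' y] *(3) by simp
  next
    assume "H P T y"
    then show "fact_of P T y \<in> theory_of A H"
      using assms(1,4) False unfolding theory_of_def by blast
  qed
  then show ?thesis using False by (simp add: asserts_def)
qed (use assms in \<open>simp add: asserts_def\<close>)

lemma theory_of_rest:
  assumes "\<Phi> \<subseteq> facts A" "A \<subseteq> B" "\<And>P T y. wfp P T \<Longrightarrow> y ` T \<subseteq> A \<Longrightarrow> H P T y \<longleftrightarrow> asserts \<Phi> P T y"
  shows "rest (theory_of B H) A = \<Phi>"
proof (rule set_eqI)
  fix q :: fact
  have "q \<in> rest (theory_of B H) A \<longleftrightarrow> (\<exists>P T y. q = fact_of P T y \<and> wfp P T \<and> T \<noteq> {} \<and> y ` T \<subseteq> A \<and> H P T y)"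
  proof
    assume *: "q \<in> rest (theory_of B H) A"
    obtain r xs where q: "q = (r, xs)" by (rule prod.exhaust)
    then obtain P T y where P: "q = fact_of P T y" "wfp P T" "T \<noteq> {}" "H P T y"
      using * by (auto simp: in_rest theory_of_def)
    then have "y ` T \<subseteq> A" using * q wfp_finite[OF P(2)] by (auto simp: in_rest fact_of_def)
    then show "\<exists>P T y. q = fact_of P T y \<and> wfp P T \<and> T \<noteq> {} \<and> y ` T \<subseteq> A \<and> H P T y" using P by blast
  next
    assume "\<exists>P T y. q = fact_of P T y \<and> wfp P T \<and> T \<noteq> {} \<and> y ` T \<subseteq> A \<and> H P T y"
    then obtain P T y where P: "q = fact_of P T y" "wfp P T" "T \<noteq> {}" "y ` T \<subseteq> A" "H P T y" by blast
    then have "q \<in> theory_of B H" using assms(2) unfolding theory_of_def by blast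
    then show "q \<in> rest (theory_of B H) A" using P wfp_finite[OF P(2)] by (simp add: fact_of_def in_rest)
  qed
  also have "\<dots> \<longleftrightarrow> (\<exists>P T y. q = fact_of P T y \<and> wfp P T \<and> T \<noteq> {} \<and> y ` T \<subseteq> A \<and> asserts \<Phi> P T y)"
    using assms(3) by blast
  also have "\<dots> \<longleftrightarrow> q \<in> \<Phi>"
  proof
    assume q: "q \<in> \<Phi>"
    then have "q \<in> facts A" using assms(1) by blast
    then show "\<exists>P T y. q = fact_of P T y \<and> wfp P T \<and> T \<noteq> {} \<and> y ` T \<subseteq> A \<and> asserts \<Phi> P T y"
      using q unfolding facts_def asserts_def by auto
  qed (auto simp: asserts_def split: if_splits)
  finally show "q \<in> rest (theory_of B H) A \<longleftrightarrow> q \<in> \<Phi>" .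
qed

text \<open>The atoms of \<open>P\<close> are divided between the two sides. Variables in
  \<open>T1 \<union> T2\<close> outside \<open>T\<close> are quantified, with witnesses given by
  \<open>z\<close>; variables occurring in both parts lie in \<open>T1 \<inter> T2\<close>, so their
  values are in \<open>A \<inter> B\<close>.\<close>

definition amalgam :: "nat set \<Rightarrow> fact set \<Rightarrow> nat set \<Rightarrow> fact set \<Rightarrow> nat set \<Rightarrow> nat set \<Rightarrow> (nat \<Rightarrow> nat) \<Rightarrow> bool" where
  "amalgam A \<Phi> B \<Psi> P T y \<longleftrightarrow> (\<exists>P1 P2 T1 T2 z. P = P1 \<union> P2 \<and> T \<subseteq> T1 \<union> T2 \<and> wfp P1 T1 \<and> wfp P2 T2 \<and>
     vars P1 \<inter> vars P2 \<subseteq> T1 \<inter> T2 \<and> (\<forall>t\<in>T. z t = y t) \<and> z ` T1 \<subseteq> A \<and> z ` T2 \<subseteq> B \<and> asserts \<Phi> P1 T1 z \<and> asserts \<Psi> P2 T2 z)"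

lemma amalgamI:
  assumes "P = P1 \<union> P2" "T \<subseteq> T1 \<union> T2" "wfp P1 T1" "wfp P2 T2" "vars P1 \<inter> vars P2 \<subseteq> T1 \<inter> T2"
    "\<forall>t\<in>T. z t = y t" "z ` T1 \<subseteq> A" "z ` T2 \<subseteq> B" "asserts \<Phi> P1 T1 z" "asserts \<Psi> P2 T2 z"
  shows "amalgam A \<Phi> B \<Psi> P T y"
  unfolding amalgam_def by (intro exI conjI; fact assms)

lemma amalgam_swap: "amalgam A \<Phi> B \<Psi> P T y = amalgam B \<Psi> A \<Phi> P T y"
  unfolding amalgam_def by (rule iffI; elim exE conjE) (metis Un_commute Int_commute)+

lemma asserts_empty: "asserts \<Phi> {} {} y"
  using Fs_nonempty by (simp add: asserts_def)

text \<open>Conservativity: values of the right part that lie in \<open>A\<close> belong to the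
  common substructure, so after quantifying the other variables that part can be transferred to
  \<open>\<Phi>\<close> and glued there.\<close>

lemma amalgam_left:
  assumes \<Phi>: "coherent \<Phi>" and \<Psi>: "coherent \<Psi>" and eq: "rest \<Phi> (A \<inter> B) = rest \<Psi> (A \<inter> B)"
    and P: "wfp P T" "y ` T \<subseteq> A"
  shows "amalgam A \<Phi> B \<Psi> P T y \<longleftrightarrow> asserts \<Phi> P T y"
proof
  assume "amalgam A \<Phi> B \<Psi> P T y"
  then obtain P1 P2 T1 T2 z where *: "P = P1 \<union> P2" "T \<subseteq> T1 \<union> T2" "wfp P1 T1" "wfp P2 T2"
    "vars P1 \<inter> vars P2 \<subseteq> T1 \<inter> T2" "\<forall>t\<in>T. z t = y t" "z ` T1 \<subseteq> A" "z ` T2 \<subseteq> B" "asserts \<Phi> P1 T1 z" "asserts \<Psi> P2 T2 z"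
    unfolding amalgam_def by (elim exE conjE) (rule that)
  \<comment> \<open>These variables take values in \<open>A \<inter> B\<close>. Among them are all
    variables shared with \<open>P1\<close>, and all of \<open>T\<close> outside
    \<open>T1\<close>.\<close>
  define T0 where "T0 = {t \<in> T2. z t \<in> A}"
  have T0: "wfp P2 T0" "T0 \<subseteq> T2" "z ` T0 \<subseteq> A \<inter> B" using *(4,8) by (auto simp: T0_def wfp_def)
  have "asserts \<Psi> P2 T0 z" using coherent_restrict[OF \<Psi> *(4) _ T0(2,1) *(10)] by simp
  then have "asserts (rest \<Phi> (A \<inter> B)) P2 T0 z" using T0 eq by (simp add: asserts_rest)
  then have 2: "asserts \<Phi> P2 T0 z" using T0 by (simp add: asserts_rest)
  have "vars P1 \<inter> vars P2 \<subseteq> T1 \<inter> T0" using *(5,7) by (auto simp: T0_def)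
  from coherent_glue[OF \<Phi> *(3) T0(1) this *(9) 2]
  have "asserts \<Phi> P (T1 \<union> T0) z" using *(1) by simp
  moreover have "T \<subseteq> T1 \<union> T0"
  proof
    fix t assume "t \<in> T"
    then show "t \<in> T1 \<union> T0" using *(2,6) P(2) by (auto simp: T0_def image_subset_iff)
  qed
  ultimately have "asserts \<Phi> P T z"
    using coherent_restrict[OF \<Phi> wfp_Un[OF *(3) T0(1)], of P T z] P(1) *(1) by simp
  then show "asserts \<Phi> P T y" using asserts_cong[OF P(1)] *(6) by metis
next
  assume "asserts \<Phi> P T y"
  then show "amalgam A \<Phi> B \<Psi> P T y"
    unfolding amalgam_def using P asserts_empty
    by (intro exI[of _ P] exI[of _ "{}"] exI[of _ T] exI[of _ "{}"] exI[of _ y]) auto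
qed

lemma K_amalgamation:
  assumes KA: "K A \<Phi>" and KB: "K B \<Psi>" and eq: "rest \<Phi> (A \<inter> B) = rest \<Psi> (A \<inter> B)"
  shows "\<exists>\<Theta>. K (A \<union> B) \<Theta> \<and> rest \<Theta> A = \<Phi> \<and> rest \<Theta> B = \<Psi>"
proof -
  let ?H = "amalgam A \<Phi> B \<Psi>"
  let ?\<Theta> = "theory_of (A \<union> B) ?H"
  have \<Phi>: "\<Phi> \<subseteq> facts A" "coherent \<Phi>" "finite A" and \<Psi>: "\<Psi> \<subseteq> facts B" "coherent \<Psi>" "finite B"
    using KA KB by (auto simp: K_def)
  have L: "?H P T y \<longleftrightarrow> asserts \<Phi> P T y" if "wfp P T" "y ` T \<subseteq> A" for P T y
    by (rule amalgam_left) (use \<Phi> \<Psi> eq that in auto)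
  have R: "?H P T y \<longleftrightarrow> asserts \<Psi> P T y" if "wfp P T" "y ` T \<subseteq> B" for P T y
    unfolding amalgam_swap[of A] by (rule amalgam_left) (use \<Phi> \<Psi> eq that in \<open>auto simp: Int_commute\<close>)
  have H: "asserts ?\<Theta> P T y \<longleftrightarrow> ?H P T y" if "wfp P T" for P T y
  proof (rule asserts_theory_of[OF that])
    show "?H P T y'" if "wfp P T" "\<forall>t\<in>T. y t = y' t" "?H P T y" for P T y y'
      using that unfolding amalgam_def by (elim exE conjE) (metis (no_types, lifting))
    \<comment> \<open>The amalgam still omits the query: without free variables the condition that
      the values lie in \<open>A\<close> is void, so conservativity over \<open>\<Phi>\<close>
      applies.\<close>
    show "?H P {} y \<longleftrightarrow> P \<noteq> Fs" if "wfp P {}" for P y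
      using L[OF that] by (simp add: asserts_def)
    show "y ` T \<subseteq> A \<union> B" if "?H P T y" for P T y
      using that unfolding amalgam_def by (elim exE conjE) (force simp: image_subset_iff)
  qed
  have "coherent ?\<Theta>"
  proof (rule coherentI)
    fix P T P' T' y assume *: "wfp P T" "P' \<subseteq> P" "T' \<subseteq> T" "wfp P' T'" "asserts ?\<Theta> P T y"
    then have "?H P T y" by (simp add: H)
    then obtain P1 P2 T1 T2 z where d: "P = P1 \<union> P2" "T \<subseteq> T1 \<union> T2" "wfp P1 T1" "wfp P2 T2"
      "vars P1 \<inter> vars P2 \<subseteq> T1 \<inter> T2" "\<forall>t\<in>T. z t = y t" "z ` T1 \<subseteq> A" "z ` T2 \<subseteq> B" "asserts \<Phi> P1 T1 z" "asserts \<Psi> P2 T2 z"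
      unfolding amalgam_def by (elim exE conjE) (rule that)
    \<comment> \<open>The given splitting is intersected with the smaller set of atoms, and free
      variables that no longer occur are dropped to keep the parts well-formed.\<close>
    let ?P1 = "P1 \<inter> P'" and ?P2 = "P2 \<inter> P'"
    let ?T1 = "T1 \<inter> vars ?P1" and ?T2 = "T2 \<inter> vars ?P2"
    have w: "wfp ?P1 ?T1" "wfp ?P2 ?T2" using d(3,4) by (auto simp: wfp_def)
    have P': "P' = ?P1 \<union> ?P2" using *(2) d(1) by blast
    have sub: "vars ?P1 \<subseteq> vars P1" "vars ?P2 \<subseteq> vars P2" by (simp_all add: vars_mono)
    have vP': "vars P' = vars ?P1 \<union> vars ?P2" using P' vars_simps(2) by metis
    have "T' \<subseteq> ?T1 \<union> ?T2"
    proof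
      fix x assume x: "x \<in> T'"
      have "x \<in> T1 \<union> T2" "T1 \<subseteq> vars P1" "T2 \<subseteq> vars P2" using x *(3) d(2,3,4) by (auto simp: wfp_def)
      moreover have "x \<in> vars ?P1 \<or> x \<in> vars ?P2" using x *(4) vP' by (auto simp: wfp_def)
      ultimately show "x \<in> ?T1 \<union> ?T2" using d(5) sub by blast
    qed
    moreover have "vars ?P1 \<inter> vars ?P2 \<subseteq> ?T1 \<inter> ?T2" using d(5) sub by blast
    moreover have "asserts \<Phi> ?P1 ?T1 z" using coherent_restrict[OF \<Phi>(2) d(3) _ _ w(1) d(9)] by simp
    moreover have "asserts \<Psi> ?P2 ?T2 z" using coherent_restrict[OF \<Psi>(2) d(4) _ _ w(2) d(10)] by simp
    moreover have "z ` ?T1 \<subseteq> A" "z ` ?T2 \<subseteq> B" "\<forall>t\<in>T'. z t = y t" using d(6,7,8) *(3) by blast+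
    ultimately have "?H P' T' y"
      using P' w by (intro amalgamI[of P' ?P1 ?P2 T' ?T1 ?T2 z y])
    then show "asserts ?\<Theta> P' T' y" using H *(4) by simp
  next
    fix P T P' T' y
    assume *: "wfp P T" "wfp P' T'" "vars P \<inter> vars P' \<subseteq> T \<inter> T'" "asserts ?\<Theta> P T y" "asserts ?\<Theta> P' T' y"
    then have "?H P T y" "?H P' T' y" by (simp_all add: H)
    then obtain P1 P2 T1 T2 z P1' P2' T1' T2' z' where d: "P = P1 \<union> P2" "T \<subseteq> T1 \<union> T2" "wfp P1 T1" "wfp P2 T2"
      "vars P1 \<inter> vars P2 \<subseteq> T1 \<inter> T2" "\<forall>t\<in>T. z t = y t" "z ` T1 \<subseteq> A" "z ` T2 \<subseteq> B" "asserts \<Phi> P1 T1 z" "asserts \<Psi> P2 T2 z"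
      and d': "P' = P1' \<union> P2'" "T' \<subseteq> T1' \<union> T2'" "wfp P1' T1'" "wfp P2' T2'"
      "vars P1' \<inter> vars P2' \<subseteq> T1' \<inter> T2'" "\<forall>t\<in>T'. z' t = y t" "z' ` T1' \<subseteq> A" "z' ` T2' \<subseteq> B" "asserts \<Phi> P1' T1' z'" "asserts \<Psi> P2' T2' z'"
      unfolding amalgam_def by (elim exE conjE) (rule that)
    have v: "vars P = vars P1 \<union> vars P2" "vars P' = vars P1' \<union> vars P2'" using d(1) d'(1) by simp_all
    have t: "T1 \<subseteq> vars P1" "T2 \<subseteq> vars P2" "T1' \<subseteq> vars P1'" "T2' \<subseteq> vars P2'" "T \<subseteq> vars P" "T' \<subseteq> vars P'"
      using d(3,4) d'(3,4) *(1,2) by (auto simp: wfp_def)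
    \<comment> \<open>The assignments can be merged: a variable in both domains occurs in both
      formulas, hence is free in both, and there both assignments agree with
      \<open>y\<close>.\<close>
    define u where "u t = (if t \<in> T1 \<union> T2 then z t else z' t)" for t
    have u: "u t = z t" if "t \<in> T1 \<union> T2" for t using that by (simp add: u_def)
    have u': "u t = z' t" if "t \<in> T1' \<union> T2'" for t
    proof (cases "t \<in> T1 \<union> T2")
      case True
      then have "t \<in> T \<inter> T'" using that t v *(3) by blast
      then show ?thesis using True d(6) d'(6) by (simp add: u_def)
    qed (simp add: u_def)
    \<comment> \<open>A variable common to a part of \<open>P\<close> and a part of
      \<open>P'\<close> lies in \<open>T \<inter> T'\<close>. If it is in the free set of the other
      part only, it occurs in both parts of that formula, and the sharing condition puts it into the
      right free set.\<close>
    have meet: "vars P1 \<inter> vars P1' \<subseteq> T1 \<inter> T1'" "vars P2 \<inter> vars P2' \<subseteq> T2 \<inter> T2'"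
      "vars P1 \<inter> vars P2' \<subseteq> T1 \<inter> T2'" "vars P2 \<inter> vars P1' \<subseteq> T2 \<inter> T1'"
      using *(3) v d(2,5) d'(2,5) t by blast+
    have "asserts \<Phi> P1 T1 u" "asserts \<Phi> P1' T1' u" "asserts \<Psi> P2 T2 u" "asserts \<Psi> P2' T2' u"
      using asserts_cong[OF d(3), of u z] asserts_cong[OF d(4), of u z]
        asserts_cong[OF d'(3), of u z'] asserts_cong[OF d'(4), of u z'] u u' d(9,10) d'(9,10) by auto
    then have "asserts \<Phi> (P1 \<union> P1') (T1 \<union> T1') u" "asserts \<Psi> (P2 \<union> P2') (T2 \<union> T2') u"
      using coherent_glue[OF \<Phi>(2) d(3) d'(3) meet(1)] coherent_glue[OF \<Psi>(2) d(4) d'(4) meet(2)] by auto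
    moreover have "vars (P1 \<union> P1') \<inter> vars (P2 \<union> P2') \<subseteq> (T1 \<union> T1') \<inter> (T2 \<union> T2')"
      using meet d(5) d'(5) by auto
    moreover have "u ` (T1 \<union> T1') \<subseteq> A" "u ` (T2 \<union> T2') \<subseteq> B"
      using u u' d(7,8) d'(7,8) by (auto simp: image_subset_iff)
    moreover have "\<forall>t\<in>T \<union> T'. u t = y t"
    proof
      fix x assume "x \<in> T \<union> T'"
      then show "u x = y x"
      proof
        assume "x \<in> T"
        then show ?thesis using u[of x] d(2,6) by auto
      next
        assume "x \<in> T'"
        then show ?thesis using u'[of x] d'(2,6) by auto
      qed
    qed
    moreover have "P \<union> P' = (P1 \<union> P1') \<union> (P2 \<union> P2')" "T \<union> T' \<subseteq> (T1 \<union> T1') \<union> (T2 \<union> T2')"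
      using d(1,2) d'(1,2) by auto
    ultimately have "?H (P \<union> P') (T \<union> T') y"
      using wfp_Un[OF d(3) d'(3)] wfp_Un[OF d(4) d'(4)]
      by (intro amalgamI[of "P \<union> P'" "P1 \<union> P1'" "P2 \<union> P2'" "T \<union> T'" "T1 \<union> T1'" "T2 \<union> T2'" u y])
    then show "asserts ?\<Theta> (P \<union> P') (T \<union> T') y" using H wfp_Un[OF *(1,2)] by simp
  qed
  moreover have "?\<Theta> \<subseteq> facts (A \<union> B)" unfolding theory_of_def facts_def by blast
  ultimately have "K (A \<union> B) ?\<Theta>" using \<Phi>(3) \<Psi>(3) by (simp add: K_def)
  moreover have "rest ?\<Theta> A = \<Phi>"
    by (rule theory_of_rest[OF \<Phi>(1) _ L]) auto
  moreover have "rest ?\<Theta> B = \<Psi>"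
    by (rule theory_of_rest[OF \<Psi>(1) _ R]) auto
  ultimately show ?thesis by blast
qed

end

section \<open>Expansions of structures in which the query fails\<close>

context query
begin

definition hom_free :: "(nat \<Rightarrow> nat list \<Rightarrow> bool) \<Rightarrow> bool" where
  "hom_free At \<longleftrightarrow> \<not> (\<exists>y. \<forall>f<s. At f (map y (V f)))"

text \<open>The part \<open>P2\<close> is not connected to \<open>T\<close>; it is regarded as satisfied in a disjoint copy, in
  accordance with the convention on sentences.\<close>

definition realized :: "(nat \<Rightarrow> nat list \<Rightarrow> bool) \<Rightarrow> nat set \<Rightarrow> nat set \<Rightarrow> (nat \<Rightarrow> nat) \<Rightarrow> bool" where
  "realized At P T y \<longleftrightarrow> (\<exists>P1 P2 z. P = P1 \<union> P2 \<and> vars P1 \<inter> vars P2 = {} \<and> T \<subseteq> vars P1 \<and> P2 \<noteq> Fs \<and>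
     (\<forall>t\<in>T. z t = y t) \<and> (\<forall>f\<in>P1. At f (map z (V f))))"

text \<open>Connectedness enters the construction through this consequence: it keeps the whole query
  false as a sentence, and it controls unions of parts that are satisfied in disjoint
  copies.\<close>

lemma disjoint_cover:
  assumes "P1 \<union> P2 = Fs" "vars P1 \<inter> vars P2 = {}"
  shows "P1 = {} \<and> P2 = Fs \<or> P2 = {} \<and> P1 = Fs"
  using connected[OF assms(1)] assms by (auto simp: vars_def)

definition theory_of_struct :: "(nat \<Rightarrow> nat list \<Rightarrow> bool) \<Rightarrow> fact set" where
  "theory_of_struct At = theory_of UNIV (realized At)"

lemma asserts_struct:
  assumes "hom_free At" "wfp P T"
  shows "asserts (theory_of_struct At) P T y \<longleftrightarrow> realized At P T y"
  unfolding theory_of_struct_def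
proof (rule asserts_theory_of[OF assms(2)])
  show "realized At P T y'" if "\<forall>t\<in>T. y t = y' t" "realized At P T y" for P T y y'
    using that unfolding realized_def by (elim exE conjE) (intro exI conjI, auto)
  show "realized At P {} y \<longleftrightarrow> P \<noteq> Fs" for P y
  proof
    assume "P \<noteq> Fs"
    then show "realized At P {} y"
      unfolding realized_def by (intro exI[of _ "{}"] exI[of _ P]) auto
  next
    assume "realized At P {} y"
    then obtain P1 P2 z where *: "P = P1 \<union> P2" "vars P1 \<inter> vars P2 = {}" "P2 \<noteq> Fs" "\<forall>f\<in>P1. At f (map z (V f))"
      unfolding realized_def by blast
    show "P \<noteq> Fs"
    proof
      assume "P = Fs"
      then have "P1 = Fs" using disjoint_cover[of P1 P2] * by auto
      then have "\<forall>f<s. At f (map z (V f))" using *(4) by auto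
      then show False using assms(1) unfolding hom_free_def by blast
    qed
  qed
qed auto

text \<open>Restricting or merging witnesses proves both rules; the parts satisfied in disjoint
  copies have to be collected into a single one that is still not the whole query.\<close>

lemma coherent_struct:
  assumes free: "hom_free At"
  shows "coherent (theory_of_struct At)"
proof (rule coherentI)
  fix P T P' T' y
  assume *: "wfp P T" "P' \<subseteq> P" "T' \<subseteq> T" "wfp P' T'" "asserts (theory_of_struct At) P T y"
  then have "realized At P T y" by (simp add: asserts_struct[OF free])
  then obtain P1 P2 z where d: "P = P1 \<union> P2" "vars P1 \<inter> vars P2 = {}" "T \<subseteq> vars P1" "P2 \<noteq> Fs"
    "\<forall>t\<in>T. z t = y t" "\<forall>f\<in>P1. At f (map z (V f))"
    unfolding realized_def by (elim exE conjE) (rule that)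
  let ?P1 = "P1 \<inter> P'" and ?P2 = "P2 \<inter> P'"
  have P': "P' = ?P1 \<union> ?P2" using *(2) d(1) by blast
  have sub: "vars ?P1 \<subseteq> vars P1" "vars ?P2 \<subseteq> vars P2" by (simp_all add: vars_mono)
  have vP': "vars P' = vars ?P1 \<union> vars ?P2" using P' vars_simps(2) by metis
  have T': "T' \<subseteq> vars ?P1"
  proof
    fix x assume x: "x \<in> T'"
    have "x \<in> vars P1" using x *(3) d(3) by blast
    moreover have "x \<in> vars ?P1 \<or> x \<in> vars ?P2" using x *(4) vP' by (auto simp: wfp_def)
    ultimately show "x \<in> vars ?P1" using d(2) sub by blast
  qed
  have "P2 \<subseteq> Fs" using *(1) d(1) by (simp add: wfp_def)
  then have "?P2 \<noteq> Fs" using d(4) by blast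
  moreover have "vars ?P1 \<inter> vars ?P2 = {}" using d(2) sub by blast
  ultimately have "realized At P' T' y"
    unfolding realized_def using P' T' d(5,6) *(3) by (intro exI[of _ ?P1] exI[of _ ?P2] exI[of _ z] conjI) auto
  then show "asserts (theory_of_struct At) P' T' y" using *(4) by (simp add: asserts_struct[OF free])
next
  fix P T P' T' y
  assume *: "wfp P T" "wfp P' T'" "vars P \<inter> vars P' \<subseteq> T \<inter> T'"
    "asserts (theory_of_struct At) P T y" "asserts (theory_of_struct At) P' T' y"
  then have "realized At P T y" "realized At P' T' y" by (simp_all add: asserts_struct[OF free])
  then obtain P1 P2 z P1' P2' z' where d: "P = P1 \<union> P2" "vars P1 \<inter> vars P2 = {}" "T \<subseteq> vars P1" "P2 \<noteq> Fs"
    "\<forall>t\<in>T. z t = y t" "\<forall>f\<in>P1. At f (map z (V f))"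
    and d': "P' = P1' \<union> P2'" "vars P1' \<inter> vars P2' = {}" "T' \<subseteq> vars P1'" "P2' \<noteq> Fs"
    "\<forall>t\<in>T'. z' t = y t" "\<forall>f\<in>P1'. At f (map z' (V f))"
    unfolding realized_def by (elim exE conjE) (rule that)
  have v: "vars P = vars P1 \<union> vars P2" "vars P' = vars P1' \<union> vars P2'" using d(1) d'(1) by simp_all
  define u where "u t = (if t \<in> vars P1 then z t else z' t)" for t
  have u': "u t = z' t" if "t \<in> vars P1'" for t
  proof (cases "t \<in> vars P1")
    case True
    then have "t \<in> T \<inter> T'" using that v *(3) by blast
    then show ?thesis using True d(5) d'(5) by (simp add: u_def)
  qed (simp add: u_def)
  have dis: "vars (P1 \<union> P1') \<inter> vars (P2 \<union> P2') = {}"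
    unfolding vars_simps using *(3)[unfolded v] d(2,3) d'(2,3) by blast
  have "vars P2 \<inter> vars P2' = {}" using *(3)[unfolded v] d(2,3) by blast
  \<comment> \<open>The two detached parts have no common variable, so by connectedness their union
    is the whole query only if one of them already is.\<close>
  then have ne: "P2 \<union> P2' \<noteq> Fs" using disjoint_cover[of P2 P2'] d(4) d'(4) by blast
  have At: "\<forall>f\<in>P1 \<union> P1'. At f (map u (V f))"
  proof
    fix f assume "f \<in> P1 \<union> P1'"
    then show "At f (map u (V f))"
    proof
      assume f: "f \<in> P1"
      then have "map u (V f) = map z (V f)" by (auto simp: u_def vars_def)
      then show ?thesis using bspec[OF d(6) f] by (simp only:)
    next
      assume f: "f \<in> P1'"
      then have "map u (V f) = map z' (V f)" using u' by (auto simp: vars_def)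
      then show ?thesis using bspec[OF d'(6) f] by (simp only:)
    qed
  qed
  have "\<forall>t\<in>T \<union> T'. u t = y t"
  proof
    fix t assume "t \<in> T \<union> T'"
    then show "u t = y t" using d(3,5) d'(3,5) u'[of t] by (auto simp: u_def)
  qed
  moreover have "P \<union> P' = (P1 \<union> P1') \<union> (P2 \<union> P2')" using d(1) d'(1) by auto
  moreover have "T \<union> T' \<subseteq> vars (P1 \<union> P1')" using d(3) d'(3) by auto
  ultimately have "realized At (P \<union> P') (T \<union> T') y"
    unfolding realized_def using dis ne At
    by (intro exI[of _ "P1 \<union> P1'"] exI[of _ "P2 \<union> P2'"] exI[of _ u] conjI)
  then show "asserts (theory_of_struct At) (P \<union> P') (T \<union> T') y"
    using wfp_Un[OF *(1,2)] by (simp add: asserts_struct[OF free])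
qed

lemma K_struct:
  assumes "hom_free At" "finite A"
  shows "K A (rest (theory_of_struct At) A)"
proof -
  have "theory_of_struct At \<subseteq> facts UNIV" by (auto simp: theory_of_struct_def theory_of_def facts_def)
  then show ?thesis using assms coherent_rest[OF coherent_struct] facts_rest by (simp add: K_def)
qed

lemma facts_nonempty:
  assumes "(r, xs) \<in> facts A"
  shows "set xs \<subseteq> A \<and> xs \<noteq> []"
proof -
  obtain P T y where "(r, xs) = fact_of P T y" "wfp P T" "T \<noteq> {}" "y ` T \<subseteq> A"
    using assms by (auto simp: facts_def)
  then show ?thesis using wfp_finite[of P T] by (auto simp: fact_of_def)
qed

lemma no_atoms_free: "hom_free (\<lambda>_ _. False)"
  using s_pos by (auto simp: hom_free_def)

sublocale amalgamation_class K
proof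
  show "finite A \<and> finite \<Phi>" if "K A \<Phi>" for A \<Phi>
    using that finite_facts[of A] by (auto simp: K_def intro: finite_subset)
  show "set xs \<subseteq> A \<and> xs \<noteq> []" if "K A \<Phi>" "(r, xs) \<in> \<Phi>" for A \<Phi> r xs
    using that facts_nonempty by (auto simp: K_def)
  have "rest (theory_of_struct (\<lambda>_ _. False)) {} \<subseteq> facts {}"
    using K_struct[OF no_atoms_free, of "{}"] by (simp add: K_def)
  then have "rest (theory_of_struct (\<lambda>_ _. False)) {} = {}" by (auto simp: facts_def)
  then show "K {} {}" using K_struct[OF no_atoms_free, of "{}"] by simp
  show "\<exists>\<Phi>. K {0} \<Phi>" using K_struct[OF no_atoms_free, of "{0}"] by auto
  show "K (h ` A) (ren h \<Phi>)" if "K A \<Phi>" "inj_on h A" for A \<Phi> h using that by (rule K_rename)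
  show "K B (rest \<Phi> B)" if "K A \<Phi>" "B \<subseteq> A" for A B \<Phi>
    using that facts_rest[of \<Phi> A B] coherent_rest[of \<Phi> B] finite_subset[of B A] by (simp add: K_def)
  show "\<exists>\<Theta>. K (A \<union> B) \<Theta> \<and> rest \<Theta> A = \<Phi> \<and> rest \<Theta> B = \<Psi>"
    if "K A \<Phi>" "K B \<Psi>" "rest \<Phi> (A \<inter> B) = rest \<Psi> (A \<inter> B)" for A B \<Phi> \<Psi>
    using that by (rule K_amalgamation)
qed

definition gen :: "fact set" where
  "gen = (SOME \<Phi>. (\<forall>A. finite A \<longrightarrow> K A (rest \<Phi> A)) \<and>
    (\<forall>X b \<Psi>. finite X \<longrightarrow> b \<notin> X \<longrightarrow> K (insert b X) \<Psi> \<longrightarrow> rest \<Psi> X = rest \<Phi> X \<longrightarrow>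
      (\<exists>c. c \<notin> X \<and> rest \<Phi> (insert c X) = ren (id(b := c)) \<Psi>)))"

sublocale generic K gen
  using someI_ex[OF generic_exists, folded gen_def] by unfold_locales blast+

lemma gen_facts: "gen \<subseteq> facts UNIV"
proof
  fix q assume q: "q \<in> gen"
  obtain r xs where "q = (r, xs)" by (rule prod.exhaust)
  then have "q \<in> rest gen (set xs)" using q by (simp add: in_rest)
  then have "q \<in> facts (set xs)" using local_K[of "set xs"] by (auto simp: K_def)
  moreover have "facts (set xs) \<subseteq> facts UNIV" unfolding facts_def by blast
  ultimately show "q \<in> facts UNIV" by blast
qed

lemma coherent_gen: "coherent gen"
proof (rule coherent_local)
  fix A :: "nat set" assume "finite A"
  then have "K A (rest gen A)" by (rule local_K)
  then show "coherent (rest gen A)" by (simp only: K_def)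
qed

section \<open>The homogeneous structure and its reduct\<close>

definition sig :: "nat set" where "sig = {code P T | P T. wfp P T \<and> T \<noteq> {}}"
definition arity :: "nat \<Rightarrow> nat" where "arity r = card (set_decode (snd (prod_decode r)))"

lemma arity_code: "finite T \<Longrightarrow> arity (code P T) = card T"
  by (simp add: arity_def code_def)

text \<open>Correct typing over the signature is all that \<open>facts\<close> demands, so for
  finite structures in this signature membership in \<open>K\<close> amounts to coherence.\<close>

lemma facts_eq: "facts A = {(r, xs). r \<in> sig \<and> length xs = arity r \<and> set xs \<subseteq> A}"
proof (rule set_eqI)
  fix q :: fact
  obtain r xs where q: "q = (r, xs)" by (rule prod.exhaust)
  show "q \<in> facts A \<longleftrightarrow> q \<in> {(r, xs). r \<in> sig \<and> length xs = arity r \<and> set xs \<subseteq> A}"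
  proof
    assume "q \<in> facts A"
    then obtain P T y where *: "q = fact_of P T y" "wfp P T" "T \<noteq> {}" "y ` T \<subseteq> A" by (auto simp: facts_def)
    then show "q \<in> {(r, xs). r \<in> sig \<and> length xs = arity r \<and> set xs \<subseteq> A}"
      using wfp_finite[OF *(2)] by (auto simp: fact_of_def sig_def arity_code)
  next
    assume "q \<in> {(r, xs). r \<in> sig \<and> length xs = arity r \<and> set xs \<subseteq> A}"
    then obtain P T where *: "r = code P T" "wfp P T" "T \<noteq> {}" "length xs = card T" "set xs \<subseteq> A"
      using q wfp_finite by (auto simp: sig_def arity_code)
    obtain y where "xs = map y (sorted_list_of_set T)" using list_as_map *(4) wfp_finite[OF *(2)] by blast
    then have "q = fact_of P T y" "y ` T \<subseteq> A" using q *(1,5) wfp_finite[OF *(2)] by (auto simp: fact_of_def)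
    then show "q \<in> facts A" using *(2,3) by (auto simp: facts_def)
  qed
qed

lemma facts_mono: "A \<subseteq> B \<Longrightarrow> facts A \<subseteq> facts B"
  by (auto simp: facts_eq)

lemma finite_sig: "finite sig"
proof -
  have "sig \<subseteq> (\<lambda>(P, T). code P T) ` (Pow Fs \<times> Pow (vars Fs))"
  proof
    fix r assume "r \<in> sig"
    then obtain P T where PT: "r = code P T" "P \<subseteq> Fs" "T \<subseteq> vars P" by (auto simp: sig_def wfp_def)
    then have "T \<subseteq> vars Fs" using vars_mono[of P Fs] by blast
    then show "r \<in> (\<lambda>(P, T). code P T) ` (Pow Fs \<times> Pow (vars Fs))"
      using PT by (intro image_eqI[of _ _ "(P, T)"]) auto
  qed
  moreover have "finite (vars Fs)" by (simp add: vars_def)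
  ultimately show ?thesis by (auto intro: finite_subset)
qed

lemma K_piso:
  assumes "piso \<Theta> \<Phi> A e" "finite A" "K (e ` A) (rest \<Phi> (e ` A))"
  shows "K A (rest \<Theta> A)"
proof -
  let ?i = "inv_into A e"
  have inj: "inj_on e A" using assms(1) by (simp add: piso_def)
  have "piso \<Phi> \<Theta> (e ` A) ?i" by (rule piso_inverse[OF assms(1)]) (use inj in auto)
  then have "inj_on ?i (e ` A)" "rest \<Theta> (?i ` e ` A) = ren ?i (rest \<Phi> (e ` A))" by (simp_all add: piso_alt)
  moreover have "?i ` e ` A = A" using inv_into_image_cancel[OF inj subset_refl] .
  ultimately show ?thesis using K_ren[OF assms(3), of ?i] by simp
qed

definition struct_of :: "nat set \<Rightarrow> fact set \<Rightarrow> (nat, nat) rstruct" where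
  "struct_of A \<Phi> = \<lparr>sdom = A, ssig = sig, sar = arity, srel = (\<lambda>r. {xs. (r, xs) \<in> \<Phi>})\<rparr>"

definition facts_in :: "(nat, nat) rstruct \<Rightarrow> fact set" where
  "facts_in M = {(r, xs). r \<in> sig \<and> xs \<in> srel M r}"

abbreviation "CC \<equiv> struct_of UNIV gen"

definition in_sig :: "(nat, nat) rstruct \<Rightarrow> bool" where
  "in_sig M \<longleftrightarrow> wf_struct M \<and> ssig M = sig \<and> (\<forall>r\<in>sig. sar M r = arity r)"

lemma in_sig_facts: "in_sig M \<Longrightarrow> facts_in M \<subseteq> facts (sdom M)"
  unfolding in_sig_def wf_struct_def facts_in_def facts_eq by fastforce

lemma struct_of_in_sig: "\<Phi> \<subseteq> facts A \<Longrightarrow> in_sig (struct_of A \<Phi>) \<and> facts_in (struct_of A \<Phi>) = \<Phi>"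
  unfolding in_sig_def wf_struct_def facts_in_def facts_eq struct_of_def by auto

lemma embeds_iff_piso:
  assumes "in_sig M" "in_sig N"
  shows "embeds M N \<longleftrightarrow> (\<exists>e. piso (facts_in M) (facts_in N) (sdom M) e \<and> e ` sdom M \<subseteq> sdom N)"
proof -
  have "piso (facts_in M) (facts_in N) (sdom M) e \<longleftrightarrow> inj_on e (sdom M) \<and>
     (\<forall>r\<in>ssig M. \<forall>xs. length xs = sar M r \<and> set xs \<subseteq> sdom M \<longrightarrow> (xs \<in> srel M r \<longleftrightarrow> map e xs \<in> srel N r))" for e
  proof -
    have "(r, xs) \<notin> facts_in M \<and> (r, map e xs) \<notin> facts_in N" if "\<not> (r \<in> sig \<and> length xs = arity r)" for r xs
      using that in_sig_facts[OF assms(1)] in_sig_facts[OF assms(2)] by (auto simp: facts_eq)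
    then have "piso (facts_in M) (facts_in N) (sdom M) e \<longleftrightarrow> inj_on e (sdom M) \<and>
      (\<forall>r xs. r \<in> sig \<and> length xs = arity r \<and> set xs \<subseteq> sdom M \<longrightarrow> ((r, xs) \<in> facts_in M \<longleftrightarrow> (r, map e xs) \<in> facts_in N))"
      unfolding piso_def by blast
    then show ?thesis using assms(1) by (auto simp: in_sig_def facts_in_def)
  qed
  then show ?thesis unfolding embeds_def by auto
qed

lemma CC_props: "in_sig CC" "facts_in CC = gen" "wf_struct CC"
  using struct_of_in_sig[OF gen_facts] by (simp_all add: in_sig_def)

lemma homogeneous_CC: "homogeneous CC"
  unfolding homogeneous_def
proof (intro allI impI, elim conjE)
  fix X h assume X: "finite X" and h: "partial_iso CC X h"
  have ill: "(r, xs) \<notin> gen" if "\<not> (r \<in> sig \<and> length xs = arity r)" for r xs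
    using gen_facts that by (auto simp: facts_eq)
  have "piso gen gen X h"
    unfolding piso_def
  proof (intro conjI allI impI)
    show "inj_on h X" using h by (simp add: partial_iso_def)
    fix r xs assume "set xs \<subseteq> X"
    then show "(r, xs) \<in> gen \<longleftrightarrow> (r, map h xs) \<in> gen"
      using h ill[of r xs] ill[of r "map h xs"] by (cases "r \<in> sig \<and> length xs = arity r") (auto simp: partial_iso_def struct_of_def)
  qed
  then obtain g where g: "bij g" "piso gen gen UNIV g" "\<forall>x\<in>X. g x = h x"
    using homogeneous_generic[OF X] by blast
  then have "automorphism CC g" by (auto simp: automorphism_def piso_def struct_of_def)
  then show "\<exists>g. automorphism CC g \<and> (\<forall>x\<in>X. g x = h x)" using g(3) by blast
qed

lemma embeds_CC_iff:
  assumes "in_sig M" "finite (sdom M)"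
  shows "embeds M CC \<longleftrightarrow> K (sdom M) (facts_in M)"
proof -
  have r: "rest (facts_in M) (sdom M) = facts_in M"
    using in_sig_facts[OF assms(1)] by (auto simp: facts_eq rest_def)
  have "embeds M CC \<longleftrightarrow> (\<exists>e. piso (facts_in M) gen (sdom M) e)"
    using embeds_iff_piso[OF assms(1) CC_props(1)] CC_props(2) by (simp add: struct_of_def)
  also have "\<dots> \<longleftrightarrow> K (sdom M) (facts_in M)"
  proof
    assume "\<exists>e. piso (facts_in M) gen (sdom M) e"
    then show "K (sdom M) (facts_in M)"
      using K_piso[of "facts_in M" gen "sdom M"] assms(2) local_K r by (metis finite_imageI)
  qed (rule embed_finite)
  finally show ?thesis .
qed

text \<open>The size bound is that of \<open>coherent_local\<close>: a failure of coherence is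
  already visible on that many points.\<close>

definition bounds :: "(nat, nat) rstruct set" where
  "bounds = (\<lambda>(n, \<Psi>). struct_of {..<n} \<Psi>) ` {(n, \<Psi>). n \<le> card (vars Fs) \<and> \<Psi> \<subseteq> facts {..<n} \<and> \<not> K {..<n} \<Psi>}"

lemma finite_bounds: "finite bounds"
proof -
  let ?m = "card (vars Fs)"
  have "{(n, \<Psi>). n \<le> ?m \<and> \<Psi> \<subseteq> facts {..<n} \<and> \<not> K {..<n} \<Psi>} \<subseteq> {..?m} \<times> Pow (facts {..<?m})"
  proof
    fix q assume "q \<in> {(n, \<Psi>). n \<le> ?m \<and> \<Psi> \<subseteq> facts {..<n} \<and> \<not> K {..<n} \<Psi>}"
    then obtain n \<Psi> where q: "q = (n, \<Psi>)" and "n \<le> ?m" "\<Psi> \<subseteq> facts {..<n}" by blast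
    moreover from this have "facts {..<n} \<subseteq> facts {..<?m}" by (intro facts_mono) auto
    ultimately show "q \<in> {..?m} \<times> Pow (facts {..<?m})" by auto
  qed
  moreover have "finite ({..?m} \<times> Pow (facts {..<?m}))" by (simp add: finite_facts)
  ultimately have "finite {(n, \<Psi>). n \<le> ?m \<and> \<Psi> \<subseteq> facts {..<n} \<and> \<not> K {..<n} \<Psi>}"
    by (rule finite_subset)
  then show ?thesis unfolding bounds_def by (rule finite_imageI)
qed

lemma not_K_small:
  assumes M: "in_sig M" "finite (sdom M)" and nK: "\<not> K (sdom M) (facts_in M)"
  shows "\<exists>N\<in>bounds. embeds N M"
proof -
  let ?F = "facts_in M"
  have F: "?F \<subseteq> facts (sdom M)" by (rule in_sig_facts[OF M(1)])
  then have "\<not> coherent ?F" using nK M(2) by (simp add: K_def)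
  then obtain A0 where A0: "finite A0" "card A0 \<le> card (vars Fs)" "\<not> coherent (rest ?F A0)"
    using coherent_local by blast
  \<comment> \<open>The set from \<open>coherent_local\<close> may contain numbers outside the
    domain; they carry no facts and are removed.\<close>
  define A where "A = A0 \<inter> sdom M"
  have A: "finite A" "card A \<le> card (vars Fs)" "A \<subseteq> sdom M"
    using A0 card_mono[of A0 A] by (auto simp: A_def)
  have "rest ?F A = rest ?F A0" using F by (auto simp: A_def rest_def facts_eq)
  then have nKA: "\<not> K A (rest ?F A)" using A0(3) by (simp add: K_def)
  obtain e where e: "bij_betw e {..<card A} A"
    using ex_bij_betw_nat_finite[OF A(1)] atLeast0LessThan by auto
  let ?g = "inv_into {..<card A} e"
  have g: "bij_betw ?g A {..<card A}" using e by (rule bij_betw_inv_into)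
  then have gA: "?g ` A = {..<card A}" "inj_on ?g A" by (auto simp: bij_betw_def)
  let ?\<Psi> = "ren ?g (rest ?F A)"
  have \<Psi>: "?\<Psi> \<subseteq> facts {..<card A}"
  proof
    fix q assume "q \<in> ?\<Psi>"
    then obtain r xs where q: "q = (r, map ?g xs)" "(r, xs) \<in> ?F" "set xs \<subseteq> A" by (auto simp: ren_def rest_def)
    then have "set (map ?g xs) \<subseteq> {..<card A}" using gA(1) by auto
    then show "q \<in> facts {..<card A}" using F q by (auto simp: facts_eq simp del: set_map)
  qed
  then have rest\<Psi>: "rest ?\<Psi> {..<card A} = ?\<Psi>" by (auto simp: facts_eq rest_def)
  have p: "piso ?F ?\<Psi> A ?g" unfolding piso_alt using gA rest\<Psi> by simp
  have "\<not> K {..<card A} ?\<Psi>"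
    using K_piso[OF p A(1)] nKA gA(1) rest\<Psi> by auto
  then have N: "struct_of {..<card A} ?\<Psi> \<in> bounds"
    unfolding bounds_def using A(2) \<Psi> by (intro image_eqI[of _ _ "(card A, ?\<Psi>)"]) auto
  have "piso ?\<Psi> ?F {..<card A} e"
    using piso_inverse[OF p, of e] gA(1) e by (auto simp: bij_betw_def f_inv_into_f)
  then have "embeds (struct_of {..<card A} ?\<Psi>) M"
    using embeds_iff_piso[of "struct_of {..<card A} ?\<Psi>" M] struct_of_in_sig[OF \<Psi>] M(1) e A(3)
    by (auto simp: struct_of_def bij_betw_def intro!: exI[of _ e])
  then show ?thesis using N by blast
qed

lemma finitely_bounded_CC: "finitely_bounded CC"
  unfolding finitely_bounded_def
proof (intro conjI exI[of _ bounds] ballI allI impI)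
  have sigC: "ssig CC = sig" "sar CC = arity" by (simp_all add: struct_of_def)
  show "finite (ssig CC)" by (simp add: sigC finite_sig)
  show "finite bounds" by (rule finite_bounds)
  show "finite_struct_in_sig CC N" if N: "N \<in> bounds" for N
  proof -
    obtain n \<Psi> where "N = struct_of {..<n} \<Psi>" "\<Psi> \<subseteq> facts {..<n}" using N by (auto simp: bounds_def)
    then show ?thesis using struct_of_in_sig[of \<Psi> "{..<n}"]
      by (auto simp: finite_struct_in_sig_def in_sig_def sigC struct_of_def)
  qed
  fix M assume "finite_struct_in_sig CC M"
  then have M: "in_sig M" "finite (sdom M)" by (auto simp: finite_struct_in_sig_def in_sig_def sigC)
  show "embeds M CC \<longleftrightarrow> \<not> (\<exists>N\<in>bounds. embeds N M)"
  proof
    assume "embeds M CC"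
    then have KM: "K (sdom M) (facts_in M)" using embeds_CC_iff[OF M] by simp
    show "\<not> (\<exists>N\<in>bounds. embeds N M)"
    proof (intro notI, elim bexE)
      fix N assume "N \<in> bounds" "embeds N M"
      then obtain n \<Psi> where N: "N = struct_of {..<n} \<Psi>" "\<Psi> \<subseteq> facts {..<n}" "\<not> K {..<n} \<Psi>" by (auto simp: bounds_def)
      obtain e where e: "piso \<Psi> (facts_in M) {..<n} e" "e ` {..<n} \<subseteq> sdom M"
        using embeds_iff_piso[of N M] \<open>embeds N M\<close> struct_of_in_sig[OF N(2)] M(1) N(1) by (auto simp: struct_of_def)
      have "K {..<n} (rest \<Psi> {..<n})" using K_piso[OF e(1)] K_rest[OF KM e(2)] by simp
      moreover have "rest \<Psi> {..<n} = \<Psi>" using N(2) by (auto simp: facts_eq rest_def)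
      ultimately show False using N(3) by simp
    qed
  next
    assume "\<not> (\<exists>N\<in>bounds. embeds N M)"
    then have "K (sdom M) (facts_in M)" using not_K_small[OF M] by blast
    then show "embeds M CC" using embeds_CC_iff[OF M] by simp
  qed
qed

end

section \<open>The reduct: omission of the query, universality, CSP and definability\<close>

context query
begin

text \<open>Tuples that violate the equalities forced by repeated variables in \<open>V f\<close> cannot contribute to a
  solution of the query, so the relation contains all of them.\<close>

definition BB :: "(nat, nat) rstruct" where
  "BB = \<lparr>sdom = UNIV, ssig = Fs, sar = (\<lambda>f. length (V f)),
     srel = (\<lambda>f. if f < s then {xs. length xs = length (V f) \<and>
       (\<forall>y. xs = map y (V f) \<longrightarrow> asserts gen {f} (set (V f)) y)} else {})\<rparr>"

lemma BB_simps [simp]: "sdom BB = UNIV" "ssig BB = Fs" "sar BB = (\<lambda>f. length (V f))"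
  by (simp_all add: BB_def)

lemma in_BB: "f < s \<Longrightarrow> xs \<in> srel BB f \<longleftrightarrow> length xs = length (V f) \<and>
    (\<forall>y. xs = map y (V f) \<longrightarrow> asserts gen {f} (set (V f)) y)"
  by (simp add: BB_def)

lemma wf_BB: "wf_struct BB"
  by (auto simp: wf_struct_def in_BB)

lemma wfp_single: "f < s \<Longrightarrow> wfp {f} (set (V f))"
  by (simp add: wfp_def)

text \<open>Gluing the single atoms asserts the whole query with all variables free; quantifying all
  of them contradicts the convention on sentences.\<close>

lemma hom_free_BB: "\<not> (\<exists>y. \<forall>f<s. map y (V f) \<in> srel BB f)"
proof
  assume "\<exists>y. \<forall>f<s. map y (V f) \<in> srel BB f"
  then obtain y where y: "\<And>f. f < s \<Longrightarrow> asserts gen {f} (set (V f)) y" using in_BB by blast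
  have "asserts gen P (vars P) y" if "finite P" "P \<subseteq> Fs" for P
    using that
  proof (induction P rule: finite_induct)
    case (insert f P)
    then have "asserts gen ({f} \<union> P) (set (V f) \<union> vars P) y"
      using y[of f] by (intro coherent_glue[OF coherent_gen wfp_single]) (auto simp: wfp_def)
    then show ?case using vars_simps(2)[of "{f}" P] by simp
  qed (simp add: asserts_empty)
  from this[of Fs] have "asserts gen Fs (vars Fs) y" by simp
  then have "asserts gen Fs {} y"
    using coherent_restrict[OF coherent_gen, of Fs "vars Fs" Fs "{}" y] by (simp add: wfp_def)
  then show False by (simp add: asserts_def)
qed

text \<open>The expansion of \<open>At\<close> embeds into \<open>gen\<close>; each atom of
  \<open>At\<close> is a realised one-atom formula, hence asserted at its image. On the reduct the
  embedding is used as a homomorphism only.\<close>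

lemma BB_universal_nat:
  assumes free: "hom_free At" and ar: "\<And>f t. At f t \<Longrightarrow> f < s \<and> length t = length (V f)"
  shows "\<exists>e. \<forall>f t. At f t \<longrightarrow> map e t \<in> srel BB f"
proof -
  obtain e where e: "piso (theory_of_struct At) gen UNIV e"
    using embed_countable[of "theory_of_struct At"] K_struct[OF free] by blast
  then have inj: "inj e" by (simp add: piso_def)
  have "map e t \<in> srel BB f" if "At f t" for f t
  proof -
    have f: "f < s" "length t = length (V f)" using ar[OF that] by auto
    have "asserts gen {f} (set (V f)) y'" if y': "map e t = map y' (V f)" for y'
    proof -
      let ?y = "inv e \<circ> y'"
      have "t = map (inv e) (map e t)" using inj by simp
      then have t: "t = map ?y (V f)" unfolding y' by simp
      have ey: "e (?y v) = y' v" if "v \<in> set (V f)" for v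
      proof -
        have "y' v \<in> set (map e t)" unfolding y' using that by simp
        then show ?thesis by (auto simp: f_inv_into_f)
      qed
      have "realized At {f} (set (V f)) ?y"
        unfolding realized_def using \<open>At f t\<close> Fs_nonempty unfolding t
        by (intro exI[of _ "{f}"] exI[of _ "{}"] exI[of _ ?y]) simp
      then have "fact_of {f} (set (V f)) ?y \<in> theory_of_struct At"
        using asserts_struct[OF free wfp_single[OF f(1)]] V_nonempty[OF f(1)] by (simp add: asserts_def)
      then have "(code {f} (set (V f)), map e (map ?y (sorted_list_of_set (set (V f))))) \<in> gen"
        using e by (simp add: piso_def fact_of_def)
      moreover have "map e (map ?y (sorted_list_of_set (set (V f)))) = map y' (sorted_list_of_set (set (V f)))"
        unfolding map_map by (rule map_cong) (use ey in simp_all)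
      ultimately have "(code {f} (set (V f)), map y' (sorted_list_of_set (set (V f)))) \<in> gen" by (simp only:)
      then show ?thesis using V_nonempty[OF f(1)] by (simp add: asserts_def fact_of_def)
    qed
    then show ?thesis using f by (simp add: in_BB)
  qed
  then show ?thesis by blast
qed

lemma BB_universal:
  fixes At :: "nat \<Rightarrow> 'b::countable list \<Rightarrow> bool"
  assumes free: "\<not> (\<exists>y. \<forall>f<s. At f (map y (V f)))" and ar: "\<And>f t. At f t \<Longrightarrow> f < s \<and> length t = length (V f)"
  shows "\<exists>e. \<forall>f t. At f t \<longrightarrow> map e t \<in> srel BB f"
proof -
  let ?At = "\<lambda>f t. \<exists>t'. t = map to_nat t' \<and> At f t'"
  have "hom_free ?At"
    unfolding hom_free_def
  proof
    assume "\<exists>y. \<forall>f<s. ?At f (map y (V f))"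
    then obtain y where y: "\<And>f. f < s \<Longrightarrow> ?At f (map y (V f))" by blast
    have "At f (map (from_nat \<circ> y) (V f))" if f: "f < s" for f
    proof -
      obtain t' where t': "map y (V f) = map to_nat t'" "At f t'" using y[OF f] by blast
      have "map (from_nat \<circ> y) (V f) = map from_nat (map to_nat t')" unfolding t'(1)[symmetric] by simp
      also have "\<dots> = t'" by (simp add: map_idI)
      finally show ?thesis using t'(2) by simp
    qed
    then show False using free by blast
  qed
  moreover have "f < s \<and> length t = length (V f)" if "?At f t" for f t
    using that ar by auto
  ultimately obtain e where e: "\<forall>f t. ?At f t \<longrightarrow> map e t \<in> srel BB f"
    using BB_universal_nat[of ?At] by blast
  have "map (e \<circ> to_nat) t \<in> srel BB f" if "At f t" for f t
    using e that by (metis map_map)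
  then show ?thesis by blast
qed

text \<open>An instance is a finite structure on its variables, and a satisfying assignment is a
  homomorphism to \<open>BB\<close>. The query is an obstruction by \<open>hom_free_BB\<close>, and
  by universality it is the only one.\<close>

lemma csp_sat_BB:
  assumes "csp_instance BB inst"
  shows "csp_sat BB inst \<longleftrightarrow> \<not> (\<exists>y. \<forall>f<s. (f, map y (V f)) \<in> set inst)"
proof
  assume "csp_sat BB inst"
  then obtain a where a: "\<And>f vs. (f, vs) \<in> set inst \<Longrightarrow> map a vs \<in> srel BB f"
    by (fastforce simp: csp_sat_def)
  show "\<not> (\<exists>y. \<forall>f<s. (f, map y (V f)) \<in> set inst)"
  proof
    assume "\<exists>y. \<forall>f<s. (f, map y (V f)) \<in> set inst"
    then obtain y where "\<And>f. f < s \<Longrightarrow> (f, map y (V f)) \<in> set inst" by blast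
    then have "\<forall>f<s. map (a \<circ> y) (V f) \<in> srel BB f" using a by fastforce
    then show False using hom_free_BB by blast
  qed
next
  assume "\<not> (\<exists>y. \<forall>f<s. (f, map y (V f)) \<in> set inst)"
  then have "\<exists>e. \<forall>f t. (f, t) \<in> set inst \<longrightarrow> map e t \<in> srel BB f"
    using assms by (intro BB_universal) (auto simp: csp_instance_def)
  then show "csp_sat BB inst" by (fastforce simp: csp_sat_def)
qed

lemma csp_BB_in_P: "csp_in_P BB"
proof -
  interpret A: alg V s .
  have valid: "A.valid inst" if "csp_instance BB inst" for inst
    using that V_nonempty by (auto simp: A.valid_def csp_instance_def split: prod.splits)
  show ?thesis
    unfolding csp_in_P_def using A.hom_query_in_P[OF s_pos] valid csp_sat_BB by metis
qed

text \<open>Every list ends in a trivial equation, whose variable 0 is permitted as a free variable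
  because no relation of \<open>BB\<close> is nullary.\<close>

fun conj_list :: "nat fo list \<Rightarrow> nat fo" where
  "conj_list [] = FEq 0 0"
| "conj_list (\<phi> # \<phi>s) = FConj \<phi> (conj_list \<phi>s)"

lemma holds_conj_list: "holds S (conj_list \<phi>s) x \<longleftrightarrow> (\<forall>\<phi>\<in>set \<phi>s. holds S \<phi> x)"
  by (induction \<phi>s) auto

lemma fv_conj_list: "fv (conj_list \<phi>s) = insert 0 (\<Union>\<phi>\<in>set \<phi>s. fv \<phi>)"
  by (induction \<phi>s) auto

lemma syms_conj_list: "syms (conj_list \<phi>s) = (\<Union>\<phi>\<in>set \<phi>s. syms \<phi>)"
  by (induction \<phi>s) auto

lemma fo_reduct_BB: "fo_reduct BB CC"
  unfolding fo_reduct_def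
proof (intro conjI ballI)
  show "sdom BB = sdom CC" by (simp add: struct_of_def)
  fix f assume "f \<in> ssig BB"
  then have f: "f < s" by simp
  let ?n = "length (V f)" and ?T = "set (V f)"
  have "\<forall>v\<in>?T. \<exists>i<?n. V f ! i = v" by (metis in_set_conv_nth)
  then obtain ix where ix: "\<And>v. v \<in> ?T \<Longrightarrow> ix v < ?n \<and> V f ! ix v = v" by metis
  have n: "?n > 0" using V_nonempty[OF f] by simp
  have setE: "set [FEq p q. p \<leftarrow> [0..<?n], q \<leftarrow> [0..<?n], V f ! p = V f ! q] =
      {FEq p q | p q. p < ?n \<and> q < ?n \<and> V f ! p = V f ! q}"
    by auto
  define E where "E = conj_list [FEq p q. p \<leftarrow> [0..<?n], q \<leftarrow> [0..<?n], V f ! p = V f ! q]"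
  define r where "r = code {f} ?T"
  \<comment> \<open>In the available connectives this is the implication from \<open>E\<close> to
    the atom: \<open>E\<close> says that the list respects the repetitions in \<open>V f\<close>,
    and \<open>ix v\<close> is a place at which \<open>v\<close> occurs.\<close>
  define \<phi> where "\<phi> = FNeg (FConj E (FNeg (FRel r (map ix (sorted_list_of_set ?T)))))"
  have E: "holds S E x \<longleftrightarrow> (\<forall>p<?n. \<forall>q<?n. V f ! p = V f ! q \<longrightarrow> x p = x q)" for S :: "(nat, nat) rstruct" and x
  proof -
    have "holds S E x \<longleftrightarrow> (\<forall>\<phi>\<in>{FEq p q | p q. p < ?n \<and> q < ?n \<and> V f ! p = V f ! q}. holds S \<phi> x)"
      unfolding E_def holds_conj_list setE ..
    also have "\<dots> \<longleftrightarrow> (\<forall>p<?n. \<forall>q<?n. V f ! p = V f ! q \<longrightarrow> holds S (FEq p q) x)" by blast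
    finally show ?thesis by (simp only: holds.simps)
  qed
  have "fv \<phi> \<subseteq> {..<sar BB f}"
    using n ix unfolding \<phi>_def E_def fv.simps fv_conj_list setE by auto
  moreover have "syms \<phi> \<subseteq> ssig CC"
  proof -
    have "r \<in> sig" using wfp_single[OF f] V_nonempty[OF f] unfolding sig_def r_def by auto
    then show ?thesis unfolding \<phi>_def E_def syms.simps syms_conj_list setE by (auto simp: struct_of_def)
  qed
  moreover have "srel BB f = {xs. length xs = sar BB f \<and> set xs \<subseteq> sdom CC \<and> holds CC \<phi> (\<lambda>i. xs ! i)}"
  proof (rule set_eqI)
    fix xs :: "nat list"
    have "(\<forall>y. xs = map y (V f) \<longrightarrow> asserts gen {f} ?T y) \<longleftrightarrow> holds CC \<phi> (\<lambda>i. xs ! i)" if len: "length xs = ?n"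
    proof -
      have *: "xs = map y (V f) \<Longrightarrow> asserts gen {f} ?T y \<longleftrightarrow> (r, map (\<lambda>i. xs ! i) (map ix (sorted_list_of_set ?T))) \<in> gen" for y
      proof -
        assume xs: "xs = map y (V f)"
        have "map y (sorted_list_of_set ?T) = map (\<lambda>i. xs ! i) (map ix (sorted_list_of_set ?T))"
          unfolding map_map by (rule map_cong) (use ix xs in auto)
        moreover have "asserts gen {f} ?T y \<longleftrightarrow> (r, map y (sorted_list_of_set ?T)) \<in> gen"
          using V_nonempty[OF f] by (simp add: asserts_def fact_of_def r_def)
        ultimately show ?thesis by (simp only:)
      qed
      have "(\<exists>y. xs = map y (V f)) \<longleftrightarrow> holds CC E (\<lambda>i. xs ! i)"
      proof
        assume "holds CC E (\<lambda>i. xs ! i)"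
        then have e: "xs ! p = xs ! q" if "p < ?n" "q < ?n" "V f ! p = V f ! q" for p q
          using that unfolding E by blast
        have "xs = map (\<lambda>v. xs ! ix v) (V f)"
        proof (rule nth_equalityI)
          fix i assume "i < length xs"
          then have i: "i < ?n" using len by simp
          then show "xs ! i = map (\<lambda>v. xs ! ix v) (V f) ! i"
            using e[of i "ix (V f ! i)"] ix[of "V f ! i"] by simp
        qed (use len in simp)
        then show "\<exists>y. xs = map y (V f)" by blast
      next
        assume "\<exists>y. xs = map y (V f)"
        then obtain y where "xs = map y (V f)" by blast
        then show "holds CC E (\<lambda>i. xs ! i)" unfolding E by simp
      qed
      then show ?thesis using * by (auto simp: \<phi>_def struct_of_def)
    qed
    then show "xs \<in> srel BB f \<longleftrightarrow> xs \<in> {xs. length xs = sar BB f \<and> set xs \<subseteq> sdom CC \<and> holds CC \<phi> (\<lambda>i. xs ! i)}"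
      using f by (auto simp: in_BB struct_of_def)
  qed
  ultimately show "\<exists>\<phi>. fv \<phi> \<subseteq> {..<sar BB f} \<and> syms \<phi> \<subseteq> ssig CC \<and>
     srel BB f = {xs. length xs = sar BB f \<and> set xs \<subseteq> sdom CC \<and> holds CC \<phi> (\<lambda>i. xs ! i)}" by blast
qed

end

section \<open>Quasi near-unanimity polymorphisms\<close>

lemma Pol_preserves:
  assumes "g \<in> Pol B n" "r \<in> ssig B" "length ts = n" "set ts \<subseteq> srel B r"
  shows "map (\<lambda>j. g (map (\<lambda>t. t ! j) ts)) [0..<sar B r] \<in> srel B r"
  using assms by (simp add: Pol_def)

definition near_const :: "'a list \<Rightarrow> 'a \<Rightarrow> bool" where
  "near_const xs a \<longleftrightarrow> (\<exists>j. \<forall>i<length xs. i \<noteq> j \<longrightarrow> xs ! i = a)"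

text \<open>Describes a quotient of the power: near-constant lists are identified with constant
  ones, and all other lists stay as they are.\<close>

definition majority :: "'a list \<Rightarrow> 'a list" where
  "majority xs = (if \<exists>a. near_const xs a then replicate (length xs) (SOME a. near_const xs a) else xs)"

text \<open>Two exceptional positions cannot cover three coordinates.\<close>

lemma near_const_unique:
  assumes "near_const xs a" "near_const xs b" "length xs \<ge> 3"
  shows "a = b"
proof -
  obtain j l where j: "\<forall>i<length xs. i \<noteq> j \<longrightarrow> xs ! i = a" and l: "\<forall>i<length xs. i \<noteq> l \<longrightarrow> xs ! i = b"
    using assms unfolding near_const_def by blast
  have "card {j, l} < card {..<length xs}" using assms(3) card_insert_le_m1[of 2 "{l}" j] by simp
  then obtain i where "i < length xs" "i \<notin> {j, l}"
    by (metis card_mono finite.emptyI finite_insert lessThan_iff not_le subsetI)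
  then show ?thesis using j l by auto
qed

lemma majority_near_const:
  assumes "near_const xs a" "length xs \<ge> 3"
  shows "majority xs = replicate (length xs) a"
proof -
  have "near_const xs (SOME a. near_const xs a)" using assms(1) by (rule someI)
  then have "(SOME a. near_const xs a) = a" using assms by (rule near_const_unique)
  then show ?thesis using assms(1) by (auto simp: majority_def)
qed

lemma majority_differs_once: "\<exists>j. \<forall>i<length xs. i \<noteq> j \<longrightarrow> majority xs ! i = xs ! i"
proof (cases "\<exists>a. near_const xs a")
  case True
  then have "near_const xs (SOME a. near_const xs a)" by (rule someI_ex)
  then obtain j where "\<forall>i<length xs. i \<noteq> j \<longrightarrow> xs ! i = (SOME a. near_const xs a)"
    unfolding near_const_def[of xs "SOME a. near_const xs a"] by blast
  then show ?thesis using True by (auto simp: majority_def intro!: exI[of _ j])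
qed (simp add: majority_def)

text \<open>The quasi near-unanimity condition \<open>f(x,..,y,..,x) = f(x,..,x)\<close>, one
  identity for each position of \<open>y\<close>; the symbol is 0, and \<open>x\<close>,
  \<open>y\<close> are the variables 0 and 1.\<close>

definition qnu :: "nat \<Rightarrow> nat h1cond" where
  "qnu n = ((\<lambda>_. n), map (\<lambda>i. (0, (replicate n 0)[i := 1], 0, replicate n 0)) [0..<n])"

lemma qnu_wf: "n \<ge> 1 \<Longrightarrow> h1_wf (qnu n)"
  by (auto simp: h1_wf_def qnu_def)

lemma qnu_nontrivial:
  assumes "n \<ge> 1" shows "\<not> h1_trivial (qnu n)"
proof
  assume "h1_trivial (qnu n)"
  then obtain I :: "nat \<Rightarrow> bool list \<Rightarrow> bool" where
    all: "\<forall>(f, \<pi>, g, \<rho>)\<in>set (snd (qnu n)). I f \<in> proj_ops (fst (qnu n) f) \<and> I g \<in> proj_ops (fst (qnu n) g)"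
      "\<forall>(f, \<pi>, g, \<rho>)\<in>set (snd (qnu n)). \<forall>x. (\<forall>i. x i \<in> UNIV) \<longrightarrow> I f (map x \<pi>) = I g (map x \<rho>)"
    unfolding h1_trivial_def satisfies_def by (elim exE conjE) (rule that)
  have mem: "(0, (replicate n 0)[i := 1], 0, replicate n 0) \<in> set (snd (qnu n))" if "i < n" for i
    using that by (simp add: qnu_def)
  have P: "I 0 \<in> proj_ops n" using bspec[OF all(1) mem[of 0]] assms by (simp add: qnu_def)
  have I: "I 0 (map x ((replicate n 0)[i := 1])) = I 0 (map x (replicate n 0))" if "i < n" for i and x :: "nat \<Rightarrow> bool"
    using bspec[OF all(2) mem[OF that]] by simp
  obtain i where i: "i < n" "I 0 = (\<lambda>xs. if length xs = n then xs ! i else undefined)"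
    using P by (auto simp: proj_ops_def)
  show False using I[OF i(1), of "\<lambda>v. v = 1"] i by simp
qed

text \<open>The two binary minors of \<open>F\<close> coincide, whereas those of the projection to
  \<open>i\<close> are different projections; \<open>[False, True]\<close> separates them.\<close>

lemma qnu_no_minion_hom:
  assumes "n \<ge> 1" "F \<in> Pol B n"
    and qnu: "\<And>i x. i < n \<Longrightarrow> (\<And>v. x v \<in> sdom B) \<Longrightarrow> F (map x ((replicate n 0)[i := 1])) = F (map x (replicate n (0::nat)))"
  shows "\<not> (\<exists>\<xi>. minion_hom_to_P B \<xi>)"
proof
  assume "\<exists>\<xi>. minion_hom_to_P B \<xi>"
  then obtain \<xi> where \<xi>: "\<xi> n F \<in> proj_ops n"
    "\<And>\<pi>. length \<pi> = n \<Longrightarrow> set \<pi> \<subseteq> {..<2} \<Longrightarrow> \<xi> 2 (minor (sdom B) 2 \<pi> F) = minor UNIV 2 \<pi> (\<xi> n F)"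
    using assms(2) unfolding minion_hom_to_P_def by (metis one_le_numeral)
  obtain i where i: "i < n" "\<xi> n F = (\<lambda>xs. if length xs = n then xs ! i else undefined)"
    using \<xi>(1) by (auto simp: proj_ops_def)
  let ?p = "(replicate n 0)[i := 1 :: nat]" and ?c = "replicate n (0 :: nat)"
  have sub: "set ?p \<subseteq> {..<2}" "set ?c \<subseteq> {..<2}"
    using set_update_subset_insert[of ?c i 1] by auto
  have "minor (sdom B) 2 ?p F = minor (sdom B) 2 ?c F"
  proof
    fix ys :: "'a list"
    show "minor (sdom B) 2 ?p F ys = minor (sdom B) 2 ?c F ys"
    proof (cases "length ys = 2 \<and> set ys \<subseteq> sdom B")
      case True
      let ?x = "\<lambda>v. if v < 2 then ys ! v else ys ! 0"
      have "?x v \<in> sdom B" for v using True nth_mem[of v ys] nth_mem[of 0 ys] by auto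
      then have "F (map ?x ?p) = F (map ?x ?c)" by (intro qnu[OF i(1)])
      moreover have "map ?x ?p = map (\<lambda>i. ys ! i) ?p" "map ?x ?c = map (\<lambda>i. ys ! i) ?c"
        using sub by (auto intro!: map_cong)
      ultimately have "F (map (\<lambda>i. ys ! i) ?p) = F (map (\<lambda>i. ys ! i) ?c)" by (simp only:)
      then show ?thesis using True by (simp only: minor_def if_True simp_thms)
    qed (auto simp: minor_def)
  qed
  then have "minor UNIV 2 ?p (\<xi> n F) = minor UNIV 2 ?c (\<xi> n F)"
    using \<xi>(2)[of ?p] \<xi>(2)[of ?c] sub by simp
  then have "minor UNIV 2 ?p (\<xi> n F) [False, True] = minor UNIV 2 ?c (\<xi> n F) [False, True]" by simp
  then show False using i by (simp add: minor_def)
qed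

context query
begin

definition total_arity :: nat where "total_arity = (\<Sum>f<s. length (V f))"

text \<open>By universality it suffices that the query fails in the quotient of the
  \<open>n\<close>-th power of \<open>BB\<close> given by \<open>majority\<close>: a homomorphism
  from this quotient to \<open>BB\<close>, composed with \<open>majority\<close>, is the
  operation.\<close>

lemma qnu_polymorphism:
  assumes n: "n \<ge> 3" "n > total_arity"
  shows "\<exists>F\<in>Pol BB n. \<forall>xs a. length xs = n \<longrightarrow> near_const xs a \<longrightarrow> F xs = F (replicate n a)"
proof -
  define At :: "nat \<Rightarrow> nat list list \<Rightarrow> bool" where
    "At f ts \<longleftrightarrow> f < s \<and> (\<exists>rows. length rows = length (V f) \<and> (\<forall>r\<in>set rows. length r = n) \<and>
       ts = map majority rows \<and> (\<forall>i<n. map (\<lambda>r. r ! i) rows \<in> srel BB f))" for f ts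
  have "\<not> (\<exists>y. \<forall>f<s. At f (map y (V f)))"
  proof
    assume "\<exists>y. \<forall>f<s. At f (map y (V f))"
    then obtain y where "\<forall>f. f < s \<longrightarrow> At f (map y (V f))" by blast
    then obtain rows where rows: "\<And>f. f < s \<Longrightarrow> length (rows f) = length (V f)"
      "\<And>f r. f < s \<Longrightarrow> r \<in> set (rows f) \<Longrightarrow> length r = n"
      "\<And>f. f < s \<Longrightarrow> map y (V f) = map majority (rows f)"
      "\<And>f i. f < s \<Longrightarrow> i < n \<Longrightarrow> map (\<lambda>r. r ! i) (rows f) \<in> srel BB f"
      unfolding At_def by metis
    \<comment> \<open>There are more coordinates than rows, so some coordinate is changed by no majority.\<close>
    obtain ex :: "nat list \<Rightarrow> nat" where ex: "\<And>xs i. i < length xs \<Longrightarrow> i \<noteq> ex xs \<Longrightarrow> majority xs ! i = xs ! i"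
      using majority_differs_once by metis
    let ?E = "\<Union>f<s. ex ` set (rows f)"
    have "card ?E \<le> (\<Sum>f<s. card (ex ` set (rows f)))" by (rule card_UN_le) simp
    also have "\<dots> \<le> (\<Sum>f<s. length (V f))"
    proof (rule sum_mono)
      fix f assume "f \<in> {..<s}"
      then have "length (rows f) = length (V f)" using rows(1) by simp
      then show "card (ex ` set (rows f)) \<le> length (V f)"
        using card_image_le[of "set (rows f)" ex] card_length[of "rows f"] by simp
    qed
    finally have "card ?E < card {..<n}" using n(2) by (simp add: total_arity_def)
    moreover have "finite ?E" by auto
    ultimately have "\<not> {..<n} \<subseteq> ?E" using card_mono leD by blast
    then obtain i where i: "i < n" "i \<notin> ?E" by blast
    have "map (\<lambda>v. y v ! i) (V f) \<in> srel BB f" if f: "f < s" for f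
    proof -
      have "map (\<lambda>v. y v ! i) (V f) = map (\<lambda>r. r ! i) (map y (V f))" by simp
      also have "\<dots> = map (\<lambda>r. majority r ! i) (rows f)" unfolding rows(3)[OF f] by simp
      also have "\<dots> = map (\<lambda>r. r ! i) (rows f)"
      proof (rule map_cong)
        fix r assume r: "r \<in> set (rows f)"
        then have "i \<noteq> ex r" using i(2) f by blast
        then show "majority r ! i = r ! i" using ex[of i r] rows(2)[OF f r] i(1) by simp
      qed simp
      finally show ?thesis using rows(4)[OF f i(1)] by simp
    qed
    then show False using hom_free_BB by blast
  qed
  moreover have "f < s \<and> length t = length (V f)" if "At f t" for f t
    using that by (auto simp: At_def)
  ultimately obtain e where e: "\<And>f t. At f t \<Longrightarrow> map e t \<in> srel BB f"
    using BB_universal[of At] by metis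
  define F where "F xs = (if length xs = n then e (majority xs) else undefined)" for xs
  have "F \<in> Pol BB n"
    unfolding Pol_def
  proof (intro CollectI conjI ballI allI impI)
    fix f ts assume f: "f \<in> ssig BB" and ts: "length ts = n \<and> set ts \<subseteq> srel BB f"
    let ?rows = "map (\<lambda>j. map (\<lambda>t. t ! j) ts) [0..<length (V f)]"
    have len: "length t = length (V f)" if "t \<in> set ts" for t using that ts f in_BB by auto
    have "At f (map majority ?rows)"
      unfolding At_def
    proof (intro conjI exI[of _ ?rows] allI impI)
      fix i assume i: "i < n"
      then have "ts ! i \<in> set ts" using ts by simp
      moreover have "map (\<lambda>r. r ! i) ?rows = map (\<lambda>j. ts ! i ! j) [0..<length (V f)]"
        using i ts by simp
      moreover have "\<dots> = ts ! i" using len[OF \<open>ts ! i \<in> set ts\<close>] map_nth[of "ts ! i"] by simp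
      ultimately show "map (\<lambda>r. r ! i) ?rows \<in> srel BB f" using ts by auto
    qed (use f ts in auto)
    from e[OF this] show "map (\<lambda>j. F (map (\<lambda>t. t ! j) ts)) [0..<sar BB f] \<in> srel BB f"
      using ts by (simp add: F_def o_def)
  qed (use n in \<open>auto simp: ext_op_def F_def\<close>)
  moreover have "F xs = F (replicate n a)" if "length xs = n" "near_const xs a" for xs a
  proof -
    have "near_const (replicate n a) a" by (simp add: near_const_def)
    then show ?thesis
      using that n(1) majority_near_const[of xs a] majority_near_const[of "replicate n a" a] by (simp add: F_def)
  qed
  ultimately show ?thesis by blast
qed

lemma BB_satisfies_qnu:
  "\<exists>n\<ge>1. satisfies (sdom BB) (Pol BB) (qnu n) \<and> \<not> (\<exists>\<xi>. minion_hom_to_P BB \<xi>)"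
proof -
  \<comment> \<open>At least 3, for uniqueness of the majority value, and above the number of places
    of the query.\<close>
  let ?n = "total_arity + 3"
  obtain F where F: "F \<in> Pol BB ?n" "\<And>xs a. length xs = ?n \<Longrightarrow> near_const xs a \<Longrightarrow> F xs = F (replicate ?n a)"
    using qnu_polymorphism[of ?n] by auto
  have q: "F (map x ((replicate ?n 0)[i := 1])) = F (map x (replicate ?n (0::nat)))" for i and x :: "nat \<Rightarrow> nat"
  proof -
    have "near_const (map x ((replicate ?n 0)[i := 1])) (x 0)"
      by (auto simp: near_const_def intro!: exI[of _ i])
    then show ?thesis using F(2)[of "map x ((replicate ?n 0)[i := 1])" "x 0"] by simp
  qed
  have "satisfies (sdom BB) (Pol BB) (qnu ?n)"
    unfolding satisfies_def using F(1) q by (intro exI[of _ "\<lambda>_. F"]) (simp add: qnu_def)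
  moreover have "\<not> (\<exists>\<xi>. minion_hom_to_P BB \<xi>)"
    by (rule qnu_no_minion_hom[OF _ F(1)]) (use q in auto)
  ultimately show ?thesis by (intro exI[of _ ?n]) simp
qed

end

section \<open>The query of a non-trivial height 1 condition\<close>

locale nontrivial_condition =
  fixes \<Sigma> :: "'f h1cond"
  assumes wf: "h1_wf \<Sigma>" and nontrivial: "\<not> h1_trivial \<Sigma>"
begin

abbreviation "ids \<equiv> snd \<Sigma>"
abbreviation "ar \<equiv> fst \<Sigma>"

definition symbols :: "'f set" where
  "symbols = (\<Union>(f, \<pi>, g, \<rho>)\<in>set ids. {f, g})"

text \<open>An identity with \<open>f\<close> on both sides contributes two entries, so a variable
  of the query may be repeated within one atom.\<close>

definition sides :: "'f \<Rightarrow> (nat \<times> nat list) list" where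
  "sides f = concat (map (\<lambda>i. case ids ! i of (f', \<pi>, g, \<rho>) \<Rightarrow>
     (if f' = f then [(i, \<pi>)] else []) @ (if g = f then [(i, \<rho>)] else [])) [0..<length ids])"

lemma set_sides: "(i, \<sigma>) \<in> set (sides f) \<longleftrightarrow> i < length ids \<and>
    (case ids ! i of (f', \<pi>, g, \<rho>) \<Rightarrow> f' = f \<and> \<sigma> = \<pi> \<or> g = f \<and> \<sigma> = \<rho>)"
proof -
  have "(i, \<sigma>) \<in> set (case ids ! j of (f', \<pi>, g, \<rho>) \<Rightarrow>
      (if f' = f then [(j, \<pi>)] else []) @ (if g = f then [(j, \<rho>)] else [])) \<longleftrightarrow>
    i = j \<and> (case ids ! i of (f', \<pi>, g, \<rho>) \<Rightarrow> f' = f \<and> \<sigma> = \<pi> \<or> g = f \<and> \<sigma> = \<rho>)" for j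
    by (cases "ids ! j") auto
  then show ?thesis by (auto simp: sides_def)
qed

lemma sides_length: "(i, \<sigma>) \<in> set (sides f) \<Longrightarrow> length \<sigma> = ar f \<and> ar f \<ge> 1"
  using wf nth_mem[of i ids] unfolding set_sides h1_wf_def by (fastforce split: prod.splits)

text \<open>\<open>c f\<close> is the coordinate to which \<open>f\<close> is projected, \<open>y i\<close> the resulting common value of the two
  sides of identity \<open>i\<close>.\<close>

definition solvable :: "'f set \<Rightarrow> bool" where
  "solvable P \<longleftrightarrow> (\<exists>(y :: nat \<Rightarrow> nat) c. \<forall>f\<in>P. c f < ar f \<and> (\<forall>(i, \<sigma>)\<in>set (sides f). y i = \<sigma> ! c f))"

lemma finite_symbols: "finite symbols"
  by (auto simp: symbols_def split: prod.splits)

lemma sides_nonempty: "f \<in> symbols \<Longrightarrow> sides f \<noteq> []"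
proof -
  assume "f \<in> symbols"
  then obtain q where q: "q \<in> set ids" "case q of (f', \<pi>, g, \<rho>) \<Rightarrow> f = f' \<or> f = g"
    by (auto simp: symbols_def)
  then obtain i where i: "i < length ids" "ids ! i = q" by (metis in_set_conv_nth)
  obtain f' \<pi> g \<rho> where "q = (f', \<pi>, g, \<rho>)" by (rule prod_cases4)
  then have "(i, \<pi>) \<in> set (sides f) \<or> (i, \<rho>) \<in> set (sides f)" using q i by (auto simp: set_sides)
  then show ?thesis by auto
qed

text \<open>The common value of the two sides of an identity says that both chosen projections pick
  the same variable.\<close>

lemma not_solvable: "\<not> solvable symbols"
proof
  assume "solvable symbols"
  then obtain y :: "nat \<Rightarrow> nat" and c where c: "\<And>f. f \<in> symbols \<Longrightarrow> c f < ar f"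
    "\<And>f i \<sigma>. f \<in> symbols \<Longrightarrow> (i, \<sigma>) \<in> set (sides f) \<Longrightarrow> y i = \<sigma> ! c f"
    unfolding solvable_def by blast
  define I where "I f = (\<lambda>xs::bool list. if length xs = ar f then xs ! c f else undefined)" for f
  have "h1_trivial \<Sigma>"
    unfolding h1_trivial_def satisfies_def
  proof (intro exI[of _ I] conjI ballI, goal_cases)
    case (1 q)
    then show ?case using c(1) by (force simp: symbols_def proj_ops_def I_def split: prod.splits)
  next
    case (2 q)
    obtain f \<pi> g \<rho> where q: "q = (f, \<pi>, g, \<rho>)" by (rule prod_cases4)
    obtain i where i: "i < length ids" "ids ! i = q" using 2 by (metis in_set_conv_nth)
    have fg: "f \<in> symbols" "g \<in> symbols" using 2 q by (force simp: symbols_def)+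
    have m: "(i, \<pi>) \<in> set (sides f)" "(i, \<rho>) \<in> set (sides g)" using i q by (auto simp: set_sides)
    have "\<pi> ! c f = \<rho> ! c g" using c(2)[OF fg(1) m(1)] c(2)[OF fg(2) m(2)] by simp
    then show ?case using c(1) fg sides_length[OF m(1)] sides_length[OF m(2)] by (simp add: q I_def)
  qed
  then show False using nontrivial by simp
qed

definition core :: "'f set" where
  "core = (SOME P. P \<subseteq> symbols \<and> \<not> solvable P \<and> (\<forall>Q. Q \<subset> P \<longrightarrow> solvable Q))"

lemma core: "core \<subseteq> symbols" "\<not> solvable core" "Q \<subset> core \<Longrightarrow> solvable Q"
proof -
  have "\<exists>P. P \<subseteq> A \<and> \<not> solvable P \<and> (\<forall>Q. Q \<subset> P \<longrightarrow> solvable Q)" if "finite A" "\<not> solvable A" for A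
    using that
  proof (induction A rule: finite_psubset_induct)
    case (psubset A)
    show ?case
    proof (cases "\<forall>Q. Q \<subset> A \<longrightarrow> solvable Q")
      case True
      then show ?thesis using psubset.prems by blast
    next
      case False
      then obtain Q where Q: "Q \<subset> A" "\<not> solvable Q" by blast
      from psubset.IH[OF this] show ?thesis using Q(1) by (meson order_trans psubset_imp_subset)
    qed
  qed
  from someI_ex[OF this[OF finite_symbols not_solvable], folded core_def]
  show "core \<subseteq> symbols" "\<not> solvable core" "Q \<subset> core \<Longrightarrow> solvable Q" by auto
qed

text \<open>Solutions for two proper subsets without common identities could be combined, against
  minimality. Such subsets are indeed proper: they are disjoint, since every symbol occurs in some
  identity.\<close>

lemma core_connected:
  assumes "P1 \<union> P2 = core" "P1 \<noteq> {}" "P2 \<noteq> {}"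
  shows "(\<Union>f\<in>P1. fst ` set (sides f)) \<inter> (\<Union>f\<in>P2. fst ` set (sides f)) \<noteq> {}"
proof
  let ?v = "\<lambda>P. \<Union>f\<in>P. fst ` set (sides f)"
  assume dis: "?v P1 \<inter> ?v P2 = {}"
  have "P1 \<inter> P2 = {}"
  proof (rule ccontr)
    assume "P1 \<inter> P2 \<noteq> {}"
    then obtain f where f: "f \<in> P1" "f \<in> P2" by blast
    then have "sides f \<noteq> []" using assms(1) core(1) sides_nonempty by blast
    then have "fst (hd (sides f)) \<in> fst ` set (sides f)" by simp
    then show False using dis f by blast
  qed
  then have "P1 \<subset> core" "P2 \<subset> core" using assms by auto
  then have "solvable P1" "solvable P2" using core(3) by auto
  then obtain y1 y2 :: "nat \<Rightarrow> nat" and c1 c2 where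
    1: "\<And>f. f \<in> P1 \<Longrightarrow> c1 f < ar f" "\<And>f i \<sigma>. f \<in> P1 \<Longrightarrow> (i, \<sigma>) \<in> set (sides f) \<Longrightarrow> y1 i = \<sigma> ! c1 f" and
    2: "\<And>f. f \<in> P2 \<Longrightarrow> c2 f < ar f" "\<And>f i \<sigma>. f \<in> P2 \<Longrightarrow> (i, \<sigma>) \<in> set (sides f) \<Longrightarrow> y2 i = \<sigma> ! c2 f"
    unfolding solvable_def by (elim exE) blast
  define y where "y i = (if i \<in> ?v P1 then y1 i else y2 i)" for i
  define c where "c f = (if f \<in> P1 then c1 f else c2 f)" for f
  have "c f < ar f \<and> (\<forall>(i, \<sigma>)\<in>set (sides f). y i = \<sigma> ! c f)" if f: "f \<in> core" for f
  proof (cases "f \<in> P1")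
    case True
    then show ?thesis using 1 by (force simp: y_def c_def)
  next
    case False
    then have f2: "f \<in> P2" using f assms(1) by blast
    have "y i = \<sigma> ! c f" if "(i, \<sigma>) \<in> set (sides f)" for i \<sigma>
    proof -
      have "i \<in> ?v P2" using f2 that by force
      then have "i \<notin> ?v P1" using dis by blast
      then show ?thesis using False 2(2)[OF f2 that] by (simp add: y_def c_def)
    qed
    then show ?thesis using False 2(1)[OF f2] by (auto simp: c_def)
  qed
  then have "solvable core" unfolding solvable_def by blast
  then show False using core(2) by blast
qed

end

theorem theorem1p3:
  fixes \<Sigma> :: "'f h1cond"
  assumes "h1_wf \<Sigma>" and "\<not> h1_trivial \<Sigma>"
  shows "\<exists>(B :: (nat, nat) rstruct) (C :: (nat, nat) rstruct).
    wf_struct B \<and> finite (ssig B) \<and>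
    wf_struct C \<and> homogeneous C \<and> finitely_bounded C \<and> fo_reduct B C \<and>
    \<not> satisfies (sdom B) (Pol B) \<Sigma> \<and>
    (\<exists>\<Sigma>' :: nat h1cond. h1_wf \<Sigma>' \<and> \<not> h1_trivial \<Sigma>' \<and> satisfies (sdom B) (Pol B) \<Sigma>') \<and>
    \<not> (\<exists>\<xi>. minion_hom_to_P B \<xi>) \<and>
    csp_in_P B"
proof -
  interpret nontrivial_condition \<Sigma> by unfold_locales (fact assms)+
  have fin: "finite core" using core(1) finite_symbols finite_subset by blast
  obtain h where h: "bij_betw h {..<card core} core"
    using ex_bij_betw_nat_finite[OF fin] atLeast0LessThan by auto
  define s where "s = card core"
  define V where "V i = map fst (sides (h i))" for i
  have hs: "h ` {..<s} = core" using h by (simp add: bij_betw_def s_def)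
  have "core \<noteq> {}" using core(2) by (auto simp: solvable_def)
  interpret query V s
  proof
    show "s > 0" using \<open>core \<noteq> {}\<close> fin by (simp add: s_def card_gt_0_iff)
    show "V i \<noteq> []" if "i < s" for i
      using that hs core(1) sides_nonempty[of "h i"] by (auto simp: V_def)
    show "(\<Union>f\<in>P1. set (V f)) \<inter> (\<Union>f\<in>P2. set (V f)) \<noteq> {}"
      if "P1 \<union> P2 = {..<s}" "P1 \<noteq> {}" "P2 \<noteq> {}" for P1 P2
      using core_connected[of "h ` P1" "h ` P2"] that hs by (simp add: V_def image_Un[symmetric])
  qed
  have "\<not> satisfies (sdom BB) (Pol BB) \<Sigma>"
  proof
    assume "satisfies (sdom BB) (Pol BB) \<Sigma>"
    then obtain I where
      "\<forall>(f, \<pi>, g, \<rho>)\<in>set ids. I f \<in> Pol BB (ar f) \<and> I g \<in> Pol BB (ar g)"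
      "\<forall>(f, \<pi>, g, \<rho>)\<in>set ids. \<forall>x. (\<forall>i. x i \<in> sdom BB) \<longrightarrow> I f (map x \<pi>) = I g (map x \<rho>)"
      unfolding satisfies_def by (elim exE conjE) (rule that)
    then have I: "(f, \<pi>, g, \<rho>) \<in> set ids \<Longrightarrow> I f \<in> Pol BB (ar f) \<and> I g \<in> Pol BB (ar g)"
      "(f, \<pi>, g, \<rho>) \<in> set ids \<Longrightarrow> I f (map x \<pi>) = I g (map x \<rho>)" for f \<pi> g \<rho> x
      by auto
    define At where "At i t \<longleftrightarrow> i < s \<and> (\<exists>c<ar (h i). t = map (\<lambda>(i, \<sigma>). \<sigma> ! c) (sides (h i)))" for i and t :: "nat list"
    have "\<not> (\<exists>y. \<forall>i<s. At i (map y (V i)))"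
    proof
      assume "\<exists>y. \<forall>i<s. At i (map y (V i))"
      then obtain y where y: "\<And>i. i < s \<Longrightarrow> At i (map y (V i))" by blast
      have "\<exists>c<ar f. \<forall>(i, \<sigma>)\<in>set (sides f). y i = \<sigma> ! c" if "f \<in> core" for f
      proof -
        obtain i where i: "i < s" "f = h i" using \<open>f \<in> core\<close> hs by blast
        then obtain c where "c < ar f" "map y (map fst (sides f)) = map (\<lambda>(i, \<sigma>). \<sigma> ! c) (sides f)"
          using y[OF i(1)] by (auto simp: At_def V_def)
        then show ?thesis by (intro exI[of _ c]) auto
      qed
      then have "solvable core" unfolding solvable_def by metis
      then show False using core(2) by simp
    qed
    moreover have "i < s \<and> length t = length (V i)" if "At i t" for i t
      using that by (auto simp: At_def V_def)
    ultimately obtain a where a: "\<And>i t. At i t \<Longrightarrow> map a t \<in> srel BB i"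
      using BB_universal[of At] by metis
    \<comment> \<open>The supposed operations, applied to the image of the variables under
      \<open>a\<close>, give each identity one value; the left side may be evaluated because the
      identities hold.\<close>
    define y where "y i = (case ids ! i of (f, \<pi>, g, \<rho>) \<Rightarrow> I f (map a \<pi>))" for i
    have y: "y i = I f (map a \<sigma>)" if "(i, \<sigma>) \<in> set (sides f)" for i \<sigma> f
    proof -
      obtain f' \<pi> g \<rho> where e: "ids ! i = (f', \<pi>, g, \<rho>)" by (rule prod_cases4)
      have "(f', \<pi>, g, \<rho>) \<in> set ids" using that nth_mem[of i ids] e by (simp add: set_sides)
      from I(2)[OF this] show ?thesis using that e by (auto simp: set_sides y_def)
    qed
    have "map y (V i) \<in> srel BB i" if i: "i < s" for i
    proof -
      let ?f = "h i"
      have "?f \<in> symbols" using i hs core(1) by blast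
      then obtain f \<pi> g \<rho> where "(f, \<pi>, g, \<rho>) \<in> set ids" "?f = f \<or> ?f = g" by (auto simp: symbols_def)
      then have P: "I ?f \<in> Pol BB (ar ?f)" using I(1) by blast
      \<comment> \<open>One tuple for each argument of the symbol. The \<open>j\<close>-th entries
        of these tuples are the arguments at its \<open>j\<close>-th occurrence, mapped by
        \<open>a\<close>, so the polymorphism returns the values of \<open>y\<close> along
        \<open>V i\<close>.\<close>
      let ?ts = "map (\<lambda>c. map (\<lambda>(i, \<sigma>). a (\<sigma> ! c)) (sides ?f)) [0..<ar ?f]"
      have "set ?ts \<subseteq> srel BB i"
      proof
        fix t assume "t \<in> set ?ts"
        then obtain c where c: "c < ar ?f" "t = map a (map (\<lambda>(i, \<sigma>). \<sigma> ! c) (sides ?f))"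
          by (auto simp: case_prod_unfold)
        then show "t \<in> srel BB i" unfolding c(2) using i by (intro a) (auto simp: At_def)
      qed
      then have "map (\<lambda>j. I ?f (map (\<lambda>t. t ! j) ?ts)) [0..<length (V i)] \<in> srel BB i"
        using Pol_preserves[OF P, of i ?ts] i by (simp only: BB_simps length_map length_upt lessThan_iff diff_zero)
      moreover have "map (\<lambda>j. I ?f (map (\<lambda>t. t ! j) ?ts)) [0..<length (V i)] = map y (V i)"
      proof (rule nth_equalityI)
        fix j assume "j < length (map (\<lambda>j. I ?f (map (\<lambda>t. t ! j) ?ts)) [0..<length (V i)])"
        then have j: "j < length (sides ?f)" by (simp add: V_def)
        obtain e \<sigma> where e: "sides ?f ! j = (e, \<sigma>)" by (rule prod.exhaust)
        then have m: "(e, \<sigma>) \<in> set (sides ?f)" using j nth_mem by metis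
        have "map (\<lambda>t. t ! j) ?ts = map (\<lambda>c. a (\<sigma> ! c)) [0..<length \<sigma>]"
          using j e sides_length[OF m] by simp
        also have "\<dots> = map a \<sigma>" by (intro nth_equalityI) auto
        finally show "map (\<lambda>j. I ?f (map (\<lambda>t. t ! j) ?ts)) [0..<length (V i)] ! j = map y (V i) ! j"
          using j e y[OF m] by (simp add: V_def)
      qed simp
      ultimately show ?thesis by simp
    qed
    then show False using hom_free_BB by blast
  qed
  moreover obtain n where n: "n \<ge> 1" "satisfies (sdom BB) (Pol BB) (qnu n)" "\<not> (\<exists>\<xi>. minion_hom_to_P BB \<xi>)"
    using BB_satisfies_qnu by blast
  moreover have "\<exists>\<Sigma>' :: nat h1cond. h1_wf \<Sigma>' \<and> \<not> h1_trivial \<Sigma>' \<and> satisfies (sdom BB) (Pol BB) \<Sigma>'"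
    using n(2) qnu_wf[OF n(1)] qnu_nontrivial[OF n(1)] by blast
  moreover have "finite (ssig BB)" by simp
  ultimately show ?thesis
    using wf_BB CC_props(3) homogeneous_CC finitely_bounded_CC fo_reduct_BB csp_BB_in_P
    by (intro exI[of _ BB] exI[of _ CC] conjI)
qed

end
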